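(* (1) $\textsc{Decide}(\Sigma_G)$ can be decided in time $\mathcal O(\mathrm{ar}(\mathbf A)\, \| \mathbf A \|^{2|G|})$ for every (finite) regular permutation group $G \leq \mathrm{Sym}(G)$. (2) For a fixed $n\in \mathbb{N}$ with $n\geq 2$, the existence of an $n$-ary cyclic term, i.e. the problem $\textsc{Decide}(\Sigma_{\mathbb{Z}_n})$, can be decided in time $\mathcal O(\mathrm{ar}(\mathbf A)\, \| \mathbf A \|^{2 p})$, where $p$ is the largest prime divisor of $n$.
   Context: A finite algebra $\mathbf A=(A,f_1,\dots,f_r)$ is a finite non-empty set $A$ with a finite list of finitary operations $f_i\colon A^{k_i}\to A$. $\mathrm{ar}(\mathbf A)$ is the maximal arity of a basic operation, and $\|\mathbf A\|=\sum_{i=1}^r|A|^{k_i}$ is the input size when the algebra is given by its operation tables. $\mathsf{Clo}(\mathbf A)$ is the set of term operations of $\mathbf A$, i.e. all operations obtained by composing basic operations and projections. All permutation groups act on finite sets. For $G \leq \mathrm{Sym}(X)$, $X$ finite, and $t\colon A^X\to A$, write $t^\pi((x_i)_{i\in X}) = t((x_{\pi(i)})_{i\in X})$. $\Sigma_G$ is the set of identities $t\approx t^\pi$, $\pi\in G$; $\mathbf A$ satisfies $\Sigma_G$ if there is an $X$-ary $t\in\mathsf{Clo}(\mathbf A)$ with $t(\overline x)=t^\pi(\overline x)$ for all $\pi\in G$ and $\overline x\in A^X$. $\textsc{Decide}(\Sigma)$ is the decision problem: given a finite algebra $\mathbf A$ (by operation tables), decide whether $\mathbf A$ satisfies $\Sigma$.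 The group is fixed and not part of the input; implicit constants may depend on it. A regular permutation group $G\leq\mathrm{Sym}(G)$ is a group acting on itself by left translation. $\mathbb Z_n\leq\mathrm{Sym}(n)$ is the group generated by the cyclic shift $(1,2,\dots,n)$; a $\mathbb Z_n$-term is an $n$-ary cyclic term, $c(x_1,x_2,\ldots,x_n)\approx c(x_2,\ldots,x_n,x_1)$. *)

theory Defs
  imports
    "HOL-Library.FuncSet"
    "HOL-Computational_Algebra.Primes"
    "HOL-Algebra.Bij"
    "HOL-Algebra.Generated_Groups"
begin

section \<open>Finite algebras and term operations\<close>

text \<open>
  A basic operation of arity \<open>k\<close> is a pair \<open>(k, f)\<close>; only the values of \<open>f\<close> on lists of
  length \<open>k\<close> over the universe matter.
\<close>

record 'a op_algebra =
  univ :: "'a set"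
  basic_ops :: "(nat \<times> ('a list \<Rightarrow> 'a)) list"

definition finite_algebra :: "'a op_algebra \<Rightarrow> bool" where
  "finite_algebra A \<longleftrightarrow>
     finite (univ A) \<and> univ A \<noteq> {} \<and>
     (\<forall>(k, f) \<in> set (basic_ops A).
        \<forall>as. length as = k \<and> set as \<subseteq> univ A \<longrightarrow> f as \<in> univ A)"

definition max_arity :: "'a op_algebra \<Rightarrow> nat" where
  "max_arity A = Max (insert 0 (fst ` set (basic_ops A)))"

definition alg_size :: "'a op_algebra \<Rightarrow> nat" where
  "alg_size A = (\<Sum>(k, f) \<leftarrow> basic_ops A. card (univ A) ^ k)"

text \<open>
  The \<open>X\<close>-ary part of the clone, as operations on \<open>X \<rightarrow>\<^sub>E univ A\<close>. A nullary basic operation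
  contributes an \<open>X\<close>-ary constant operation.
\<close>

inductive_set term_ops :: "'a op_algebra \<Rightarrow> 'x set \<Rightarrow> (('x \<Rightarrow> 'a) \<Rightarrow> 'a) set"
  for A :: "'a op_algebra" and X :: "'x set"
  where
    proj: "i \<in> X \<Longrightarrow> (\<lambda>x \<in> X \<rightarrow>\<^sub>E univ A. x i) \<in> term_ops A X"
  | comp: "\<lbrakk>(k, f) \<in> set (basic_ops A); length ts = k; \<forall>t \<in> set ts. t \<in> term_ops A X\<rbrakk> \<Longrightarrow>
           (\<lambda>x \<in> X \<rightarrow>\<^sub>E univ A. f (map (\<lambda>t. t x) ts)) \<in> term_ops A X"


section \<open>Symmetric identities\<close>

definition permute_args ::
  "'a op_algebra \<Rightarrow> 'x set \<Rightarrow> ('x \<Rightarrow> 'x) \<Rightarrow> (('x \<Rightarrow> 'a) \<Rightarrow> 'a) \<Rightarrow> ('x \<Rightarrow> 'a) \<Rightarrow> 'a" where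
  "permute_args A X \<pi> t = (\<lambda>x \<in> X \<rightarrow>\<^sub>E univ A. t (\<lambda>i \<in> X. x (\<pi> i)))"

text \<open>
  \<open>H\<close> is the set of permutations of a permutation group on \<open>X\<close>, that is, a subgroup of
  \<open>BijGroup X\<close>.
\<close>

definition satisfies_sym :: "'x set \<Rightarrow> ('x \<Rightarrow> 'x) set \<Rightarrow> 'a op_algebra \<Rightarrow> bool" where
  "satisfies_sym X H A \<longleftrightarrow>
     (\<exists>t \<in> term_ops A X. \<forall>\<pi> \<in> H. \<forall>x \<in> X \<rightarrow>\<^sub>E univ A. t x = permute_args A X \<pi> t x)"

definition left_translations :: "('g, 'm) monoid_scheme \<Rightarrow> ('g \<Rightarrow> 'g) set" where
  "left_translations G = (\<lambda>g. \<lambda>x \<in> carrier G. g \<otimes>\<^bsub>G\<^esub> x) ` carrier G"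

definition cyclic_shift :: "nat \<Rightarrow> nat \<Rightarrow> nat" where
  "cyclic_shift n = (\<lambda>i \<in> {1..n}. if i = n then 1 else i + 1)"

definition cyclic_perms :: "nat \<Rightarrow> (nat \<Rightarrow> nat) set" where
  "cyclic_perms n = generate (BijGroup {1..n}) {cyclic_shift n}"

definition largest_prime_divisor :: "nat \<Rightarrow> nat" where
  "largest_prime_divisor n = Max {p. prime p \<and> p dvd n}"

lemma left_translations_subgroup:
  assumes "group G"
  shows "subgroup (left_translations G) (BijGroup (carrier G))"
proof -
  interpret group G by fact
  let ?h = "\<lambda>g. \<lambda>x \<in> carrier G. g \<otimes>\<^bsub>G\<^esub> x"
  have bij: "?h g \<in> Bij (carrier G)" if "g \<in> carrier G" for g
    using that by (auto simp: Bij_def bij_betw_def inj_on_def surj_const_mult)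
  have "?h \<in> hom G (BijGroup (carrier G))"
    by (rule homI)
      (auto simp: BijGroup_def bij compose_def m_assoc intro!: restrict_ext)
  then interpret group_hom G "BijGroup (carrier G)" ?h
    by (simp add: group_hom_def group_hom_axioms_def group_BijGroup group_axioms)
  show ?thesis
    unfolding left_translations_def by (rule img_is_subgroup)
qed

lemma cyclic_shift_Bij:
  assumes "n \<ge> 1"
  shows "cyclic_shift n \<in> Bij {1..n}"
proof -
  have inj: "inj_on (cyclic_shift n) {1..n}"
    by (auto simp: cyclic_shift_def inj_on_def split: if_splits)
  have "cyclic_shift n ` {1..n} \<subseteq> {1..n}"
    using assms by (auto simp: cyclic_shift_def)
  with inj have "cyclic_shift n ` {1..n} = {1..n}"
    by (intro endo_inj_surj) auto
  with inj show ?thesis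
    by (simp add: Bij_def bij_betw_def cyclic_shift_def)
qed

lemma cyclic_perms_subgroup:
  assumes "n \<ge> 1"
  shows "subgroup (cyclic_perms n) (BijGroup {1..n})"
  unfolding cyclic_perms_def
  by (rule group.generate_is_subgroup[OF group_BijGroup])
    (use cyclic_shift_Bij[OF assms] in \<open>simp add: BijGroup_def\<close>)


section \<open>Random access machines\<close>

text \<open>
  The model of computation is the unit-cost RAM with addition and truncated subtraction (and no
  multiplication). Registers are indexed by the natural numbers, hold natural numbers and are
  initially \<open>0\<close>. The input is a separate read-only array of natural numbers, accessed through
  \<open>ReadInput\<close>; it yields \<open>0\<close> outside the array. Every instruction takes one time unit.
\<close>

datatype instr =
    SetConst nat nat
  | Move nat nat
  | AddReg nat nat nat
  | SubReg nat nat nat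
  | LoadInd nat nat
  | StoreInd nat nat
  | ReadInput nat nat
  | Jump nat
  | JumpZero nat nat

type_synonym ram_config = "nat \<times> (nat \<Rightarrow> nat)"

fun exec_instr :: "nat list \<Rightarrow> instr \<Rightarrow> ram_config \<Rightarrow> ram_config" where
  "exec_instr w (SetConst i c) (pc, R) = (pc + 1, R(i := c))"
| "exec_instr w (Move i j) (pc, R) = (pc + 1, R(i := R j))"
| "exec_instr w (AddReg i j k) (pc, R) = (pc + 1, R(i := R j + R k))"
| "exec_instr w (SubReg i j k) (pc, R) = (pc + 1, R(i := R j - R k))"
| "exec_instr w (LoadInd i j) (pc, R) = (pc + 1, R(i := R (R j)))"
| "exec_instr w (StoreInd i j) (pc, R) = (pc + 1, R(R i := R j))"
| "exec_instr w (ReadInput i j) (pc, R) =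
     (pc + 1, R(i := (if R j < length w then w ! R j else 0)))"
| "exec_instr w (Jump l) (pc, R) = (l, R)"
| "exec_instr w (JumpZero i l) (pc, R) = (if R i = 0 then l else pc + 1, R)"

text \<open>A machine halts by leaving its program; a halted configuration does not change any more.\<close>

definition ram_step :: "instr list \<Rightarrow> nat list \<Rightarrow> ram_config \<Rightarrow> ram_config" where
  "ram_step P w s = (if fst s < length P then exec_instr w (P ! fst s) s else s)"

definition ram_halts_with :: "instr list \<Rightarrow> nat list \<Rightarrow> nat \<Rightarrow> nat \<Rightarrow> bool" where
  "ram_halts_with P w T y \<longleftrightarrow>
     (let (pc, R) = (ram_step P w ^^ T) (0, \<lambda>_. 0) in length P \<le> pc \<and> R 0 = y)"


section \<open>Deciding properties of algebras given by operation tables\<close>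

text \<open>
  Instances are the finite algebras with universe \<open>{0, \<dots>, m - 1}\<close>. Such an algebra is presented by
  the size of the universe, the number of basic operations, their arities, and their tables, where
  the arguments in each table are in lexicographic order.
\<close>

definition op_table :: "nat \<Rightarrow> nat \<times> (nat list \<Rightarrow> nat) \<Rightarrow> nat list" where
  "op_table m kf = map (snd kf) (product_lists (replicate (fst kf) [0..<m]))"

definition encode_algebra :: "nat op_algebra \<Rightarrow> nat list" where
  "encode_algebra A =
     card (univ A) # length (basic_ops A) # map fst (basic_ops A) @
     concat (map (op_table (card (univ A))) (basic_ops A))"

definition instance_algebra :: "nat op_algebra \<Rightarrow> bool" where
  "instance_algebra A \<longleftrightarrow> finite_algebra A \<and> univ A = {..<card (univ A)}"

text \<open>
  Decidability of \<open>Q\<close> in time \<open>O(g)\<close>. Every bound is rounded up to at least \<open>1\<close>, which matters only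
  where \<open>g A = 0\<close>, for instance on algebras without operations of positive arity.
\<close>

definition decidable_in_time :: "(nat op_algebra \<Rightarrow> bool) \<Rightarrow> (nat op_algebra \<Rightarrow> nat) \<Rightarrow> bool" where
  "decidable_in_time Q g \<longleftrightarrow>
     (\<exists>P c. \<forall>A. instance_algebra A \<longrightarrow>
        ram_halts_with P (encode_algebra A) (c * max 1 (g A)) (if Q A then 1 else 0))"

end

theory Submission
  imports Defs
begin

text \<open>
  \<^bold>\<open>Local symmetry.\<close> Let \<open>H = \<rho> ` X\<close> be a regular permutation group, \<open>\<rho> i\<close> being the element that moves
  the base point to \<open>i\<close>. A term can be repaired one argument tuple at a time: if \<open>t\<close> takes the same
  value on all \<open>H\<close>-rearrangements of each tuple of a set \<open>F\<close>, and \<open>b\<close> is a further tuple, apply to the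
  tuple \<open>u i = t (b \<circ> \<rho> i)\<close> a term \<open>s\<close> that takes the same value on all rearrangements of \<open>u\<close>, and form
  \<open>s (i \<mapsto> t (x \<circ> \<rho> i))\<close>. On \<open>F\<close> the arguments of \<open>s\<close> are constant, and on a rearrangement of \<open>b\<close> they are the
  corresponding rearrangement of \<open>u\<close>, by regularity. So a symmetric term exists iff for every tuple
  \<open>x\<close> some term is constant on the rearrangements of \<open>x\<close> (\<open>satisfies_iff_locally\<close>). With \<open>n = card X\<close>, this
  says that the subalgebra of \<open>A ^ n\<close> generated by \<open>n\<close> explicit elements contains a constant tuple
  (\<open>closure_eq_value_codes\<close>, \<open>all_meet_iff_local_sym\<close>).

  \<^bold>\<open>The algorithm.\<close> Let \<open>m = card (univ A)\<close>, \<open>M = m ^ n\<close> and \<open>L = alg_size A\<close>. For each of the \<open>M\<close> tuples the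
  subalgebra is enumerated in a queue of at most \<open>M\<close> elements. When an element leaves the queue,
  each unary operation is applied to this element, and each operation of arity \<open>k \<ge> 2\<close> is applied to all
  \<open>M ^ k\<close> tuples over \<open>A ^ n\<close>, skipping those with an entry not yet found. The wasted repetition of the
  latter costs a factor \<open>M\<close>, which is harmless: as soon as some \<open>k \<ge> 2\<close> occurs, \<open>M * M \<le> L ^ n\<close>, while \<open>L ^ n\<close>
  also bounds the sum of the \<open>M ^ k\<close>. If all operations are unary then \<open>L = r * m\<close> and \<open>M * M * r \<le> L ^ (2 * n)\<close>.
  Both cases are \<open>key_bound\<close>; evaluating one operation costs a further factor proportional to its arity.

  \<^bold>\<open>Degenerate instances.\<close> A nullary operation yields a constant, hence symmetric, term; without
  operations there are only projections, and a nontrivial regular group admits a symmetric one only if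
  \<open>m = 1\<close>. Deciding these cases first matters for the time bound: if \<open>max_arity A = 0\<close> then only constant time
  is available, but then there is no operation at all or the first one is nullary. For the trivial group
  every projection is symmetric.

  \<^bold>\<open>Cyclic terms.\<close> A cyclic term of arity \<open>n\<close> yields one of arity \<open>p\<close> for each divisor \<open>p\<close> of \<open>n\<close>, by feeding it a
  periodic sequence, and cyclic terms of arities \<open>p\<close> and \<open>q\<close> combine to one of arity \<open>p * q\<close>
  (\<open>cyclic_term_iff_primes\<close>). Hence it suffices to run the algorithm for each prime divisor of \<open>n\<close>.

  \<^bold>\<open>The machine.\<close> The algorithm is written in a small language of bounded loops over scalars and arrays,
  whose meaning and cost are total functions, and which compiles to the random access machine with
  constant overhead (\<open>compile_correct\<close>).
\<close>

section \<open>Term operations and local symmetry\<close>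

lemma term_ops_extensional: "t \<in> term_ops A X \<Longrightarrow> t \<in> extensional (X \<rightarrow>\<^sub>E univ A)"
  by (induction rule: term_ops.induct) (rule restrict_extensional)+

lemma term_ops_closed:
  assumes "finite_algebra A" "t \<in> term_ops A X" "x \<in> X \<rightarrow>\<^sub>E univ A"
  shows "t x \<in> univ A"
  using assms(2)
proof induction
  case (proj i)
  with assms(3) show ?case by auto
next
  case (comp k f ts)
  have "length (map (\<lambda>t. t x) ts) = k" "set (map (\<lambda>t. t x) ts) \<subseteq> univ A"
    using comp by auto
  with assms(1) comp(1) have "f (map (\<lambda>t. t x) ts) \<in> univ A"
    unfolding finite_algebra_def by blast
  with assms(3) show ?case by simp
qed

text \<open>
  Clones are closed under superposition, also when the inner terms have another set of variables; this
  covers renaming and identification of variables, which is \<open>term_ops_reindex\<close>.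
\<close>

lemma term_ops_compose:
  assumes A: "finite_algebra A" and "t \<in> term_ops A Y" and s: "\<And>y. y \<in> Y \<Longrightarrow> s y \<in> term_ops A X"
  shows "(\<lambda>x \<in> X \<rightarrow>\<^sub>E univ A. t (\<lambda>y \<in> Y. s y x)) \<in> term_ops A X"
  using assms(2)
proof induction
  case (proj i)
  have dom: "(\<lambda>y \<in> Y. s y x) \<in> Y \<rightarrow>\<^sub>E univ A" if "x \<in> X \<rightarrow>\<^sub>E univ A" for x
    using term_ops_closed[OF A s that] by auto
  have "(\<lambda>x \<in> X \<rightarrow>\<^sub>E univ A. (\<lambda>x \<in> Y \<rightarrow>\<^sub>E univ A. x i) (\<lambda>y \<in> Y. s y x)) = s i"
    using proj dom by (intro extensionalityI[OF _ term_ops_extensional[OF s[OF proj]]]) auto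
  then show ?case using s[OF proj] by (simp only:)
next
  case (comp k f ts)
  have dom: "(\<lambda>y \<in> Y. s y x) \<in> Y \<rightarrow>\<^sub>E univ A" if "x \<in> X \<rightarrow>\<^sub>E univ A" for x
    using term_ops_closed[OF A s that] by auto
  let ?ts = "map (\<lambda>t. \<lambda>x \<in> X \<rightarrow>\<^sub>E univ A. t (\<lambda>y \<in> Y. s y x)) ts"
  have "(\<lambda>x \<in> X \<rightarrow>\<^sub>E univ A. f (map (\<lambda>t. t x) ?ts)) \<in> term_ops A X"
  proof (rule term_ops.comp[OF comp(1)])
    show "length ?ts = k" using comp(2) by simp
    show "\<forall>t \<in> set ?ts. t \<in> term_ops A X" unfolding set_map using comp(3) by blast
  qed
  also have "(\<lambda>x \<in> X \<rightarrow>\<^sub>E univ A. f (map (\<lambda>t. t x) ?ts)) =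
      (\<lambda>x \<in> X \<rightarrow>\<^sub>E univ A. (\<lambda>x \<in> Y \<rightarrow>\<^sub>E univ A. f (map (\<lambda>t. t x) ts)) (\<lambda>y \<in> Y. s y x))"
    using dom by (intro restrict_ext) (simp add: comp_def cong: map_cong)
  finally show ?case .
qed

lemma term_ops_reindex:
  assumes "finite_algebra A" "t \<in> term_ops A Y" "\<And>y. y \<in> Y \<Longrightarrow> e y \<in> X"
  shows "(\<lambda>x \<in> X \<rightarrow>\<^sub>E univ A. t (\<lambda>y \<in> Y. x (e y))) \<in> term_ops A X"
proof -
  have "(\<lambda>x \<in> X \<rightarrow>\<^sub>E univ A. t (\<lambda>y \<in> Y. (\<lambda>x \<in> X \<rightarrow>\<^sub>E univ A. x (e y)) x)) \<in> term_ops A X"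
    using assms by (intro term_ops_compose[where s = "\<lambda>y. \<lambda>x \<in> X \<rightarrow>\<^sub>E univ A. x (e y)"] term_ops.proj)
  also have "(\<lambda>x \<in> X \<rightarrow>\<^sub>E univ A. t (\<lambda>y \<in> Y. (\<lambda>x \<in> X \<rightarrow>\<^sub>E univ A. x (e y)) x)) =
    (\<lambda>x \<in> X \<rightarrow>\<^sub>E univ A. t (\<lambda>y \<in> Y. x (e y)))"
    by (intro restrict_ext) simp
  finally show ?thesis .
qed

text \<open>
  The part of regularity that the proof uses. For a regular group with base point \<open>e\<close>, \<open>\<rho> i\<close> is the element
  with \<open>\<rho> i e = i\<close>; then \<open>\<rho> (\<pi> i)\<close> and \<open>\<pi> \<circ> \<rho> i\<close> agree at \<open>e\<close> and are therefore equal, which is \<open>mult\<close>.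
\<close>

locale regular_perms =
  fixes X :: "'x set" and H :: "('x \<Rightarrow> 'x) set" and \<rho> :: "'x \<Rightarrow> 'x \<Rightarrow> 'x"
  assumes finite_X: "finite X" and X_nonempty: "X \<noteq> {}"
    and H_eq: "H = \<rho> ` X"
    and perm: "\<And>\<pi> i. \<pi> \<in> H \<Longrightarrow> i \<in> X \<Longrightarrow> \<pi> i \<in> X"
    and id: "\<exists>\<pi>\<in>H. \<forall>i\<in>X. \<pi> i = i"
    and mult: "\<And>\<pi> i j. \<pi> \<in> H \<Longrightarrow> i \<in> X \<Longrightarrow> j \<in> X \<Longrightarrow> \<rho> (\<pi> i) j = \<pi> (\<rho> i j)"
begin

definition locally :: "'a op_algebra \<Rightarrow> bool" where
  "locally A \<longleftrightarrow> (\<forall>x \<in> X \<rightarrow>\<^sub>E univ A. \<exists>t \<in> term_ops A X. \<exists>d. \<forall>\<pi> \<in> H. t (\<lambda>i \<in> X. x (\<pi> i)) = d)"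

lemma permuted:
  "\<pi> \<in> H \<Longrightarrow> x \<in> X \<rightarrow>\<^sub>E univ A \<Longrightarrow> (\<lambda>i \<in> X. x (\<pi> i)) \<in> X \<rightarrow>\<^sub>E univ A"
  using perm by auto

text \<open>
  Induction over the finite set of tuples on which the term already behaves; the step is the
  superposition of two terms described at the start of the theory.
\<close>

lemma locally_imp_satisfies:
  assumes A: "finite_algebra A" and loc: "locally A"
  shows "satisfies_sym X H A"
proof -
  have \<rho>: "\<rho> i \<in> H" if "i \<in> X" for i using that H_eq by auto
  have fin: "finite (X \<rightarrow>\<^sub>E univ A)"
    using A finite_X by (intro finite_PiE) (auto simp: finite_algebra_def)
  have "\<exists>t \<in> term_ops A X. \<forall>x \<in> F. \<exists>d. \<forall>\<pi> \<in> H. t (\<lambda>i \<in> X. x (\<pi> i)) = d"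
    if "finite F" "F \<subseteq> X \<rightarrow>\<^sub>E univ A" for F
    using that
  proof (induction F rule: finite_induct)
    case empty
    obtain i where "i \<in> X" using X_nonempty by auto
    then show ?case by (auto intro: term_ops.proj)
  next
    case (insert b F)
    then obtain t where t: "t \<in> term_ops A X" "\<And>x. x \<in> F \<Longrightarrow> \<exists>d. \<forall>\<pi> \<in> H. t (\<lambda>i \<in> X. x (\<pi> i)) = d"
      by blast
    \<comment> \<open>the values of the old term on the rearrangements of the new tuple, indexed by the group\<close>
    define u where "u = (\<lambda>i \<in> X. t (\<lambda>j \<in> X. b (\<rho> i j)))"
    have b: "b \<in> X \<rightarrow>\<^sub>E univ A" using insert by auto
    have u: "u \<in> X \<rightarrow>\<^sub>E univ A"
      unfolding u_def using term_ops_closed[OF A t(1) permuted[OF \<rho> b]] by auto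
    then obtain s d where s: "s \<in> term_ops A X" "\<And>\<pi>. \<pi> \<in> H \<Longrightarrow> s (\<lambda>i \<in> X. u (\<pi> i)) = d"
      using loc unfolding locally_def by blast
    define t' where "t' = (\<lambda>x \<in> X \<rightarrow>\<^sub>E univ A. s (\<lambda>i \<in> X. t (\<lambda>j \<in> X. x (\<rho> i j))))"
    have "(\<lambda>x \<in> X \<rightarrow>\<^sub>E univ A. s (\<lambda>i \<in> X. (\<lambda>x \<in> X \<rightarrow>\<^sub>E univ A. t (\<lambda>j \<in> X. x (\<rho> i j))) x)) \<in> term_ops A X"
      using \<rho> perm by (intro term_ops_compose[OF A s(1), where s = "\<lambda>i. \<lambda>x \<in> X \<rightarrow>\<^sub>E univ A. t (\<lambda>j \<in> X. x (\<rho> i j))"]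
        term_ops_reindex[OF A t(1)]) auto
    also have "(\<lambda>x \<in> X \<rightarrow>\<^sub>E univ A. s (\<lambda>i \<in> X. (\<lambda>x \<in> X \<rightarrow>\<^sub>E univ A. t (\<lambda>j \<in> X. x (\<rho> i j))) x)) = t'"
      unfolding t'_def by (intro restrict_ext) (simp cong: restrict_cong)
    finally have "t' \<in> term_ops A X" .
    \<comment> \<open>regularity: rearranging the argument permutes the values of the inner term\<close>
    have t': "t' (\<lambda>i \<in> X. x (\<pi> i)) = s (\<lambda>i \<in> X. t (\<lambda>j \<in> X. x (\<rho> (\<pi> i) j)))"
      if "\<pi> \<in> H" "x \<in> X \<rightarrow>\<^sub>E univ A" for \<pi> x
    proof -
      have "(\<lambda>j \<in> X. (\<lambda>i \<in> X. x (\<pi> i)) (\<rho> i j)) = (\<lambda>j \<in> X. x (\<rho> (\<pi> i) j))" if "i \<in> X" for i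
        using that \<open>\<pi> \<in> H\<close> mult perm[OF \<rho>] by (intro restrict_ext) auto
      then have "(\<lambda>i \<in> X. t (\<lambda>j \<in> X. (\<lambda>i \<in> X. x (\<pi> i)) (\<rho> i j))) = (\<lambda>i \<in> X. t (\<lambda>j \<in> X. x (\<rho> (\<pi> i) j)))"
        by (intro restrict_ext) simp
      with permuted[OF that] show ?thesis by (simp add: t'_def)
    qed
    have "\<exists>d. \<forall>\<pi> \<in> H. t' (\<lambda>i \<in> X. x (\<pi> i)) = d" if x: "x \<in> insert b F" for x
    proof (cases "x = b")
      case True
      have "t' (\<lambda>i \<in> X. b (\<pi> i)) = d" if "\<pi> \<in> H" for \<pi>
      proof -
        have "(\<lambda>i \<in> X. u (\<pi> i)) = (\<lambda>i \<in> X. t (\<lambda>j \<in> X. b (\<rho> (\<pi> i) j)))"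
          using that perm by (intro restrict_ext) (auto simp: u_def)
        with t'[OF that b] s(2)[OF that] show ?thesis by simp
      qed
      with True show ?thesis by auto
    next
      case False
      with x obtain e where e: "\<And>\<pi>. \<pi> \<in> H \<Longrightarrow> t (\<lambda>i \<in> X. x (\<pi> i)) = e" using t(2)[of x] by auto
      have "t' (\<lambda>i \<in> X. x (\<pi> i)) = s (\<lambda>i \<in> X. e)" if "\<pi> \<in> H" for \<pi>
      proof -
        have "(\<lambda>i \<in> X. t (\<lambda>j \<in> X. x (\<rho> (\<pi> i) j))) = (\<lambda>i \<in> X. e)"
          using e[OF \<rho>[OF perm[OF that]]] by (intro restrict_ext) simp
        moreover have "x \<in> X \<rightarrow>\<^sub>E univ A" using x insert.prems by auto
        ultimately show ?thesis using t'[OF that, of x] by simp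
      qed
      then show ?thesis by auto
    qed
    with \<open>t' \<in> term_ops A X\<close> show ?case by blast
  qed
  from this[OF fin order_refl] obtain t where t: "t \<in> term_ops A X"
    "\<And>x. x \<in> X \<rightarrow>\<^sub>E univ A \<Longrightarrow> \<exists>d. \<forall>\<pi> \<in> H. t (\<lambda>i \<in> X. x (\<pi> i)) = d" by blast
  obtain \<iota> where \<iota>: "\<iota> \<in> H" "\<And>i. i \<in> X \<Longrightarrow> \<iota> i = i" using id by blast
  have "t x = permute_args A X \<pi> t x" if \<pi>: "\<pi> \<in> H" and x: "x \<in> X \<rightarrow>\<^sub>E univ A" for \<pi> x
  proof -
    have "(\<lambda>i \<in> X. x (\<iota> i)) = x" using \<iota> x by (auto simp: fun_eq_iff PiE_def extensional_def)
    moreover obtain d where d: "\<And>\<pi>. \<pi> \<in> H \<Longrightarrow> t (\<lambda>i \<in> X. x (\<pi> i)) = d" using t(2)[OF x] by blast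
    ultimately show ?thesis using d[OF \<iota>(1)] d[OF \<pi>] x by (simp add: permute_args_def)
  qed
  with t(1) show ?thesis unfolding satisfies_sym_def by blast
qed

lemma satisfies_iff_locally:
  assumes A: "finite_algebra A"
  shows "satisfies_sym X H A \<longleftrightarrow> locally A"
proof
  assume "satisfies_sym X H A"
  then obtain t where t: "t \<in> term_ops A X"
    "\<And>\<pi> x. \<pi> \<in> H \<Longrightarrow> x \<in> X \<rightarrow>\<^sub>E univ A \<Longrightarrow> t x = t (\<lambda>i \<in> X. x (\<pi> i))"
    by (auto simp: satisfies_sym_def permute_args_def)
  show "locally A"
    unfolding locally_def
  proof
    fix x assume "x \<in> X \<rightarrow>\<^sub>E univ A"
    then have "\<forall>\<pi> \<in> H. t (\<lambda>i \<in> X. x (\<pi> i)) = t x" using t(2) by simp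
    then show "\<exists>t \<in> term_ops A X. \<exists>d. \<forall>\<pi> \<in> H. t (\<lambda>i \<in> X. x (\<pi> i)) = d" using t(1) by blast
  qed
qed (rule locally_imp_satisfies[OF A])


end

text \<open>
  The local condition with the variables and the group elements numbered by \<open>{..<n}\<close>: \<open>\<sigma> c i\<close> is the image of
  variable \<open>i\<close> under the \<open>c\<close>-th group element. Only this table of numbers enters the program.
\<close>

definition local_sym :: "nat \<Rightarrow> (nat \<Rightarrow> nat \<Rightarrow> nat) \<Rightarrow> 'a op_algebra \<Rightarrow> bool" where
  "local_sym n \<sigma> A \<longleftrightarrow> (\<forall>x \<in> {..<n} \<rightarrow>\<^sub>E univ A. \<exists>t \<in> term_ops A {..<n}. \<exists>d. \<forall>c<n. t (\<lambda>i \<in> {..<n}. x (\<sigma> c i)) = d)"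

lemma (in regular_perms) locally_iff_local_sym:
  assumes A: "finite_algebra A" and e: "bij_betw e {..<n} X"
  shows "locally A \<longleftrightarrow> local_sym n (\<lambda>c i. inv_into {..<n} e (\<rho> (e c) (e i))) A"
proof -
  let ?I = "{..<n} :: nat set"
  define g where "g = inv_into ?I e"
  have g: "g j \<in> ?I" "e (g j) = j" if "j \<in> X" for j
    using that e unfolding g_def bij_betw_def by (auto intro: inv_into_into f_inv_into_f)
  have ge: "e i \<in> X" "g (e i) = i" if "i \<in> ?I" for i
    using that e unfolding g_def bij_betw_def by (auto intro: inv_into_f_f)
  have \<rho>: "\<rho> i j \<in> X" if "i \<in> X" "j \<in> X" for i j using that H_eq perm by auto
  show ?thesis
    unfolding g_def[symmetric]
  proof
    assume loc: "locally A"
    show "local_sym n (\<lambda>c i. g (\<rho> (e c) (e i))) A"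
      unfolding local_sym_def
    proof
      fix x assume x: "x \<in> ?I \<rightarrow>\<^sub>E univ A"
      define x' where "x' = (\<lambda>j \<in> X. x (g j))"
      have "x' \<in> X \<rightarrow>\<^sub>E univ A" using x g by (auto simp: x'_def)
      then obtain t d where t: "t \<in> term_ops A X" "\<And>\<pi>. \<pi> \<in> H \<Longrightarrow> t (\<lambda>j \<in> X. x' (\<pi> j)) = d"
        using loc unfolding locally_def by blast
      define t' where "t' = (\<lambda>y \<in> ?I \<rightarrow>\<^sub>E univ A. t (\<lambda>j \<in> X. y (g j)))"
      have "t' \<in> term_ops A ?I"
        unfolding t'_def by (rule term_ops_reindex[OF A t(1) g(1)])
      moreover have "t' (\<lambda>i \<in> ?I. x (g (\<rho> (e c) (e i)))) = d" if "c < n" for c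
      proof -
        have "(\<lambda>i \<in> ?I. x (g (\<rho> (e c) (e i)))) \<in> ?I \<rightarrow>\<^sub>E univ A"
          using x that g(1)[OF \<rho>[OF ge(1) ge(1)]] by auto
        moreover have "(\<lambda>j \<in> X. (\<lambda>i \<in> ?I. x (g (\<rho> (e c) (e i)))) (g j)) = (\<lambda>j \<in> X. x' (\<rho> (e c) j))"
          using that g \<rho>[OF ge(1)] by (intro restrict_ext) (simp add: x'_def)
        moreover have "\<rho> (e c) \<in> H" using H_eq ge(1)[of c] that by auto
        ultimately show ?thesis using t(2) by (simp add: t'_def)
      qed
      ultimately show "\<exists>t \<in> term_ops A ?I. \<exists>d. \<forall>c<n. t (\<lambda>i \<in> ?I. x (g (\<rho> (e c) (e i)))) = d"
        by blast
    qed
  next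
    assume loc: "local_sym n (\<lambda>c i. g (\<rho> (e c) (e i))) A"
    show "locally A"
      unfolding locally_def
    proof
      fix x assume x: "x \<in> X \<rightarrow>\<^sub>E univ A"
      define x' where "x' = (\<lambda>i \<in> ?I. x (e i))"
      have "x' \<in> ?I \<rightarrow>\<^sub>E univ A" using x ge by (auto simp: x'_def)
      then obtain t d where t: "t \<in> term_ops A ?I"
        "\<And>c. c < n \<Longrightarrow> t (\<lambda>i \<in> ?I. x' (g (\<rho> (e c) (e i)))) = d"
        using loc unfolding local_sym_def by blast
      define t' where "t' = (\<lambda>y \<in> X \<rightarrow>\<^sub>E univ A. t (\<lambda>i \<in> ?I. y (e i)))"
      have "t' \<in> term_ops A X"
        unfolding t'_def by (rule term_ops_reindex[OF A t(1) ge(1)])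
      moreover have "t' (\<lambda>j \<in> X. x (\<pi> j)) = d" if "\<pi> \<in> H" for \<pi>
      proof -
        obtain j where "j \<in> X" "\<pi> = \<rho> j" using \<open>\<pi> \<in> H\<close> H_eq by auto
        then have c: "g j < n" "\<pi> = \<rho> (e (g j))" using g by auto
        have "(\<lambda>i \<in> ?I. (\<lambda>j \<in> X. x (\<pi> j)) (e i)) = (\<lambda>i \<in> ?I. x' (g (\<rho> (e (g j)) (e i))))"
          using ge g \<rho> \<open>j \<in> X\<close> unfolding c(2) by (intro restrict_ext) (simp add: x'_def)
        then show ?thesis using t(2)[OF c(1)] permuted[OF that x] by (simp add: t'_def)
      qed
      ultimately show "\<exists>t \<in> term_ops A X. \<exists>d. \<forall>\<pi> \<in> H. t (\<lambda>i \<in> X. x (\<pi> i)) = d" by blast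
    qed
  qed
qed

lemma (in regular_perms) satisfies_iff_local_sym:
  "\<exists>\<sigma>. (\<forall>c<card X. \<forall>i<card X. \<sigma> c i < card X) \<and>
    (\<forall>A :: 'a op_algebra. finite_algebra A \<longrightarrow> satisfies_sym X H A = local_sym (card X) \<sigma> A)"
proof -
  obtain e where e: "bij_betw e {..<card X} X"
    using ex_bij_betw_nat_finite[OF finite_X] by (auto simp: atLeast0LessThan)
  have "inv_into {..<card X} e (\<rho> (e c) (e i)) < card X" if "c < card X" "i < card X" for c i
  proof -
    have "e c \<in> X" "e i \<in> X" using e that by (auto simp: bij_betw_def)
    then have "\<rho> (e c) (e i) \<in> e ` {..<card X}" using H_eq perm e by (auto simp: bij_betw_def)
    from inv_into_into[OF this] show ?thesis by simp
  qed
  moreover have "satisfies_sym X H A = local_sym (card X) (\<lambda>c i. inv_into {..<card X} e (\<rho> (e c) (e i))) A"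
    if "finite_algebra A" for A :: "'a op_algebra"
    unfolding satisfies_iff_locally[OF that] by (rule locally_iff_local_sym[OF that e])
  ultimately show ?thesis
    by (intro exI[of _ "\<lambda>c i. inv_into {..<card X} e (\<rho> (e c) (e i))"]) simp
qed

lemma regular_perms_left_translations:
  assumes "group G" "finite (carrier G)"
  shows "regular_perms (carrier G) (left_translations G) (\<lambda>g. \<lambda>x \<in> carrier G. g \<otimes>\<^bsub>G\<^esub> x)"
proof -
  interpret group G by fact
  show ?thesis
  proof
    show "\<exists>\<pi>\<in>left_translations G. \<forall>i\<in>carrier G. \<pi> i = i"
      unfolding left_translations_def by (intro bexI[of _ "\<lambda>x \<in> carrier G. \<one>\<^bsub>G\<^esub> \<otimes>\<^bsub>G\<^esub> x"]) auto
  qed (use assms in \<open>auto simp: left_translations_def m_assoc\<close>)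
qed

section \<open>Cyclic terms\<close>

text \<open>
  The \<open>j\<close>-th power of the cyclic shift. The variables are numbered from 1, and \<open>n\<close> serves as the base
  point: \<open>rotation n j n = j\<close>, so \<open>rotation n n\<close> is the identity.
\<close>

definition rotation :: "nat \<Rightarrow> nat \<Rightarrow> nat \<Rightarrow> nat" where
  "rotation n j = (\<lambda>i \<in> {1..n}. (i + j - 1) mod n + 1)"

lemma rotation_in: "n \<ge> 1 \<Longrightarrow> i \<in> {1..n} \<Longrightarrow> rotation n j i \<in> {1..n}"
  by (simp add: rotation_def Suc_le_eq)

lemma rotation_rotation:
  assumes "n \<ge> 1" "i \<in> {1..n}" "l \<in> {1..n}"
  shows "rotation n (rotation n j l) i = rotation n j (rotation n l i)"
proof -
  have "(i + ((l + j - 1) mod n + 1) - 1) mod n = (i + (l + j - 1)) mod n" by (simp add: mod_simps)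
  moreover have "((i + l - 1) mod n + 1 + j - 1) mod n = (i + l - 1 + j) mod n" by (simp add: mod_simps)
  moreover have "i + (l + j - 1) = i + l - 1 + j" using assms by simp
  ultimately show ?thesis
    using assms rotation_in[OF assms(1,2), of l] by (simp add: rotation_def)
qed

lemma cyclic_shift_eq_rotation: "n \<ge> 1 \<Longrightarrow> cyclic_shift n = rotation n 1"
  unfolding cyclic_shift_def rotation_def by (intro restrict_ext) auto

lemma cyclic_perms_eq:
  assumes n: "n \<ge> 1"
  shows "cyclic_perms n = rotation n ` {1..n}"
proof -
  let ?S = "{1..n}"
  interpret B: group "BijGroup ?S" by (rule group_BijGroup)
  have one: "rotation n n = \<one>\<^bsub>BijGroup ?S\<^esub>"
    unfolding rotation_def BijGroup_def monoid.simps
  proof (rule restrict_ext)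
    fix i assume i: "i \<in> ?S"
    then have "i + n - 1 = (i - 1) + n" by simp
    then have "(i + n - 1) mod n = (i - 1) mod n" by simp
    also have "\<dots> = i - 1" using i by (intro mod_less) auto
    finally show "(i + n - 1) mod n + 1 = i" using i by simp
  qed
  have shift: "rotation n 1 \<in> carrier (BijGroup ?S)"
    using cyclic_shift_Bij[OF n] cyclic_shift_eq_rotation[OF n] by (simp add: BijGroup_def)
  have mult: "rotation n j \<otimes>\<^bsub>BijGroup ?S\<^esub> rotation n l = rotation n (rotation n j l)"
    if "rotation n j \<in> carrier (BijGroup ?S)" "rotation n l \<in> carrier (BijGroup ?S)" "l \<in> ?S" for j l
  proof -
    have "compose ?S (rotation n j) (rotation n l) = rotation n (rotation n j l)"
      unfolding compose_def
      using rotation_rotation[OF n _ that(3)]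
      by (intro extensionalityI[of _ ?S]) (auto simp: rotation_def extensional_def)
    with that(1,2) show ?thesis by (simp add: BijGroup_def)
  qed
  let ?G = "generate (BijGroup ?S) {rotation n 1}"
  have G_carrier: "?G \<subseteq> carrier (BijGroup ?S)" using shift by (intro B.generate_incl) auto
  have next_rot: "rotation n j \<otimes>\<^bsub>BijGroup ?S\<^esub> rotation n 1 = rotation n (rotation n j 1)"
    if "rotation n j \<in> ?G" for j
    using that G_carrier shift n by (intro mult) auto
  have in_G: "rotation n j \<in> ?G" if "1 \<le> j" "j \<le> n" for j
    using that
  proof (induction j rule: nat_induct_at_least)
    case base
    show ?case by (intro generate.incl) auto
  next
    case (Suc j)
    then have IH: "rotation n j \<in> ?G" by simp
    have "rotation n j 1 = Suc j" using Suc by (simp add: rotation_def)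
    with next_rot[OF IH] generate.eng[OF IH generate.incl[of "rotation n 1"]] show ?case by simp
  qed
  have carr: "rotation n j \<in> carrier (BijGroup ?S)" if "j \<in> ?S" for j
    using in_G[of j] that G_carrier by auto
  have "?G \<subseteq> rotation n ` ?S"
  proof
    fix h assume "h \<in> ?G"
    then show "h \<in> rotation n ` ?S"
    proof induction
      case one
      show ?case using \<open>rotation n n = _\<close> n by (intro image_eqI[of _ _ n]) auto
    next
      case (incl h)
      then show ?case using n by auto
    next
      case (inv h)
      define k where "k = (if n = 1 then 1 else n - 1)"
      have k: "k \<in> ?S" using n by (auto simp: k_def)
      have "rotation n k 1 = n" using n by (auto simp: rotation_def k_def)
      then have "rotation n k \<otimes>\<^bsub>BijGroup ?S\<^esub> rotation n 1 = \<one>\<^bsub>BijGroup ?S\<^esub>"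
        using next_rot[OF in_G] k one by auto
      then have "inv\<^bsub>BijGroup ?S\<^esub> (rotation n 1) = rotation n k"
        using carr[OF k] shift by (intro B.inv_equality)
      with inv k show ?case by auto
    next
      case (eng h1 h2)
      then obtain j l where jl: "j \<in> ?S" "l \<in> ?S" "h1 = rotation n j" "h2 = rotation n l" by auto
      then have "h1 \<otimes>\<^bsub>BijGroup ?S\<^esub> h2 = rotation n (rotation n j l)" using mult carr by auto
      then show ?case using rotation_in[OF n jl(2)] by auto
    qed
  qed
  moreover have "rotation n ` ?S \<subseteq> ?G" using in_G by auto
  ultimately show ?thesis unfolding cyclic_perms_def cyclic_shift_eq_rotation[OF n] by blast
qed

lemma regular_perms_cyclic:
  assumes n: "n \<ge> 1"
  shows "regular_perms {1..n} (cyclic_perms n) (rotation n)"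
proof
  show "cyclic_perms n = rotation n ` {1..n}" by (rule cyclic_perms_eq[OF n])
  show "\<pi> i \<in> {1..n}" if "\<pi> \<in> cyclic_perms n" "i \<in> {1..n}" for \<pi> i
    using that rotation_in[OF n] unfolding cyclic_perms_eq[OF n] by auto
  have "rotation n n i = i" if "i \<in> {1..n}" for i
  proof -
    have "i + n - 1 = (i - 1) + n" using that by simp
    then have "(i + n - 1) mod n = (i - 1) mod n" by simp
    also have "\<dots> = i - 1" using that by (intro mod_less) auto
    finally show ?thesis using that by (simp add: rotation_def)
  qed
  then show "\<exists>\<pi>\<in>cyclic_perms n. \<forall>i\<in>{1..n}. \<pi> i = i"
    unfolding cyclic_perms_eq[OF n] using n by (intro bexI[of _ "rotation n n"]) auto
  show "rotation n (\<pi> i) j = \<pi> (rotation n i j)"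
    if "\<pi> \<in> cyclic_perms n" "i \<in> {1..n}" "j \<in> {1..n}" for \<pi> i j
    using that rotation_rotation[OF n] unfolding cyclic_perms_eq[OF n] by auto
qed (use n in auto)

text \<open>
  Cyclicity expressed through periodic sequences instead of tuples: shifting the argument becomes
  \<open>u (Suc i)\<close>, and the index arithmetic modulo \<open>n\<close> disappears from the proofs that change the arity.
\<close>

definition cyclic_term :: "nat \<Rightarrow> 'a op_algebra \<Rightarrow> ((nat \<Rightarrow> 'a) \<Rightarrow> 'a) \<Rightarrow> bool" where
  "cyclic_term n A t \<longleftrightarrow> t \<in> term_ops A {1..n} \<and>
     (\<forall>u. (\<forall>i. u i \<in> univ A \<and> u (i + n) = u i) \<longrightarrow> t (\<lambda>i \<in> {1..n}. u (Suc i)) = t (\<lambda>i \<in> {1..n}. u i))"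

lemma satisfies_cyclic_iff:
  assumes A: "finite_algebra A" and n: "n \<ge> 1"
  shows "satisfies_sym {1..n} (cyclic_perms n) A \<longleftrightarrow> (\<exists>t. cyclic_term n A t)"
proof
  assume "satisfies_sym {1..n} (cyclic_perms n) A"
  then obtain t where t: "t \<in> term_ops A {1..n}"
    "\<And>\<pi> x. \<pi> \<in> cyclic_perms n \<Longrightarrow> x \<in> {1..n} \<rightarrow>\<^sub>E univ A \<Longrightarrow> t x = t (\<lambda>i \<in> {1..n}. x (\<pi> i))"
    by (auto simp: satisfies_sym_def permute_args_def)
  have "t (\<lambda>i \<in> {1..n}. u (Suc i)) = t (\<lambda>i \<in> {1..n}. u i)"
    if u: "\<forall>i. u i \<in> univ A \<and> u (i + n) = u i" for u
  proof -
    have shift: "cyclic_shift n \<in> cyclic_perms n"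
      unfolding cyclic_perms_def by (intro generate.incl) simp
    have "(\<lambda>i \<in> {1..n}. (\<lambda>i \<in> {1..n}. u i) (cyclic_shift n i)) = (\<lambda>i \<in> {1..n}. u (Suc i))"
    proof (rule restrict_ext)
      fix i assume "i \<in> {1..n}"
      moreover have "u (Suc n) = u 1" using u[rule_format, of 1] by simp
      ultimately show "(\<lambda>i \<in> {1..n}. u i) (cyclic_shift n i) = u (Suc i)"
        using n by (auto simp: cyclic_shift_def)
    qed
    with t(2)[OF shift, of "\<lambda>i \<in> {1..n}. u i"] u show ?thesis by simp
  qed
  with t(1) show "\<exists>t. cyclic_term n A t" unfolding cyclic_term_def by blast
next
  assume "\<exists>t. cyclic_term n A t"
  then obtain t where t: "t \<in> term_ops A {1..n}"
    "\<And>u. (\<And>i. u i \<in> univ A) \<Longrightarrow> (\<And>i. u (i + n) = u i) \<Longrightarrow>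
       t (\<lambda>i \<in> {1..n}. u (Suc i)) = t (\<lambda>i \<in> {1..n}. u i)"
    unfolding cyclic_term_def by blast
  have "t x = permute_args A {1..n} \<pi> t x"
    if \<pi>: "\<pi> \<in> cyclic_perms n" and x: "x \<in> {1..n} \<rightarrow>\<^sub>E univ A" for \<pi> x
  proof -
    obtain j where j: "\<pi> = rotation n j" using \<pi> cyclic_perms_eq[OF n] by auto
    define u where "u i = x ((i + n - 1) mod n + 1)" for i
    have u_in: "u i \<in> univ A" for i using x n by (auto simp: u_def Suc_le_eq)
    have u_per: "u (i + n) = u i" for i
    proof -
      have "i + n + n - 1 = (i + n - 1) + n" using n by simp
      then show ?thesis by (simp add: u_def)
    qed
    have shifts: "t (\<lambda>i \<in> {1..n}. u (i + j)) = t (\<lambda>i \<in> {1..n}. u i)" for j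
    proof (induction j)
      case (Suc j)
      have "t (\<lambda>i \<in> {1..n}. u (i + Suc j)) = t (\<lambda>i \<in> {1..n}. u (i + j))"
        unfolding add_Suc_right add_Suc[symmetric]
      proof (rule t(2))
        show "u (i + n + j) = u (i + j)" for i
          using u_per[of "i + j"] by (simp add: ac_simps)
      qed (rule u_in)
      from this Suc show ?case by (rule trans)
    qed simp
    have "(\<lambda>i \<in> {1..n}. x (rotation n j i)) = (\<lambda>i \<in> {1..n}. u (i + j))"
    proof (rule restrict_ext)
      fix i assume i: "i \<in> {1..n}"
      then have "i + j + n - 1 = (i + j - 1) + n" by simp
      then have "(i + j + n - 1) mod n = (i + j - 1) mod n" by (simp only: mod_add_self2)
      then show "x (rotation n j i) = u (i + j)" using i by (simp add: u_def rotation_def)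
    qed
    moreover have "(\<lambda>i \<in> {1..n}. u i) = x"
    proof (rule extensionalityI[of _ "{1..n}"])
      fix i assume i: "i \<in> {1..n}"
      then have "i + n - 1 = (i - 1) + n" by simp
      then have "(i + n - 1) mod n = (i - 1) mod n" by simp
      also have "\<dots> = i - 1" using i by (intro mod_less) auto
      finally show "(\<lambda>i \<in> {1..n}. u i) i = x i" using i by (simp add: u_def)
    qed (use x in \<open>auto simp: PiE_def\<close>)
    ultimately show ?thesis using shifts[of j] x j by (simp add: permute_args_def)
  qed
  with t(1) show "satisfies_sym {1..n} (cyclic_perms n) A" unfolding satisfies_sym_def by blast
qed

text \<open>
  The term \<open>c (d (x 1, x (1 + p), ...), ..., d (x p, x (2 * p), ...))\<close> is cyclic: the inner values, continued to
  all starting points, form a sequence that is \<open>p\<close>-periodic because \<open>d\<close> is cyclic.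
\<close>

lemma cyclic_term_mult:
  assumes A: "finite_algebra A" and p: "p \<ge> 1" and q: "q \<ge> 1"
    and c: "cyclic_term p A c" and d: "cyclic_term q A d"
  shows "\<exists>t. cyclic_term (p * q) A t"
proof -
  let ?n = "p * q"
  have in_n: "j + p * (i - 1) \<in> {1..?n}" if "j \<in> {1..p}" "i \<in> {1..q}" for i j
  proof -
    have "j + p * (i - 1) \<le> p + p * (q - 1)" using that by (intro add_mono mult_left_mono) auto
    also have "\<dots> = ?n" using q by (cases q) auto
    finally show ?thesis using that by auto
  qed
  define block where "block j = (\<lambda>x \<in> {1..?n} \<rightarrow>\<^sub>E univ A. d (\<lambda>i \<in> {1..q}. x (j + p * (i - 1))))" for j
  have block: "block j \<in> term_ops A {1..?n}" if "j \<in> {1..p}" for j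
    unfolding block_def using d in_n[OF that] by (intro term_ops_reindex[OF A]) (auto simp: cyclic_term_def)
  define t where "t = (\<lambda>x \<in> {1..?n} \<rightarrow>\<^sub>E univ A. c (\<lambda>j \<in> {1..p}. block j x))"
  have "t \<in> term_ops A {1..?n}"
    unfolding t_def using c block by (intro term_ops_compose[OF A]) (auto simp: cyclic_term_def)
  moreover have "t (\<lambda>i \<in> {1..?n}. u (Suc i)) = t (\<lambda>i \<in> {1..?n}. u i)"
    if u: "\<forall>i. u i \<in> univ A \<and> u (i + ?n) = u i" for u
  proof -
    define v where "v j = d (\<lambda>i \<in> {1..q}. u (j + p * (i - 1)))" for j
    have eval: "t (\<lambda>i \<in> {1..?n}. u (i + s)) = c (\<lambda>j \<in> {1..p}. v (j + s))" for s
    proof -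
      have "(\<lambda>i \<in> {1..?n}. u (i + s)) \<in> {1..?n} \<rightarrow>\<^sub>E univ A" using u by auto
      moreover have "block j (\<lambda>i \<in> {1..?n}. u (i + s)) = v (j + s)" if "j \<in> {1..p}" for j
      proof -
        have "(\<lambda>i \<in> {1..q}. (\<lambda>i \<in> {1..?n}. u (i + s)) (j + p * (i - 1))) =
            (\<lambda>i \<in> {1..q}. u (j + s + p * (i - 1)))"
        proof (rule restrict_ext)
          fix i assume "i \<in> {1..q}"
          then have "(\<lambda>i \<in> {1..?n}. u (i + s)) (j + p * (i - 1)) = u (j + p * (i - 1) + s)"
            using in_n[OF that] by (simp only: restrict_apply')
          then show "(\<lambda>i \<in> {1..?n}. u (i + s)) (j + p * (i - 1)) = u (j + s + p * (i - 1))"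
            by (simp only: ac_simps)
        qed
        with \<open>_ \<in> {1..?n} \<rightarrow>\<^sub>E univ A\<close> show ?thesis by (simp add: block_def v_def)
      qed
      ultimately show ?thesis by (simp add: t_def cong: restrict_cong)
    qed
    have v_in: "v j \<in> univ A" for j
    proof -
      have "(\<lambda>i \<in> {1..q}. u (j + p * (i - 1))) \<in> {1..q} \<rightarrow>\<^sub>E univ A" using u by auto
      moreover have "d \<in> term_ops A {1..q}" using d unfolding cyclic_term_def by blast
      ultimately show ?thesis unfolding v_def using term_ops_closed[OF A] by blast
    qed
    have "v (j + p) = v j" for j
    proof -
      \<comment> \<open>the sequence that the \<open>j\<close>-th block reads, indexed from 1; a full period is added before \<open>p\<close> is
        subtracted so that truncated subtraction does no harm at \<open>i = 0\<close>\<close>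
      define y where "y i = u (j + p * i + p * q - p)" for i
      have y: "y i \<in> univ A" "y (i + q) = y i" for i
      proof -
        have "j + p * (i + q) + p * q - p = (j + p * i + p * q - p) + ?n"
          using q by (cases q) (auto simp: algebra_simps)
        then show "y (i + q) = y i" using u by (simp add: y_def)
      qed (use u in \<open>simp add: y_def\<close>)
      have ui: "u (k + ?n) = u k" for k using u by blast
      have "y i = u (j + p * (i - 1))" if "i \<ge> 1" for i
      proof -
        have "j + p * i + p * q - p = j + p * (i - 1) + ?n"
          using that by (cases i) (auto simp: algebra_simps)
        then show ?thesis by (simp add: y_def ui)
      qed
      then have "(\<lambda>i \<in> {1..q}. y i) = (\<lambda>i \<in> {1..q}. u (j + p * (i - 1)))"
        "(\<lambda>i \<in> {1..q}. y (Suc i)) = (\<lambda>i \<in> {1..q}. u (j + p + p * (i - 1)))"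
        by (auto intro!: restrict_ext simp: algebra_simps)
      moreover have "d (\<lambda>i \<in> {1..q}. y (Suc i)) = d (\<lambda>i \<in> {1..q}. y i)"
        using d y unfolding cyclic_term_def by blast
      ultimately show ?thesis by (simp add: v_def)
    qed
    then have "c (\<lambda>j \<in> {1..p}. v (Suc j)) = c (\<lambda>j \<in> {1..p}. v j)"
      using c v_in unfolding cyclic_term_def by blast
    then show ?thesis using eval[of 0] eval[of 1] by simp
  qed
  ultimately show ?thesis unfolding cyclic_term_def by blast
qed

text \<open>
  Identify the variables of a cyclic term of arity \<open>n\<close> periodically modulo \<open>p\<close>.
\<close>

lemma cyclic_term_dvd:
  assumes A: "finite_algebra A" and p: "p \<ge> 1" and "p dvd n" and c: "cyclic_term n A c"
  shows "\<exists>t. cyclic_term p A t"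
proof -
  obtain q where n: "n = p * q" using assms(3) by auto
  define t where "t = (\<lambda>x \<in> {1..p} \<rightarrow>\<^sub>E univ A. c (\<lambda>i \<in> {1..n}. x ((i + p - 1) mod p + 1)))"
  have "t \<in> term_ops A {1..p}"
    unfolding t_def using c p by (intro term_ops_reindex[OF A]) (auto simp: cyclic_term_def Suc_le_eq)
  moreover have "t (\<lambda>i \<in> {1..p}. u (Suc i)) = t (\<lambda>i \<in> {1..p}. u i)"
    if u: "\<forall>i. u i \<in> univ A \<and> u (i + p) = u i" for u
  proof -
    have mult: "u (i + p * k) = u i" for i k
    proof (induction k)
      case (Suc k)
      have "u (i + p * Suc k) = u (i + p * k + p)" by (simp add: ac_simps)
      also have "\<dots> = u (i + p * k)" using u by blast
      finally show ?case using Suc by simp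
    qed simp
    have red: "u ((i + p - 1) mod p + 1 + s) = u (i + s)" if "i \<ge> 1" for i s
    proof -
      have "i + p - 1 = (i - 1) + p" using that by simp
      then have "(i + p - 1) mod p = (i - 1) mod p" by simp
      then have "u ((i + p - 1) mod p + 1 + s) = u ((i - 1) mod p + 1 + s + p * ((i - 1) div p))"
        by (simp only: mult)
      also have "(i - 1) mod p + 1 + s + p * ((i - 1) div p) = ((i - 1) mod p + p * ((i - 1) div p)) + 1 + s"
        by (simp only: ac_simps)
      also have "\<dots> = i + s" using that by simp
      finally show ?thesis .
    qed
    have eval: "t (\<lambda>i \<in> {1..p}. u (i + s)) = c (\<lambda>i \<in> {1..n}. u (i + s))" for s
    proof -
      have "(\<lambda>i \<in> {1..p}. u (i + s)) \<in> {1..p} \<rightarrow>\<^sub>E univ A" using u by auto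
      moreover have "(\<lambda>i \<in> {1..n}. (\<lambda>i \<in> {1..p}. u (i + s)) ((i + p - 1) mod p + 1)) = (\<lambda>i \<in> {1..n}. u (i + s))"
        using p red by (intro restrict_ext) (auto simp: Suc_le_eq)
      ultimately show ?thesis by (simp add: t_def)
    qed
    have "u (i + n) = u i" for i using mult n by simp
    then have "c (\<lambda>i \<in> {1..n}. u (Suc i)) = c (\<lambda>i \<in> {1..n}. u i)"
      using c u unfolding cyclic_term_def by blast
    then show ?thesis using eval[of 0] eval[of 1] by simp
  qed
  ultimately show ?thesis unfolding cyclic_term_def by blast
qed

lemma cyclic_term_iff_primes:
  assumes A: "finite_algebra A" and "n \<ge> 1"
  shows "(\<exists>t. cyclic_term n A t) \<longleftrightarrow> (\<forall>p. prime p \<and> p dvd n \<longrightarrow> (\<exists>t. cyclic_term p A t))"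
proof
  assume "\<exists>t. cyclic_term n A t"
  then show "\<forall>p. prime p \<and> p dvd n \<longrightarrow> (\<exists>t. cyclic_term p A t)"
    using cyclic_term_dvd[OF A] prime_ge_1_nat by blast
next
  assume "\<forall>p. prime p \<and> p dvd n \<longrightarrow> (\<exists>t. cyclic_term p A t)"
  with assms(2) show "\<exists>t. cyclic_term n A t"
  proof (induction n rule: less_induct)
    case (less n)
    show ?case
    proof (cases "n = 1")
      case True
      have "u (Suc 0 + 1) = u (Suc 0)" if "\<forall>i. u i \<in> univ A \<and> u (i + 1) = u i" for u :: "nat \<Rightarrow> 'a"
        using that by blast
      then have "cyclic_term 1 A (\<lambda>x \<in> {1..1} \<rightarrow>\<^sub>E univ A. x 1)"
        unfolding cyclic_term_def by (auto intro!: term_ops.proj)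
      with True show ?thesis by blast
    next
      case False
      then obtain p where p: "prime p" "p dvd n" using prime_factor_nat by blast
      then obtain q where q: "n = p * q" by auto
      have "q \<ge> 1" using q less.prems(1) by (cases q) auto
      moreover have "q < n" using q \<open>q \<ge> 1\<close> prime_gt_1_nat[OF p(1)] by simp
      moreover have "\<forall>p. prime p \<and> p dvd q \<longrightarrow> (\<exists>t. cyclic_term p A t)"
        using less.prems(2) q by auto
      ultimately obtain d where "cyclic_term q A d" using less.IH by blast
      moreover obtain c where "cyclic_term p A c" using less.prems(2) p by blast
      ultimately show ?thesis
        using cyclic_term_mult[OF A _ \<open>q \<ge> 1\<close>] prime_ge_1_nat[OF p(1)] q by blast
    qed
  qed
qed

section \<open>A language of bounded loops and its compilation\<close>

text \<open>
  A store has scalars, which are the row 0, and arrays, which are the other rows.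
\<close>

type_synonym store = "nat \<Rightarrow> nat \<Rightarrow> nat"

definition upd :: "store \<Rightarrow> nat \<Rightarrow> nat \<Rightarrow> nat \<Rightarrow> store" where
  "upd s b i v = s(b := (s b)(i := v))"

lemma upd_apply [simp]: "upd s b i v b' i' = (if b' = b \<and> i' = i then v else s b' i')"
  by (simp add: upd_def)

lemma upd_other [simp]: "b' \<noteq> b \<Longrightarrow> upd s b i v b' = s b'"
  by (simp add: upd_def)

lemma upd_upd [simp]: "upd (upd s b i v) b i v' = upd s b i v'"
  by (simp add: upd_def)

text \<open>
  \<open>Get x b y\<close> loads into scalar \<open>x\<close> the entry of array \<open>b\<close> whose index is in scalar \<open>y\<close>; \<open>Put b x y\<close> stores scalar \<open>y\<close>
  at the index in scalar \<open>x\<close>; \<open>Inp\<close> reads the input. \<open>For x y c\<close> runs \<open>c\<close> with \<open>x\<close> counting from 0 up to the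
  initial value of \<open>y\<close>, so that every program terminates and both its effect and its cost are
  primitive recursive.
\<close>

datatype com =
    Lit nat nat
  | Mov nat nat
  | Plus nat nat nat
  | Minus nat nat nat
  | Get nat nat nat
  | Put nat nat nat
  | Inp nat nat
  | Seq com com  (infixr \<open>;;\<close> 60)
  | Cond nat com com
  | For nat nat com

primrec sem :: "nat list \<Rightarrow> com \<Rightarrow> store \<Rightarrow> store" where
  "sem w (Lit x c) s = upd s 0 x c"
| "sem w (Mov x y) s = upd s 0 x (s 0 y)"
| "sem w (Plus x y z) s = upd s 0 x (s 0 y + s 0 z)"
| "sem w (Minus x y z) s = upd s 0 x (s 0 y - s 0 z)"
| "sem w (Get x b y) s = upd s 0 x (s b (s 0 y))"
| "sem w (Put b x y) s = upd s b (s 0 x) (s 0 y)"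
| "sem w (Inp x y) s = upd s 0 x (if s 0 y < length w then w ! s 0 y else 0)"
| "sem w (c ;; d) s = sem w d (sem w c s)"
| "sem w (Cond x c d) s = (if s 0 x \<noteq> 0 then sem w c s else sem w d s)"
| "sem w (For x y c) s = upd (fold (\<lambda>i t. sem w c (upd t 0 x i)) [0..<s 0 y] s) 0 x (s 0 y)"

primrec cost :: "nat list \<Rightarrow> com \<Rightarrow> store \<Rightarrow> nat" where
  "cost w (Lit x c) s = 1"
| "cost w (Mov x y) s = 1"
| "cost w (Plus x y z) s = 1"
| "cost w (Minus x y z) s = 1"
| "cost w (Get x b y) s = 1"
| "cost w (Put b x y) s = 1"
| "cost w (Inp x y) s = 1"
| "cost w (c ;; d) s = cost w c s + cost w d (sem w c s)"
| "cost w (Cond x c d) s = 1 + (if s 0 x \<noteq> 0 then cost w c s else cost w d s)"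
| "cost w (For x y c) s = 1 + (\<Sum>j<s 0 y. 1 + cost w c (upd (fold (\<lambda>i t. sem w c (upd t 0 x i)) [0..<j] s) 0 x j))"

primrec writes :: "com \<Rightarrow> nat \<Rightarrow> nat \<Rightarrow> bool" where
  "writes (Lit x c) b i = (b = 0 \<and> i = x)"
| "writes (Mov x y) b i = (b = 0 \<and> i = x)"
| "writes (Plus x y z) b i = (b = 0 \<and> i = x)"
| "writes (Minus x y z) b i = (b = 0 \<and> i = x)"
| "writes (Get x b' y) b i = (b = 0 \<and> i = x)"
| "writes (Put b' x y) b i = (b = b')"
| "writes (Inp x y) b i = (b = 0 \<and> i = x)"
| "writes (c ;; d) b i = (writes c b i \<or> writes d b i)"
| "writes (Cond x c d) b i = (writes c b i \<or> writes d b i)"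
| "writes (For x y c) b i = (b = 0 \<and> i = x \<or> writes c b i)"

lemma sem_unwritten: "\<not> writes c b i \<Longrightarrow> sem w c s b i = s b i"
proof (induction c arbitrary: s)
  case (For x y c)
  have "fold (\<lambda>i t. sem w c (upd t 0 x i)) [0..<N] s b i = s b i" for N
    by (induction N) (use For in auto)
  with For.prems show ?case by auto
qed auto

text \<open>
  A loop is compiled to a test of its counter against its bound in every round. This agrees with \<open>sem\<close>
  when the body changes neither of the two. Rows are limited by the 16-fold interleaving of the compiled
  memory layout.
\<close>

primrec wf_com :: "com \<Rightarrow> bool" where
  "wf_com (Lit x c) = True"
| "wf_com (Mov x y) = True"
| "wf_com (Plus x y z) = True"
| "wf_com (Minus x y z) = True"
| "wf_com (Get x b y) = (b < 15)"
| "wf_com (Put b x y) = (b < 15)"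
| "wf_com (Inp x y) = True"
| "wf_com (c ;; d) = (wf_com c \<and> wf_com d)"
| "wf_com (Cond x c d) = (wf_com c \<and> wf_com d)"
| "wf_com (For x y c) = (x \<noteq> y \<and> \<not> writes c 0 x \<and> \<not> writes c 0 y \<and> wf_com c)"

text \<open>
  Entry \<open>i\<close> of row \<open>b\<close> lives in machine register \<open>16 * i + b\<close>, so that unboundedly long arrays coexist; the
  multiple of 16 is computed by four doublings. Row 15 is never used by a program, and its registers 15 and
  31 serve as scratch.
\<close>

definition address_code :: "nat \<Rightarrow> nat \<Rightarrow> instr list" where
  "address_code b y = [AddReg 15 (16 * y) (16 * y), AddReg 15 15 15, AddReg 15 15 15,
     AddReg 15 15 15, SetConst 31 b, AddReg 15 15 31]"

primrec compile :: "com \<Rightarrow> nat \<Rightarrow> instr list" where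
  "compile (Lit x c) a = [SetConst (16 * x) c]"
| "compile (Mov x y) a = [Move (16 * x) (16 * y)]"
| "compile (Plus x y z) a = [AddReg (16 * x) (16 * y) (16 * z)]"
| "compile (Minus x y z) a = [SubReg (16 * x) (16 * y) (16 * z)]"
| "compile (Get x b y) a = address_code b y @ [LoadInd (16 * x) 15]"
| "compile (Put b x y) a = address_code b x @ [StoreInd 15 (16 * y)]"
| "compile (Inp x y) a = [ReadInput (16 * x) (16 * y)]"
| "compile (c ;; d) a = (let C = compile c a in C @ compile d (a + length C))"
| "compile (Cond x c d) a =
     (let C = compile c (a + 1); D = compile d (a + 2 + length C) in
      [JumpZero (16 * x) (a + 2 + length C)] @ C @ [Jump (a + 2 + length C + length D)] @ D)"
| "compile (For x y c) a =
     (let C = compile c (a + 3) in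
      [SetConst (16 * x) 0, SubReg 15 (16 * y) (16 * x), JumpZero 15 (a + 6 + length C)] @ C @
      [SetConst 15 1, AddReg (16 * x) (16 * x) 15, Jump (a + 1)])"

definition code_at :: "instr list \<Rightarrow> nat \<Rightarrow> instr list \<Rightarrow> bool" where
  "code_at P a is \<longleftrightarrow> (\<forall>i<length is. a + i < length P \<and> P ! (a + i) = is ! i)"

lemma code_at_Nil [simp]: "code_at P a []"
  by (simp add: code_at_def)

lemma code_at_Cons [simp]:
  "code_at P a (x # xs) \<longleftrightarrow> a < length P \<and> P ! a = x \<and> code_at P (Suc a) xs"
proof -
  have "(\<forall>i<Suc n. Q i) \<longleftrightarrow> Q 0 \<and> (\<forall>i<n. Q (Suc i))" for Q and n :: nat
    using less_Suc_eq_0_disj by auto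
  then show ?thesis by (simp add: code_at_def)
qed

lemma code_at_append [simp]:
  "code_at P a (xs @ ys) \<longleftrightarrow> code_at P a xs \<and> code_at P (a + length xs) ys"
  by (induction xs arbitrary: a) auto

definition represents :: "(nat \<Rightarrow> nat) \<Rightarrow> store \<Rightarrow> bool" where
  "represents R s \<longleftrightarrow> (\<forall>b<15. \<forall>i. R (16 * i + b) = s b i)"

definition reaches :: "instr list \<Rightarrow> nat list \<Rightarrow> nat \<Rightarrow> ram_config \<Rightarrow> ram_config \<Rightarrow> bool" where
  "reaches P w T u v \<longleftrightarrow> (\<exists>T'\<le>T. (ram_step P w ^^ T') u = v)"

lemma reaches_refl: "reaches P w T u u"
  unfolding reaches_def by (intro exI[of _ 0]) simp

lemma reaches_trans: "reaches P w T1 u v \<Longrightarrow> reaches P w T2 v x \<Longrightarrow> reaches P w (T1 + T2) u x"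
  unfolding reaches_def
proof (elim exE conjE)
  fix a b assume "a \<le> T1" "(ram_step P w ^^ a) u = v" "b \<le> T2" "(ram_step P w ^^ b) v = x"
  thus "\<exists>T'\<le>T1 + T2. (ram_step P w ^^ T') u = x"
    by (intro exI[of _ "b + a"]) (simp add: funpow_add)
qed

lemma reaches_mono: "reaches P w T u v \<Longrightarrow> T \<le> T' \<Longrightarrow> reaches P w T' u v"
  unfolding reaches_def by (blast intro: le_trans)

lemma reaches_step:
  assumes "fst u < length P" "reaches P w T (exec_instr w (P ! fst u) u) v"
  shows "reaches P w (Suc T) u v"
proof -
  obtain T' where "T' \<le> T" "(ram_step P w ^^ T') (ram_step P w u) = v"
    using assms by (auto simp: reaches_def ram_step_def)
  thus ?thesis unfolding reaches_def
    by (intro exI[of _ "Suc T'"]) (simp add: funpow_Suc_right del: funpow.simps)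
qed

lemma represents_scalar: "represents R s \<Longrightarrow> R (16 * x) = s 0 x"
  unfolding represents_def by (metis add.right_neutral zero_less_numeral)

lemma represents_upd:
  assumes "represents R s" "b < 15"
  shows "represents (R(16 * i + b := v)) (upd s b i v)"
  unfolding represents_def
proof (intro allI impI)
  fix b' i' :: nat assume "b' < 15"
  have "(16 * j + d) mod 16 = d \<and> (16 * j + d) div 16 = j" if "d < 15" for j d :: nat
    using that by simp
  from this[of b' i'] this[of b i]
  have "16 * i' + b' = 16 * i + b \<longleftrightarrow> b' = b \<and> i' = i"
    using \<open>b' < 15\<close> \<open>b < 15\<close> by metis
  then show "(R(16 * i + b := v)) (16 * i' + b') = upd s b i v b' i'"
    using assms \<open>b' < 15\<close> by (auto simp: represents_def)
qed

lemma represents_upd_scalar: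
  "represents R s \<Longrightarrow> represents (R(16 * i := v)) (upd s 0 i v)"
  using represents_upd[of R s 0] by simp

lemma represents_scratch:
  assumes "represents R s" "j mod 16 = 15"
  shows "represents (R(j := v)) s"
proof -
  have "16 * i + b \<noteq> j" if "b < 15" for b i :: nat
    using assms(2) that by auto
  with assms(1) show ?thesis by (auto simp: represents_def)
qed

primrec straight :: "instr \<Rightarrow> bool" where
  "straight (SetConst i c) = True"
| "straight (Move i j) = True"
| "straight (AddReg i j k) = True"
| "straight (SubReg i j k) = True"
| "straight (LoadInd i j) = True"
| "straight (StoreInd i j) = True"
| "straight (ReadInput i j) = True"
| "straight (Jump l) = False"
| "straight (JumpZero i l) = False"

lemma reaches_straight:
  assumes "code_at P a is" "list_all straight is"
  shows "reaches P w (length is) (a, R) (fold (exec_instr w) is (a, R))"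
  using assms
proof (induction "is" arbitrary: a R)
  case Nil
  show ?case by (simp add: reaches_refl)
next
  case (Cons x xs)
  obtain R' where R': "exec_instr w x (a, R) = (Suc a, R')"
    using Cons.prems by (cases x) auto
  have "reaches P w (length xs) (Suc a, R') (fold (exec_instr w) xs (Suc a, R'))"
    using Cons by simp
  with R' Cons.prems show ?case
    by (auto intro: reaches_step)
qed

lemma fold_address_code:
  assumes "represents R s"
  shows "fold (exec_instr w) (address_code b y) (a, R) =
    (a + 6, R(15 := 16 * s 0 y + b, 31 := b))"
proof -
  have "R(15 := v, 31 := b) = R(31 := b, 15 := v)" for v
    by (rule fun_upd_twist) simp
  moreover have sixteen: "v + v + (v + v) + (v + v + (v + v)) +
      (v + v + (v + v) + (v + v + (v + v))) = 16 * v" for v :: nat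
    by simp
  ultimately show ?thesis
    using represents_scalar[OF assms, of y]
    by (simp add: address_code_def sixteen)
qed

lemma represents_address:
  assumes "represents R s"
  shows "represents (R(15 := u, 31 := v)) s"
  using assms by (intro represents_scratch) auto

lemma reaches_representedI:
  assumes "reaches P w T u (pc, R')" "represents R' s'" "T \<le> T'" "pc = pc'"
  shows "\<exists>R'. reaches P w T' u (pc', R') \<and> represents R' s'"
  using assms reaches_mono by blast

text \<open>
  Every unit of \<open>cost\<close> becomes at most ten machine steps: the longest unit is one round of a loop or
  an array access, with seven or fewer instructions of overhead.
\<close>

lemma compile_correct:
  assumes "wf_com c" "code_at P a (compile c a)" "represents R s"
  shows "\<exists>R'. reaches P w (10 * cost w c s) (a, R) (a + length (compile c a), R') \<and>
    represents R' (sem w c s)"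
  using assms
proof (induction c arbitrary: a R s)
  case (Lit x c)
  have "reaches P w 1 (a, R) (a + 1, R(16 * x := c))"
    using reaches_straight[OF Lit(2), of w R] by simp
  then show ?case
    by (rule reaches_representedI) (use represents_upd_scalar[OF Lit(3)] in \<open>simp_all del: upd_apply\<close>)
next
  case (Mov x y)
  have "reaches P w 1 (a, R) (a + 1, R(16 * x := s 0 y))"
    using reaches_straight[OF Mov(2), of w R] represents_scalar[OF Mov(3)] by simp
  then show ?case
    by (rule reaches_representedI) (use represents_upd_scalar[OF Mov(3)] in \<open>simp_all del: upd_apply\<close>)
next
  case (Plus x y z)
  have "reaches P w 1 (a, R) (a + 1, R(16 * x := s 0 y + s 0 z))"
    using reaches_straight[OF Plus(2), of w R] represents_scalar[OF Plus(3)] by simp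
  then show ?case
    by (rule reaches_representedI) (use represents_upd_scalar[OF Plus(3)] in \<open>simp_all del: upd_apply\<close>)
next
  case (Minus x y z)
  have "reaches P w 1 (a, R) (a + 1, R(16 * x := s 0 y - s 0 z))"
    using reaches_straight[OF Minus(2), of w R] represents_scalar[OF Minus(3)] by simp
  then show ?case
    by (rule reaches_representedI) (use represents_upd_scalar[OF Minus(3)] in \<open>simp_all del: upd_apply\<close>)
next
  case (Inp x y)
  let ?v = "if s 0 y < length w then w ! s 0 y else 0"
  have "reaches P w 1 (a, R) (a + 1, R(16 * x := ?v))"
    using reaches_straight[OF Inp(2), of w R] represents_scalar[OF Inp(3), of y]
    by (simp split del: if_split cong: if_cong)
  then show ?case
    by (rule reaches_representedI) (use represents_upd_scalar[OF Inp(3)] in \<open>simp_all del: upd_apply\<close>)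
next
  case (Get x b y)
  let ?R = "R(15 := 16 * s 0 y + b, 31 := b)"
  have rep: "represents ?R s" by (rule represents_address[OF Get(3)])
  have "?R (16 * s 0 y + b) = s b (s 0 y)"
    using rep Get(1) unfolding represents_def by (metis wf_com.simps(5))
  moreover have "?R 15 = 16 * s 0 y + b" by simp
  ultimately have "exec_instr w (LoadInd (16 * x) 15) (a + 6, ?R) =
      (a + 6 + 1, ?R(16 * x := s b (s 0 y)))"
    by (simp only: exec_instr.simps)
  moreover have "list_all straight (compile (Get x b y) a)" by (simp add: address_code_def)
  moreover have "length (compile (Get x b y) a) = 7" by (simp add: address_code_def)
  ultimately have "reaches P w 7 (a, R) (a + 6 + 1, ?R(16 * x := s b (s 0 y)))"
    using reaches_straight[OF Get(2), of w R] fold_address_code[OF Get(3), of w b y a]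
    by (simp only: compile.simps fold_append fold_simps comp_apply)
  then show ?case
    by (rule reaches_representedI) (use represents_upd_scalar[OF rep] in \<open>simp_all add: address_code_def del: upd_apply\<close>)
next
  case (Put b x y)
  let ?R = "R(15 := 16 * s 0 x + b, 31 := b)"
  have rep: "represents ?R s" by (rule represents_address[OF Put(3)])
  have "?R (16 * y) = s 0 y" by (rule represents_scalar[OF rep])
  moreover have "?R 15 = 16 * s 0 x + b" by simp
  ultimately have "exec_instr w (StoreInd 15 (16 * y)) (a + 6, ?R) =
      (a + 6 + 1, ?R(16 * s 0 x + b := s 0 y))"
    by (simp only: exec_instr.simps)
  moreover have "list_all straight (compile (Put b x y) a)" by (simp add: address_code_def)
  moreover have "length (compile (Put b x y) a) = 7" by (simp add: address_code_def)
  ultimately have "reaches P w 7 (a, R) (a + 6 + 1, ?R(16 * s 0 x + b := s 0 y))"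
    using reaches_straight[OF Put(2), of w R] fold_address_code[OF Put(3), of w b x a]
    by (simp only: compile.simps fold_append fold_simps comp_apply)
  then show ?case
    by (rule reaches_representedI) (use represents_upd[OF rep] Put(1) in \<open>simp_all add: address_code_def del: upd_apply\<close>)
next
  case (Seq c d)
  let ?C = "compile c a"
  have code: "code_at P a ?C" "code_at P (a + length ?C) (compile d (a + length ?C))"
    using Seq.prems(2) by (simp_all add: Let_def)
  obtain R1 where R1: "reaches P w (10 * cost w c s) (a, R) (a + length ?C, R1)"
    "represents R1 (sem w c s)"
    using Seq.IH(1)[OF _ code(1) Seq.prems(3)] Seq.prems(1) by auto
  obtain R2 where R2: "reaches P w (10 * cost w d (sem w c s)) (a + length ?C, R1)
      (a + length ?C + length (compile d (a + length ?C)), R2)"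
    "represents R2 (sem w d (sem w c s))"
    using Seq.IH(2)[OF _ code(2) R1(2)] Seq.prems(1) by auto
  show ?case
    using reaches_trans[OF R1(1) R2(1)] R2(2)
    by (auto simp: Let_def algebra_simps)
next
  case (Cond x c d)
  define C where "C = compile c (a + 1)"
  define D where "D = compile d (a + 2 + length C)"
  have code: "a < length P" "P ! a = JumpZero (16 * x) (a + 2 + length C)"
    "code_at P (a + 1) C" "a + 1 + length C < length P"
    "P ! (a + 1 + length C) = Jump (a + 2 + length C + length D)"
    "code_at P (a + 2 + length C) D"
    using Cond.prems(2) by (simp_all add: Let_def C_def D_def)
  have len: "length (compile (Cond x c d) a) = 2 + length C + length D"
    by (simp add: Let_def C_def D_def)
  have x: "R (16 * x) = s 0 x" by (rule represents_scalar[OF Cond.prems(3)])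
  show ?case
  proof (cases "s 0 x = 0")
    case True
    obtain R' where R': "reaches P w (10 * cost w d s) (a + 2 + length C, R)
        (a + 2 + length C + length D, R')" "represents R' (sem w d s)"
      using Cond.IH(2)[OF _ code(6)[unfolded D_def] Cond.prems(3)] Cond.prems(1)
      by (auto simp: D_def)
    have "reaches P w (Suc (10 * cost w d s)) (a, R) (a + 2 + length C + length D, R')"
      using code(1,2) x True R'(1) by (intro reaches_step) auto
    with R'(2) True show ?thesis
      unfolding len by (auto simp: add.assoc elim!: reaches_mono intro!: exI[of _ R'])
  next
    case False
    obtain R' where R': "reaches P w (10 * cost w c s) (a + 1, R) (a + 1 + length C, R')"
        "represents R' (sem w c s)"
      using Cond.IH(1)[OF _ code(3)[unfolded C_def] Cond.prems(3)] Cond.prems(1)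
      by (auto simp: C_def)
    have 1: "reaches P w (Suc (10 * cost w c s)) (a, R) (a + 1 + length C, R')"
      using code(1,2) x False R'(1) by (intro reaches_step) auto
    have 2: "reaches P w (Suc 0) (a + 1 + length C, R') (a + 2 + length C + length D, R')"
      using code(4,5) by (intro reaches_step) (auto intro: reaches_refl)
    from reaches_trans[OF 1 2] R'(2) False show ?thesis
      unfolding len by (auto simp: add.assoc elim!: reaches_mono intro!: exI[of _ R'])
  qed
next
  case (For x y c)
  define C where "C = compile c (a + 3)"
  define body where "body = (\<lambda>i t. sem w c (upd t 0 x i))"
  define at where "at = (\<lambda>j. upd (fold body [0..<j] s) 0 x j)"
  let ?N = "s 0 y"
  have code: "a < length P" "P ! a = SetConst (16 * x) 0" "code_at P (a + 3) C"
    "code_at P (a + 1) [SubReg 15 (16 * y) (16 * x)]"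
    "a + 2 < length P" "P ! (a + 2) = JumpZero 15 (a + 6 + length C)"
    "code_at P (a + 3 + length C) [SetConst 15 1, AddReg (16 * x) (16 * x) 15]"
    "a + 5 + length C < length P" "P ! (a + 5 + length C) = Jump (a + 1)"
    using For.prems(2) by (simp_all add: Let_def C_def add.assoc numeral_eq_Suc)
  have xy: "x \<noteq> y" "\<not> writes c 0 x" "\<not> writes c 0 y" "wf_com c"
    using For.prems(1) by auto
  have at_y: "at j 0 y = ?N" for j
    using xy by (induction j) (auto simp: at_def body_def sem_unwritten)
  have test: "reaches P w 1 (a + 1, R) (a + 2, R(15 := R (16 * y) - R (16 * x)))" for R
    using reaches_straight[OF code(4), of w R] by simp
  \<comment> \<open>one round of the loop, from the test to the next test\<close>
  have round: "\<exists>R'. reaches P w (10 + 10 * cost w c (at j)) (a + 1, R) (a + 1, R') \<and>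
      represents R' (at (Suc j))" if "j < ?N" "represents R (at j)" for j R
  proof -
    have val: "R (16 * y) - R (16 * x) \<noteq> 0"
      using that at_y[of j] by (simp add: represents_scalar at_def)
    let ?R = "R(15 := R (16 * y) - R (16 * x))"
    have rep: "represents ?R (at j)" using that(2) by (intro represents_scratch) auto
    have 1: "reaches P w (Suc 0) (a + 2, ?R) (a + 3, ?R)"
      using code(5,6) val by (intro reaches_step) (auto intro: reaches_refl simp: numeral_3_eq_3)
    obtain R1 where R1: "reaches P w (10 * cost w c (at j)) (a + 3, ?R) (a + 3 + length C, R1)"
      "represents R1 (sem w c (at j))"
      using For.IH[OF xy(4) code(3)[unfolded C_def] rep, folded C_def] by blast
    have x: "R1 (16 * x) = j"
      using represents_scalar[OF R1(2), of x] xy by (simp add: sem_unwritten at_def)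
    let ?R2 = "R1(15 := 1, 16 * x := j + 1)"
    have n15: "16 * x \<noteq> 15" by arith
    have 2: "reaches P w 2 (a + 3 + length C, R1) (a + 5 + length C, ?R2)"
      using reaches_straight[OF code(7), of w R1] x n15
      by (simp add: numeral_eq_Suc)
    have 3: "reaches P w (Suc 0) (a + 5 + length C, ?R2) (a + 1, ?R2)"
      using code(8,9) by (intro reaches_step) (auto intro: reaches_refl)
    have "represents ?R2 (upd (sem w c (at j)) 0 x (j + 1))"
      by (intro represents_upd_scalar represents_scratch R1(2)) auto
    also have "upd (sem w c (at j)) 0 x (j + 1) = at (Suc j)"
      by (simp add: at_def body_def)
    finally have "represents ?R2 (at (Suc j))" .
    from reaches_trans[OF test reaches_trans[OF 1 reaches_trans[OF R1(1) reaches_trans[OF 2 3]]]] this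
    show ?thesis by (rule reaches_representedI) simp_all
  qed
  have loop: "\<exists>R'. reaches P w (\<Sum>i<j. 10 + 10 * cost w c (at i)) (a + 1, R(16 * x := 0)) (a + 1, R') \<and>
      represents R' (at j)" if "j \<le> ?N" for j
    using that
  proof (induction j)
    case 0
    have "represents (R(16 * x := 0)) (at 0)"
      using represents_upd_scalar[OF For.prems(3)] by (simp add: at_def)
    with reaches_refl show ?case by blast
  next
    case (Suc j)
    then obtain R1 where "reaches P w (\<Sum>i<j. 10 + 10 * cost w c (at i)) (a + 1, R(16 * x := 0)) (a + 1, R1)"
      "represents R1 (at j)" using Suc_leD by blast
    moreover from this round[of j R1] Suc.prems obtain R2 where
      "reaches P w (10 + 10 * cost w c (at j)) (a + 1, R1) (a + 1, R2)" "represents R2 (at (Suc j))"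
      by auto
    ultimately show ?case
      using reaches_trans unfolding sum.lessThan_Suc by blast
  qed
  obtain R1 where R1: "reaches P w (\<Sum>i<?N. 10 + 10 * cost w c (at i)) (a + 1, R(16 * x := 0)) (a + 1, R1)"
    "represents R1 (at ?N)" using loop[of ?N] by auto
  let ?R = "R1(15 := R1 (16 * y) - R1 (16 * x))"
  have zero: "R1 (16 * y) - R1 (16 * x) = 0"
    using at_y[of ?N] R1(2) by (simp add: represents_scalar at_def)
  have 0: "reaches P w (Suc (\<Sum>i<?N. 10 + 10 * cost w c (at i))) (a, R) (a + 1, R1)"
    using code(1,2) R1(1) by (intro reaches_step) auto
  have 1: "reaches P w (Suc 0) (a + 2, ?R) (a + 6 + length C, ?R)"
    using code(5,6) zero by (intro reaches_step) (auto intro: reaches_refl)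
  have rep: "represents ?R (at ?N)" using R1(2) by (intro represents_scratch) auto
  have T: "Suc (\<Sum>i<?N. 10 + 10 * cost w c (at i)) + (1 + Suc 0) \<le> 10 * cost w (For x y c) s"
    by (simp add: at_def body_def sum.distrib sum_distrib_left)
  have "a + 6 + length C = a + length (compile (For x y c) a)"
    by (simp add: Let_def C_def)
  moreover have "represents ?R (sem w (For x y c) s)"
    using rep by (simp add: at_def body_def del: upd_apply)
  ultimately show ?case
    using reaches_representedI[OF reaches_trans[OF 0 reaches_trans[OF test 1]] _ T] by blast
qed

text \<open>
  Total correctness together with a time bound. The rules below propagate a budget \<open>T\<close> forwards; those
  for sequences and loops also supply the fact that places not written by the program keep their contents,
  so that invariants need to mention only what changes.
\<close>

definition runs :: "nat list \<Rightarrow> com \<Rightarrow> store \<Rightarrow> nat \<Rightarrow> (store \<Rightarrow> bool) \<Rightarrow> bool" where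
  "runs w c s T Q \<longleftrightarrow> cost w c s \<le> T \<and> Q (sem w c s)"

lemma runs_frame:
  assumes "runs w c s T Q"
    and "\<And>t. Q t \<Longrightarrow> (\<And>b i. \<not> writes c b i \<Longrightarrow> t b i = s b i) \<Longrightarrow> Q' t" and "T \<le> T'"
  shows "runs w c s T' Q'"
  using assms by (auto simp: runs_def sem_unwritten)

lemma runs_Seq:
  assumes "runs w c s T1 R" "\<And>t. R t \<Longrightarrow> (\<And>b i. \<not> writes c b i \<Longrightarrow> t b i = s b i) \<Longrightarrow> runs w d t T2 Q"
    "T1 + T2 \<le> T"
  shows "runs w (c ;; d) s T Q"
  using assms by (fastforce simp: runs_def sem_unwritten)

lemma runs_For:
  assumes "I 0 s"
    and step: "\<And>i t. i < s 0 y \<Longrightarrow> I i t \<Longrightarrow> (\<And>b j. \<not> writes (For x y c) b j \<Longrightarrow> t b j = s b j) \<Longrightarrow>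
        runs w c (upd t 0 x i) (B i) (\<lambda>t. I (Suc i) t)"
    and Q: "\<And>t. I (s 0 y) t \<Longrightarrow> (\<And>b j. \<not> writes (For x y c) b j \<Longrightarrow> t b j = s b j) \<Longrightarrow>
       Q (upd t 0 x (s 0 y))"
    and T: "1 + (\<Sum>i<s 0 y. 1 + B i) \<le> T"
  shows "runs w (For x y c) s T Q"
proof -
  define body where "body = (\<lambda>i t. sem w c (upd t 0 x i))"
  have inv: "I j (fold body [0..<j] s) \<and>
      (\<forall>b i. \<not> writes (For x y c) b i \<longrightarrow> fold body [0..<j] s b i = s b i) \<and>
      (\<Sum>i<j. 1 + cost w c (upd (fold body [0..<i] s) 0 x i)) \<le> (\<Sum>i<j. 1 + B i)"
    if "j \<le> s 0 y" for j
    using that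
  proof (induction j)
    case 0
    then show ?case using assms(1) by simp
  next
    case (Suc j)
    then have "runs w c (upd (fold body [0..<j] s) 0 x j) (B j) (\<lambda>t. I (Suc j) t)"
      by (intro step) auto
    then have "cost w c (upd (fold body [0..<j] s) 0 x j) \<le> B j"
      "I (Suc j) (body j (fold body [0..<j] s))"
      by (simp_all add: runs_def body_def del: upd_apply)
    moreover have "body j t b i = t b i" if "\<not> writes (For x y c) b i" for t b i
      using that by (auto simp: body_def sem_unwritten)
    ultimately show ?case
      using Suc by (simp add: add_mono del: upd_apply)
  qed
  show ?thesis
    using inv[of "s 0 y"] Q T unfolding runs_def by (auto simp: body_def)
qed

lemma runs_mono: "runs w c s T Q \<Longrightarrow> T \<le> T' \<Longrightarrow> runs w c s T' Q"
  by (simp add: runs_def)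

lemma runs_simps [simp]:
  "runs w (Lit x v) s T Q \<longleftrightarrow> 1 \<le> T \<and> Q (upd s 0 x v)"
  "runs w (Mov x y) s T Q \<longleftrightarrow> 1 \<le> T \<and> Q (upd s 0 x (s 0 y))"
  "runs w (Plus x y z) s T Q \<longleftrightarrow> 1 \<le> T \<and> Q (upd s 0 x (s 0 y + s 0 z))"
  "runs w (Minus x y z) s T Q \<longleftrightarrow> 1 \<le> T \<and> Q (upd s 0 x (s 0 y - s 0 z))"
  "runs w (Get x b y) s T Q \<longleftrightarrow> 1 \<le> T \<and> Q (upd s 0 x (s b (s 0 y)))"
  "runs w (Put b x y) s T Q \<longleftrightarrow> 1 \<le> T \<and> Q (upd s b (s 0 x) (s 0 y))"
  "runs w (Inp x y) s T Q \<longleftrightarrow> 1 \<le> T \<and> Q (upd s 0 x (if s 0 y < length w then w ! s 0 y else 0))"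
  "runs w (Cond x c d) s T Q \<longleftrightarrow>
    1 \<le> T \<and> (s 0 x \<noteq> 0 \<longrightarrow> runs w c s (T - 1) Q) \<and> (s 0 x = 0 \<longrightarrow> runs w d s (T - 1) Q)"
  by (auto simp: runs_def)

lemma runs_Seq_simps [simp]:
  "runs w (Lit x v ;; d) s T Q \<longleftrightarrow> 1 \<le> T \<and> runs w d (upd s 0 x v) (T - 1) Q"
  "runs w (Mov x y ;; d) s T Q \<longleftrightarrow> 1 \<le> T \<and> runs w d (upd s 0 x (s 0 y)) (T - 1) Q"
  "runs w (Plus x y z ;; d) s T Q \<longleftrightarrow> 1 \<le> T \<and> runs w d (upd s 0 x (s 0 y + s 0 z)) (T - 1) Q"
  "runs w (Minus x y z ;; d) s T Q \<longleftrightarrow> 1 \<le> T \<and> runs w d (upd s 0 x (s 0 y - s 0 z)) (T - 1) Q"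
  "runs w (Get x b y ;; d) s T Q \<longleftrightarrow> 1 \<le> T \<and> runs w d (upd s 0 x (s b (s 0 y))) (T - 1) Q"
  "runs w (Put b x y ;; d) s T Q \<longleftrightarrow> 1 \<le> T \<and> runs w d (upd s b (s 0 x) (s 0 y)) (T - 1) Q"
  "runs w (Inp x y ;; d) s T Q \<longleftrightarrow>
    1 \<le> T \<and> runs w d (upd s 0 x (if s 0 y < length w then w ! s 0 y else 0)) (T - 1) Q"
  "runs w (Cond x c1 c2 ;; d) s T Q \<longleftrightarrow>
    1 \<le> T \<and> (s 0 x \<noteq> 0 \<longrightarrow> runs w (c1 ;; d) s (T - 1) Q) \<and> (s 0 x = 0 \<longrightarrow> runs w (c2 ;; d) s (T - 1) Q)"
  "runs w ((c1 ;; c2) ;; d) s T Q \<longleftrightarrow> runs w (c1 ;; c2 ;; d) s T Q"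
  by (auto simp: runs_def)

section \<open>Positional notation\<close>

primrec horner :: "nat \<Rightarrow> (nat \<Rightarrow> nat) \<Rightarrow> nat \<Rightarrow> nat" where
  "horner m f 0 = 0"
| "horner m f (Suc j) = horner m f j * m + f j"

lemma horner_cong: "(\<And>j. j < n \<Longrightarrow> f j = g j) \<Longrightarrow> horner m f n = horner m g n"
  by (induction n) auto

lemma horner_less:
  "(\<And>j. j < n \<Longrightarrow> f j < m) \<Longrightarrow> horner m f n < m ^ n"
proof (induction n)
  case (Suc n)
  then have "Suc (horner m f n) * m \<le> m ^ n * m"
    by (intro mult_right_mono) (auto simp: Suc_le_eq)
  with Suc.prems[of n] show ?case by (simp add: algebra_simps)
qed simp

text \<open>
  Digit \<open>c\<close>, counted from the least significant one, of a number in base \<open>m\<close> is the entry that Horner's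
  scheme read \<open>c\<close> places before the end.
\<close>

lemma horner_digit:
  "(\<And>j. j < n \<Longrightarrow> f j < m) \<Longrightarrow> c < n \<Longrightarrow> horner m f n div m ^ c mod m = f (n - 1 - c)"
proof (induction n arbitrary: c)
  case (Suc n)
  have "f n < m" using Suc.prems by auto
  then have m: "0 < m" "f n < m" by auto
  show ?case
  proof (cases c)
    case 0
    with m show ?thesis by simp
  next
    case (Suc c')
    have "horner m f (Suc n) div m ^ c = (horner m f n * m + f n) div m div m ^ c'"
      by (simp add: Suc div_mult2_eq)
    also have "(horner m f n * m + f n) div m = horner m f n"
      using m by simp
    finally show ?thesis using Suc.IH[of c'] Suc.prems \<open>c = Suc c'\<close> by auto
  qed
qed simp

section \<open>Preparing tables of arithmetic\<close>

text \<open>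
  The programs share one register layout. Scalars: 0 holds the answer, 1 the size \<open>m\<close> of the universe,
  2 the number \<open>r\<close> of operations, 3 the power \<open>n\<close>, 4 the number \<open>M = m ^ n\<close> of elements of \<open>A ^ n\<close>, 5 the
  table length \<open>K = M ^ kmax\<close>, 6 the maximal arity \<open>kmax\<close>, 7 and 8 the constants 1 and 0, 9 the result of
  \<open>power_com\<close>, 19 and 24 the arity and the table offset of the current operation, 20 a temporary, 31 the
  element under construction, 32 the length of the queue, 33 the tuple under test and 35 the queue position.
  The remaining scalars are loop counters and temporaries.

  Arrays: 1 to 5 tabulate \<open>x * m\<close>, \<open>x div m\<close>, \<open>x mod m\<close>, \<open>x div M\<close> and \<open>x mod M\<close>, because the machine can neither multiply
  nor divide; 6 and 7 hold for each operation the offset of its table and the number of tuples visited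
  per stage; 8 marks the elements found so far, 9 is the queue; 10 holds the entries of the tuple under
  test, 11 the table positions for the coordinates of one operation; 12 the permutations.
\<close>

abbreviation skip :: com where "skip \<equiv> Mov 20 20"

definition power_com :: "nat \<Rightarrow> nat \<Rightarrow> com" where
  "power_com b e = Lit 9 1 ;; For 11 e (Lit 10 0 ;; For 12 b (Plus 10 10 9) ;; Mov 9 10)"

lemma runs_power_com:
  assumes "b \<notin> {9, 10, 11, 12}" "e \<notin> {9, 10, 11, 12}"
  shows "runs w (power_com b e) s (2 + s 0 e * (4 + 2 * s 0 b)) (\<lambda>t. t 0 9 = s 0 b ^ s 0 e)"
proof -
  let ?s = "upd s 0 9 1"
  have mult: "runs w (For 12 b (Plus 10 10 9)) (upd t 0 10 0) (1 + 2 * s 0 b)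
      (\<lambda>u. u 0 10 = s 0 b * t 0 9)" if "t 0 b = s 0 b" for t
    by (rule runs_For[where I = "\<lambda>j u. u 0 10 = j * t 0 9" and B = "\<lambda>_. 1"])
      (use assms that in auto)
  have "runs w (For 11 e (Lit 10 0 ;; For 12 b (Plus 10 10 9) ;; Mov 9 10)) ?s
      (1 + s 0 e * (4 + 2 * s 0 b)) (\<lambda>t. t 0 9 = s 0 b ^ s 0 e)"
  proof (rule runs_For[where I = "\<lambda>j u. u 0 9 = s 0 b ^ j" and B = "\<lambda>_. 3 + 2 * s 0 b"])
    fix j u
    assume u: "u 0 9 = s 0 b ^ j"
      "\<And>b' j. \<not> writes (For 11 e (Lit 10 0 ;; For 12 b (Plus 10 10 9) ;; Mov 9 10)) b' j \<Longrightarrow>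
        u b' j = ?s b' j"
    have "u 0 b = s 0 b" using assms u(2)[of 0 b] by auto
    then have "runs w (For 12 b (Plus 10 10 9)) (upd (upd u 0 11 j) 0 10 0) (1 + 2 * s 0 b)
      (\<lambda>u'. u' 0 10 = s 0 b * u 0 9)"
      using mult[of "upd u 0 11 j"] assms by auto
    then have "runs w (For 12 b (Plus 10 10 9) ;; Mov 9 10) (upd (upd u 0 11 j) 0 10 0) (2 + 2 * s 0 b)
      (\<lambda>u'. u' 0 9 = s 0 b * u 0 9)"
      by (rule runs_Seq[where ?T2.0 = 1]) auto
    with u(1) show "runs w (Lit 10 0 ;; For 12 b (Plus 10 10 9) ;; Mov 9 10) (upd u 0 11 j)
       (3 + 2 * s 0 b) (\<lambda>u. u 0 9 = s 0 b ^ Suc j)"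
      by simp
  qed (use assms in \<open>auto simp: algebra_simps\<close>)
  then show ?thesis by (simp add: power_com_def)
qed

text \<open>
  Advances the quotient \<open>q\<close> and the remainder \<open>x\<close> of a running counter with respect to the divisor in \<open>d\<close>.
\<close>

definition tick :: "nat \<Rightarrow> nat \<Rightarrow> nat \<Rightarrow> com" where
  "tick q x d = Plus x x 7 ;; Minus 20 d x ;; Cond 20 skip (Lit x 0 ;; Plus q q 7)"

definition table_com :: com where
  "table_com = Lit 13 0 ;; Lit 14 0 ;; Lit 15 0 ;; Lit 16 0 ;; Lit 17 0 ;;
     For 11 5 (Put 1 11 13 ;; Put 2 11 14 ;; Put 3 11 15 ;; Put 4 11 16 ;; Put 5 11 17 ;;
       Plus 13 13 1 ;; tick 14 15 1 ;; tick 16 17 4)"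

lemma runs_table_com:
  assumes "s 0 7 = 1" "s 0 1 = m" "s 0 4 = M" "0 < m" "0 < M"
  shows "runs w table_com s (6 + s 0 5 * 17)
    (\<lambda>t. \<forall>x<s 0 5. t 1 x = x * m \<and> t 2 x = x div m \<and> t 3 x = x mod m \<and> t 4 x = x div M \<and> t 5 x = x mod M)"
proof -
  let ?I = "\<lambda>i t. t 0 13 = i * m \<and> t 0 14 = i div m \<and> t 0 15 = i mod m \<and> t 0 16 = i div M \<and> t 0 17 = i mod M
    \<and> (\<forall>x<i. t 1 x = x * m \<and> t 2 x = x div m \<and> t 3 x = x mod m \<and> t 4 x = x div M \<and> t 5 x = x mod M)"
  have wrap: "m \<le> Suc (i mod m) \<longleftrightarrow> Suc (i mod m) = m" "M \<le> Suc (i mod M) \<longleftrightarrow> Suc (i mod M) = M" for i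
    using mod_less_divisor[OF assms(4), of i] mod_less_divisor[OF assms(5), of i] by linarith+
  show ?thesis
    unfolding table_com_def
    apply simp
    apply (rule runs_For[where I = ?I and B = "\<lambda>_. 16"])
    subgoal by simp
    subgoal premises prems for i t
    proof -
      have "t 0 7 = 1" "t 0 1 = m" "t 0 4 = M"
        using prems(3)[of 0 7] prems(3)[of 0 1] prems(3)[of 0 4] assms by (simp_all add: tick_def)
      with prems(2) wrap[of i] assms(4,5) show ?thesis
        by (auto simp: tick_def div_Suc mod_Suc less_Suc_eq)
    qed
    by auto
qed


text \<open>
  For an operation of arity 1 a stage visits one tuple, the current queue element; otherwise it visits
  all \<open>M ^ k\<close> tuples.
\<close>

definition prepare_ops_com :: com where
  "prepare_ops_com = Lit 20 2 ;; Plus 18 2 20 ;;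
     For 22 2 (Lit 20 2 ;; Plus 20 20 22 ;; Inp 19 20 ;; Put 6 22 18 ;;
       power_com 1 19 ;; Plus 18 18 9 ;; Minus 20 19 7 ;;
       Cond 20 (power_com 4 19 ;; Put 7 22 9) (Put 7 22 7))"

lemma writes_power_com: "writes (power_com b e) c i \<longleftrightarrow> c = 0 \<and> i \<in> {9, 10, 11, 12}"
  by (auto simp: power_com_def)

lemma runs_prepare_ops_com:
  assumes s: "s 0 7 = 1" "s 0 1 = m" "s 0 4 = M" "s 0 2 = r"
    and ar: "\<And>i. i < r \<Longrightarrow> 2 + i < length w \<and> w ! (2 + i) = ar i \<and> 1 \<le> ar i"
  shows "runs w prepare_ops_com s (3 + (\<Sum>i<r. 15 + ar i * (8 + 2 * m + 2 * M)))
    (\<lambda>t. \<forall>i<r. t 6 i = 2 + r + (\<Sum>l<i. m ^ ar l) \<and> t 7 i = (if ar i = 1 then 1 else M ^ ar i))"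
proof -
  let ?I = "\<lambda>i t. t 0 18 = 2 + r + (\<Sum>l<i. m ^ ar l) \<and>
    (\<forall>h<i. t 6 h = 2 + r + (\<Sum>l<h. m ^ ar l) \<and> t 7 h = (if ar h = 1 then 1 else M ^ ar h))"
  show ?thesis
    unfolding prepare_ops_com_def
    apply simp
    apply (rule runs_For[where I = ?I and B = "\<lambda>i. 14 + ar i * (8 + 2 * m + 2 * M)"])
    subgoal using s by simp
    subgoal premises prems for i t
    proof -
      have i: "i < r" using prems(1) s by simp
      have t: "t 0 7 = 1" "t 0 1 = m" "t 0 4 = M" "t 0 2 = r"
        using prems(3)[of 0 7] prems(3)[of 0 1] prems(3)[of 0 4] prems(3)[of 0 2] s
        by (simp_all add: writes_power_com)
      let ?u = "upd (upd (upd (upd t 0 22 i) 0 20 (2 + i)) 0 19 (ar i)) 6 i (t 0 18)"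
      have "runs w (power_com 1 19 ;; Plus 18 18 9 ;; Minus 20 19 7 ;;
          Cond 20 (power_com 4 19 ;; Put 7 22 9) (Put 7 22 7)) ?u (10 + ar i * (8 + 2 * m + 2 * M))
          (?I (Suc i))"
      proof (rule runs_Seq[OF runs_power_com, where ?T2.0 = "6 + ar i * (4 + 2 * M)"])
        fix u assume u: "u 0 9 = ?u 0 1 ^ ?u 0 19"
          and frame: "\<And>b j. \<not> writes (power_com 1 19) b j \<Longrightarrow> u b j = ?u b j"
        have vals: "u 0 7 = 1" "u 0 4 = M" "u 0 18 = t 0 18" "u 0 22 = i" "u 0 19 = ar i"
          "u 0 9 = m ^ ar i" "u 6 x = (if x = i then t 0 18 else t 6 x)" "u 7 x = t 7 x" for x
          using u t by (simp_all add: frame writes_power_com)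
        let ?v = "upd (upd u 0 18 (t 0 18 + m ^ ar i)) 0 20 (ar i - 1)"
        have "runs w (power_com 4 19 ;; Put 7 22 9) ?v (3 + ar i * (4 + 2 * M)) (?I (Suc i))"
          if "ar i \<noteq> 1"
        proof (rule runs_Seq[OF runs_power_com, where ?T2.0 = 1])
          fix x assume x: "x 0 9 = ?v 0 4 ^ ?v 0 19"
            and frame: "\<And>b j. \<not> writes (power_com 4 19) b j \<Longrightarrow> x b j = ?v b j"
          have "x 0 9 = M ^ ar i" "x 0 22 = i" "x 0 18 = t 0 18 + m ^ ar i" "x 7 y = t 7 y"
            "x 6 y = (if y = i then t 0 18 else t 6 y)" for y
            using x vals by (simp_all add: frame writes_power_com)
          then show "runs w (Put 7 22 9) x 1 (?I (Suc i))"
            using prems(2) that by (simp add: less_Suc_eq)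
        qed (use vals in auto)
        then show "runs w (Plus 18 18 9 ;; Minus 20 19 7 ;;
            Cond 20 (power_com 4 19 ;; Put 7 22 9) (Put 7 22 7)) u (6 + ar i * (4 + 2 * M)) (?I (Suc i))"
          using prems(2) vals ar[OF i] by (auto simp add: less_Suc_eq intro: runs_mono)
      qed (use t in \<open>auto simp: algebra_simps\<close>)
      then show ?thesis using t i ar[OF i] by simp
    qed
    subgoal using s by auto
    subgoal using s by simp
    done
qed

section \<open>The program that searches for constant tuples\<close>

text \<open>
  Appends the element in register 31 to the queue unless it is already marked.
\<close>

definition insert_com :: com where
  "insert_com = Get 20 8 31 ;; Cond 20 skip (Put 8 31 7 ;; Put 9 32 31 ;; Plus 32 32 7)"

text \<open>
  One step of Horner's scheme in all \<open>n\<close> coordinates at once: register 28 holds an element, whose digits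
  are appended to the table positions in array 11.
\<close>

definition digits_loop :: com where
  "digits_loop = For 25 3 (Get 29 3 28 ;; Get 28 2 28 ;; Get 30 11 25 ;; Get 30 1 30 ;; Plus 30 30 29 ;;
         Put 11 25 30)"

text \<open>
  Decodes the tuple number in register 23 into its entries, digits in base \<open>M\<close>. Register 26 stays
  nonzero as long as all entries are already in the subalgebra.
\<close>

definition args_loop :: com where
  "args_loop = For 27 19 (Get 28 5 23 ;; Get 23 4 23 ;; Get 20 8 28 ;; Cond 20 skip (Lit 26 0) ;;
       digits_loop)"

text \<open>
  Looks up the value of the operation in each coordinate and encodes the resulting element. The
  coordinates are taken from the last to the first, as the first one is the least significant digit.
\<close>

definition result_loop :: com where
  "result_loop = Lit 31 0 ;;
        For 25 3 (Minus 20 3 25 ;; Minus 20 20 7 ;; Get 20 11 20 ;; Plus 20 20 24 ;; Inp 20 20 ;;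
          Get 31 1 31 ;; Plus 31 31 20)"

definition eval_com :: com where
  "eval_com = For 25 3 (Put 11 25 8) ;; Lit 26 1 ;; args_loop ;;
     Cond 26 (result_loop ;; insert_com) skip"

definition generator_loop :: com where
  "generator_loop = Lit 31 0 ;;
     For 25 3 (Get 20 12 34 ;; Plus 34 34 7 ;; Get 20 10 20 ;; Get 31 1 31 ;; Plus 31 31 20)"

definition coords_loop :: com where
  "coords_loop = Mov 28 33 ;; For 25 3 (Get 29 3 28 ;; Get 28 2 28 ;; Put 10 25 29)"

definition gens_com :: com where
  "gens_com = coords_loop ;; Lit 34 0 ;; For 27 3 (generator_loop ;; insert_com)"

text \<open>
  Register 37 contains 1 exactly when the operation is unary or \<open>M = 1\<close>; the arity in register 19
  decides whether the visited tuple is the current queue element or the one numbered by the counter.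
\<close>

definition tuples_loop :: com where
  "tuples_loop = For 38 37 (Mov 23 38 ;; Minus 20 19 7 ;; Cond 20 skip (Get 23 9 35) ;; eval_com)"

definition stage_com :: com where
  "stage_com = Minus 20 32 35 ;;
     Cond 20
       (For 36 2 (Lit 20 2 ;; Plus 20 20 36 ;; Inp 19 20 ;; Get 24 6 36 ;; Get 37 7 36 ;; tuples_loop))
       skip"

definition check_com :: com where
  "check_com = Lit 39 0 ;;
     For 38 1 (Lit 31 0 ;; For 25 3 (Get 31 1 31 ;; Plus 31 31 38) ;;
       Get 20 8 31 ;; Cond 20 (Lit 39 1) skip) ;;
     Cond 39 skip (Lit 0 0)"

definition clear_loop :: com where
  "clear_loop = For 25 4 (Put 8 25 8) ;; Lit 32 0"

definition search_com :: com where
  "search_com = For 33 4 (clear_loop ;; gens_com ;; For 35 4 stage_com ;; check_com)"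

lemma writes_insert_com: "writes insert_com b i \<longleftrightarrow> b = 0 \<and> i \<in> {20, 32} \<or> b \<in> {8, 9}"
  by (auto simp: insert_com_def)

lemma writes_digits_loop: "writes digits_loop b i \<longleftrightarrow> b = 0 \<and> i \<in> {25, 28, 29, 30} \<or> b = 11"
  by (auto simp: digits_loop_def writes_insert_com)

lemma writes_args_loop: "writes args_loop b i \<longleftrightarrow> b = 0 \<and> i \<in> {20, 23, 25, 26, 27, 28, 29, 30} \<or> b = 11"
  by (auto simp: args_loop_def writes_insert_com writes_digits_loop)

lemma writes_result_loop: "writes result_loop b i \<longleftrightarrow> b = 0 \<and> i \<in> {20, 25, 31}"
  by (auto simp: result_loop_def writes_insert_com writes_digits_loop writes_args_loop)

lemma writes_eval_com: "writes eval_com b i \<longleftrightarrow>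
    b = 0 \<and> i \<in> {20, 23, 25, 26, 27, 28, 29, 30, 31, 32} \<or> b \<in> {8, 9, 11}"
  by (auto simp: eval_com_def writes_insert_com writes_digits_loop writes_args_loop writes_result_loop)

lemma writes_generator_loop: "writes generator_loop b i \<longleftrightarrow> b = 0 \<and> i \<in> {20, 25, 31, 34}"
  by (auto simp: generator_loop_def writes_insert_com writes_digits_loop writes_args_loop writes_result_loop writes_eval_com)

lemma writes_coords_loop: "writes coords_loop b i \<longleftrightarrow> b = 0 \<and> i \<in> {25, 28, 29} \<or> b = 10"
  by (auto simp: coords_loop_def writes_insert_com writes_digits_loop writes_args_loop writes_result_loop writes_eval_com writes_generator_loop)

lemma writes_gens_com: "writes gens_com b i \<longleftrightarrow> b = 0 \<and> i \<in> {20, 25, 27, 28, 29, 31, 32, 34} \<or> b \<in> {8, 9, 10}"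
  by (auto simp: gens_com_def writes_insert_com writes_digits_loop writes_args_loop writes_result_loop writes_eval_com writes_generator_loop writes_coords_loop)

lemma writes_tuples_loop: "writes tuples_loop b i \<longleftrightarrow>
    b = 0 \<and> i \<in> {20, 23, 25, 26, 27, 28, 29, 30, 31, 32, 38} \<or> b \<in> {8, 9, 11}"
  by (auto simp: tuples_loop_def writes_insert_com writes_digits_loop writes_args_loop writes_result_loop writes_eval_com writes_generator_loop writes_coords_loop writes_gens_com)

lemma writes_stage_com: "writes stage_com b i \<longleftrightarrow>
    b = 0 \<and> i \<in> {19, 20, 23, 24, 25, 26, 27, 28, 29, 30, 31, 32, 36, 37, 38} \<or> b \<in> {8, 9, 11}"
  by (auto simp: stage_com_def writes_insert_com writes_digits_loop writes_args_loop writes_result_loop writes_eval_com writes_generator_loop writes_coords_loop writes_gens_com writes_tuples_loop)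

lemma writes_check_com: "writes check_com b i \<longleftrightarrow> b = 0 \<and> i \<in> {0, 20, 25, 31, 38, 39}"
  by (auto simp: check_com_def writes_insert_com writes_digits_loop writes_args_loop writes_result_loop writes_eval_com writes_generator_loop writes_coords_loop writes_gens_com writes_tuples_loop writes_stage_com)

lemma writes_clear_loop: "writes clear_loop b i \<longleftrightarrow> b = 0 \<and> i \<in> {25, 32} \<or> b = 8"
  by (auto simp: clear_loop_def writes_insert_com writes_digits_loop writes_args_loop writes_result_loop writes_eval_com writes_generator_loop writes_coords_loop writes_gens_com writes_tuples_loop writes_stage_com writes_check_com)

lemmas writes_parts =
  writes_insert_com writes_digits_loop writes_args_loop writes_result_loop writes_eval_com writes_generator_loop writes_coords_loop writes_gens_com writes_tuples_loop writes_stage_com writes_check_com writes_clear_loop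

primrec load_com :: "nat list \<Rightarrow> nat \<Rightarrow> com" where
  "load_com [] j = skip"
| "load_com (x # xs) j = Lit 20 j ;; Lit 31 x ;; Put 12 20 31 ;; load_com xs (Suc j)"

section \<open>Correctness and running time of the search\<close>

text \<open>
  The data of one test, with the input \<open>w\<close> viewed through the arities \<open>ar\<close> and the offsets \<open>off\<close> of the
  operation tables. All arities are positive here.
\<close>

locale operation_tables =
  fixes w :: "nat list" and n m r :: nat and ar off :: "nat \<Rightarrow> nat" and \<sigma> :: "nat \<Rightarrow> nat \<Rightarrow> nat"
    and kmax :: nat
  assumes n: "1 \<le> n" and m: "1 \<le> m" and r: "1 \<le> r"
    and arity: "\<And>i. i < r \<Longrightarrow> 2 + i < length w \<and> w ! (2 + i) = ar i \<and> 1 \<le> ar i \<and> ar i \<le> kmax"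
    and kmax_attained: "\<exists>i<r. ar i = kmax"
    and off: "\<And>i. i < r \<Longrightarrow> off i = 2 + r + (\<Sum>l<i. m ^ ar l)"
    and entry: "\<And>i j. i < r \<Longrightarrow> j < m ^ ar i \<Longrightarrow> off i + j < length w \<and> w ! (off i + j) < m"
    and \<sigma>: "\<And>c i. c < n \<Longrightarrow> i < n \<Longrightarrow> \<sigma> c i < n"
begin

definition M :: nat where "M = m ^ n"
definition K :: nat where "K = M ^ kmax"

text \<open>
  An element of \<open>A ^ n\<close> is represented by a number below \<open>M\<close>, its coordinates being the digits in base \<open>m\<close>,
  least significant first.
\<close>

definition coord :: "nat \<Rightarrow> nat \<Rightarrow> nat" where "coord x c = x div m ^ c mod m"
definition code :: "(nat \<Rightarrow> nat) \<Rightarrow> nat" where "code f = horner m (\<lambda>j. f (n - 1 - j)) n"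

lemma M_pos: "0 < M" using m by (simp add: M_def)
lemma kmax_pos: "1 \<le> kmax" using arity[of 0] r by auto
lemma M_le_K: "M \<le> K" using kmax_pos M_pos unfolding K_def by (simp add: self_le_power)
lemma coord_less: "coord x c < m" using m by (simp add: coord_def)

lemma coord_code: "(\<And>c. c < n \<Longrightarrow> f c < m) \<Longrightarrow> c < n \<Longrightarrow> coord (code f) c = f c"
  unfolding coord_def code_def by (subst horner_digit) auto

lemma code_less: "(\<And>c. c < n \<Longrightarrow> f c < m) \<Longrightarrow> code f < M"
  unfolding code_def M_def using n by (intro horner_less) auto

lemma code_cong: "(\<And>c. c < n \<Longrightarrow> f c = g c) \<Longrightarrow> code f = code g"
  unfolding code_def by (intro horner_cong) auto

text \<open>
  The \<open>i\<close>-th operation of \<open>A ^ n\<close> on codes. The arguments in an operation table are in lexicographic order,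
  so Horner's scheme over the arguments yields the position of the value.
\<close>

definition apply_op :: "nat \<Rightarrow> (nat \<Rightarrow> nat) \<Rightarrow> nat" where
  "apply_op i x = code (\<lambda>c. w ! (off i + horner m (\<lambda>j. coord (x j) c) (ar i)))"

definition args :: "nat \<Rightarrow> nat \<Rightarrow> nat" where "args z j = z div M ^ j mod M"

definition iterations :: "nat \<Rightarrow> nat" where
  "iterations i = (if ar i = 1 then 1 else M ^ ar i)"

text \<open>
  What all tables must contain before the search starts, and what the search leaves untouched.
\<close>

definition ready :: "store \<Rightarrow> bool" where
  "ready t \<longleftrightarrow> t 0 1 = m \<and> t 0 2 = r \<and> t 0 3 = n \<and> t 0 4 = M \<and> t 0 7 = 1 \<and> t 0 8 = 0 \<and>
    (\<forall>x<K. t 1 x = x * m \<and> t 2 x = x div m \<and> t 3 x = x mod m \<and> t 4 x = x div M \<and> t 5 x = x mod M) \<and>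
    (\<forall>i<r. t 6 i = off i \<and> t 7 i = iterations i) \<and>
    (\<forall>i<n. \<forall>c<n. t 12 (i * n + c) = \<sigma> (n - 1 - c) i)"

lemma ready_upd [simp]: "b = 0 \<and> 8 < i \<or> b \<in> {8, 9, 10, 11} \<Longrightarrow> ready (upd t b i v) = ready t"
  unfolding ready_def by (elim disjE conjE insertE emptyE; simp)

lemma ready_cong:
  assumes "ready s" "\<And>b i. b = 0 \<and> i \<in> {1, 2, 3, 4, 7, 8} \<or> b \<in> {1, 2, 3, 4, 5, 6, 7, 12} \<Longrightarrow> t b i = s b i"
  shows "ready t"
  using assms(1) assms(2)[of 0] assms(2)[of 1] assms(2)[of 2] assms(2)[of 3] assms(2)[of 4]
    assms(2)[of 5] assms(2)[of 6] assms(2)[of 7] assms(2)[of 12]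
  unfolding ready_def by simp

definition members :: "store \<Rightarrow> nat set" where
  "members t = {x. x < M \<and> t 8 x \<noteq> 0}"

definition queue :: "store \<Rightarrow> bool" where
  "queue t \<longleftrightarrow> inj_on (t 9) {..<t 0 32} \<and> t 9 ` {..<t 0 32} = members t"

text \<open>
  The queue only grows at its end; in particular an element once processed keeps its position.
\<close>

definition extends :: "store \<Rightarrow> store \<Rightarrow> bool" where
  "extends s t \<longleftrightarrow> s 0 32 \<le> t 0 32 \<and> (\<forall>l<s 0 32. t 9 l = s 9 l)"

lemma extends_refl: "extends s s" by (simp add: extends_def)
lemma extends_trans: "extends s t \<Longrightarrow> extends t u \<Longrightarrow> extends s u"
  by (auto simp: extends_def)

lemma queue_length_le: "queue t \<Longrightarrow> t 0 32 \<le> M"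
proof -
  assume "queue t"
  then have "card {..<t 0 32} = card (members t)"
    unfolding queue_def by (metis card_image)
  also have "\<dots> \<le> card {..<M}" by (rule card_mono) (auto simp: members_def)
  finally show ?thesis by simp
qed

lemma runs_insert_com:
  assumes "queue s" "s 0 31 < M" "s 0 7 = 1"
  shows "runs w insert_com s 5
    (\<lambda>t. queue t \<and> members t = insert (s 0 31) (members s) \<and> extends s t)"
proof (cases "s 8 (s 0 31) = 0")
  case True
  define t where "t = upd (upd (upd (upd s 0 20 0) 8 (s 0 31) 1) 9 (s 0 32) (s 0 31)) 0 32 (s 0 32 + 1)"
  have t: "t 0 32 = Suc (s 0 32)" "t 9 (s 0 32) = s 0 31" "\<And>l. l < s 0 32 \<Longrightarrow> t 9 l = s 9 l"
    by (auto simp: t_def)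
  have "s 0 31 \<notin> s 9 ` {..<s 0 32}"
    using assms(1) True by (auto simp: queue_def members_def)
  moreover have "t 9 ` {..<s 0 32} = s 9 ` {..<s 0 32}"
    using t(3) by (intro image_cong) auto
  moreover have "inj_on (t 9) {..<s 0 32} = inj_on (s 9) {..<s 0 32}"
    using t(3) by (intro inj_on_cong) auto
  moreover have mem: "members t = insert (s 0 31) (members s)"
    using assms(2) by (auto simp: members_def t_def)
  ultimately have "queue t"
    using assms(1) t(1,2) unfolding queue_def by (simp add: lessThan_Suc)
  moreover have "extends s t" using t by (simp add: extends_def)
  ultimately show ?thesis
    using True assms(3) mem by (simp add: insert_com_def t_def)
next
  case False
  then have "s 0 31 \<in> members s" using assms(2) by (simp add: members_def)
  with False assms show ?thesis
    by (auto simp: insert_com_def extends_def queue_def members_def insert_absorb)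
qed

lemma members_upd [simp]: "b \<noteq> 8 \<Longrightarrow> members (upd s b i v) = members s"
  by (simp add: members_def)

lemma queue_upd [simp]: "b = 0 \<and> i \<noteq> 32 \<or> b \<notin> {0, 8, 9} \<Longrightarrow> queue (upd s b i v) = queue s"
  by (auto simp: queue_def)

lemma extends_upd [simp]:
  "b = 0 \<and> i \<noteq> 32 \<or> b \<notin> {0, 9} \<Longrightarrow> extends (upd s b i v) t = extends s t"
  "b = 0 \<and> i \<noteq> 32 \<or> b \<notin> {0, 9} \<Longrightarrow> extends s (upd t b i v) = extends s t"
  unfolding extends_def by (elim disjE conjE; simp)+

definition same_queue :: "store \<Rightarrow> store \<Rightarrow> bool" where
  "same_queue s t \<longleftrightarrow> t 0 32 = s 0 32 \<and> (\<forall>i. t 8 i = s 8 i \<and> t 9 i = s 9 i)"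

lemma same_queueD:
  assumes "same_queue s t"
  shows "queue t = queue s" "members t = members s" "extends s t"
proof -
  have "t 0 32 = s 0 32" "t 8 = s 8" "t 9 = s 9" using assms by (auto simp: same_queue_def)
  then show "queue t = queue s" "members t = members s" "extends s t"
    by (simp_all add: queue_def members_def extends_def)
qed

lemma ready_simps:
  assumes "ready s"
  shows "s 0 1 = m" "s 0 (Suc 0) = m" "s 0 2 = r" "s 0 3 = n" "s 0 4 = M" "s 0 7 = 1" "s 0 8 = 0"
    "x < K \<Longrightarrow> s 1 x = x * m" "x < K \<Longrightarrow> s (Suc 0) x = x * m" "x < K \<Longrightarrow> s 2 x = x div m"
    "x < K \<Longrightarrow> s 3 x = x mod m" "x < K \<Longrightarrow> s 4 x = x div M" "x < K \<Longrightarrow> s 5 x = x mod M"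
    "i < r \<Longrightarrow> s 6 i = off i" "i < r \<Longrightarrow> s 7 i = iterations i"
    "i < n \<Longrightarrow> c < n \<Longrightarrow> s 12 (i * n + c) = \<sigma> (n - 1 - c) i"
  using assms by (simp_all add: ready_def)

lemma power_le_K: "j \<le> kmax \<Longrightarrow> m ^ j \<le> K"
proof -
  assume "j \<le> kmax"
  have "m ^ j \<le> M ^ j"
    using n m by (simp add: M_def power_mono self_le_power)
  also have "\<dots> \<le> K" unfolding K_def using \<open>j \<le> kmax\<close> M_pos by (simp add: power_increasing)
  finally show ?thesis .
qed

lemma power_le_M: "j \<le> n \<Longrightarrow> m ^ j \<le> M"
  using m by (simp add: M_def power_increasing)

lemma div_less_K: "x < K \<Longrightarrow> x div d < K"
  using div_le_dividend le_less_trans by blast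

lemma runs_digits_loop:
  assumes ready: "ready s" and x: "s 0 28 < M" and e: "\<And>c. c < n \<Longrightarrow> s 11 c < K"
  shows "runs w digits_loop s (1 + 7 * n)
    (\<lambda>t. \<forall>c<n. t 11 c = s 11 c * m + coord (s 0 28) c)"
  unfolding digits_loop_def
proof (rule runs_For[where I = "\<lambda>c u. u 0 28 = s 0 28 div m ^ c \<and>
    (\<forall>d<n. u 11 d = (if d < c then s 11 d * m + coord (s 0 28) d else s 11 d))" and B = "\<lambda>_. 6"],
    goal_cases)
  case (2 c t)
  have "ready t" by (rule ready_cong[OF ready], rule 2(3)) auto
  moreover have "c < n" using 2(1) ready by (simp add: ready_simps)
  moreover have "s 0 28 div m ^ c < K" using x M_le_K by (intro div_less_K) auto
  ultimately show ?case
    using 2(2) e[of c]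
    by (auto simp: ready_simps coord_def div_mult2_eq[symmetric] mult.commute less_Suc_eq)
qed (use ready in \<open>auto simp: ready_simps\<close>)

lemma runs_args_loop:
  assumes ready: "ready s" and i: "i < r" "s 0 19 = ar i" and z: "s 0 23 < K" and e: "\<And>c. c < n \<Longrightarrow> s 11 c = 0"
    and "s 0 26 = 1"
  shows "runs w args_loop s (1 + ar i * (7 + 7 * n))
    (\<lambda>t. (\<forall>c<n. t 11 c = horner m (\<lambda>l. coord (args (s 0 23) l) c) (ar i)) \<and>
       (t 0 26 \<noteq> 0 \<longleftrightarrow> (\<forall>l<ar i. args (s 0 23) l \<in> members s)))"
  unfolding args_loop_def
proof (rule runs_For[where I = "\<lambda>j t. t 0 23 = s 0 23 div M ^ j \<and>
      (\<forall>c<n. t 11 c = horner m (\<lambda>l. coord (args (s 0 23) l) c) j) \<and>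
       (t 0 26 \<noteq> 0 \<longleftrightarrow> (\<forall>l<j. args (s 0 23) l \<in> members s))"
      and B = "\<lambda>_. 6 + 7 * n"], goal_cases)
  case (2 j t)
  let ?z = "s 0 23"
  have j: "j < ar i" using 2(1) i by simp
  have "ready t" by (rule ready_cong[OF ready], rule 2(3)) (auto simp: digits_loop_def)
  have zj: "?z div M ^ j < K" using z by (rule div_less_K)
  have a: "args ?z j < M" using M_pos by (simp add: args_def)
  define b where "b = (if args ?z j \<in> members s then t 0 26 else 0)"
  define Q where "Q = (\<lambda>t :: store. t 0 23 = s 0 23 div M ^ Suc j \<and>
      (\<forall>c<n. t 11 c = horner m (\<lambda>l. coord (args (s 0 23) l) c) (Suc j)) \<and>
       (t 0 26 \<noteq> 0 \<longleftrightarrow> (\<forall>l<Suc j. args (s 0 23) l \<in> members s)))"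
  have t8: "t 8 x = s 8 x" for x using 2(3)[of 8] by (simp add: digits_loop_def)
  have e_less: "t 11 c < K" if "c < n" for c
  proof -
    have "t 11 c < m ^ j"
      using 2(2) that by (auto intro!: horner_less coord_less)
    also have "\<dots> \<le> K" using j arity[OF i(1)] by (intro power_le_K) auto
    finally show ?thesis .
  qed
  have loop: "runs w digits_loop u (1 + 7 * n) Q"
    if u: "ready u" "u 0 28 = args ?z j" "u 0 23 = ?z div M ^ Suc j" "\<And>c. u 11 c = t 11 c"
      "u 0 26 = b" for u
  proof (rule runs_frame[OF runs_digits_loop[OF u(1)]], goal_cases)
    case (3 t')
    then have "t' 0 23 = u 0 23" "t' 0 26 = u 0 26"
      by (auto simp: digits_loop_def)
    with 3(1) u 2(2) show ?case
      by (auto simp: Q_def b_def less_Suc_eq)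
  qed (use u a e_less in auto)
  show ?case
    unfolding Q_def[symmetric]
    using 2(2) \<open>ready t\<close> zj a t8[of "args ?z j"]
    by (auto simp: ready_simps args_def[symmetric] div_mult2_eq[symmetric] mult.commute b_def members_def
        intro!: runs_mono[OF loop])
qed (use assms in \<open>auto simp: digits_loop_def\<close>)

lemma runs_result_loop:
  assumes ready: "ready s" and i: "i < r" "s 0 24 = off i" and e: "\<And>c. c < n \<Longrightarrow> s 11 c = horner m (\<lambda>j. coord (x j) c) (ar i)"
  shows "runs w result_loop s (2 + 8 * n) (\<lambda>t. t 0 31 = apply_op i x)"
proof -
  let ?val = "\<lambda>c. w ! (off i + horner m (\<lambda>j. coord (x j) c) (ar i))"
  have entry': "off i + horner m (\<lambda>j. coord (x j) c) (ar i) < length w \<and> ?val c < m" for c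
    using entry[OF i(1), of "horner m (\<lambda>j. coord (x j) c) (ar i)"]
      horner_less[of "ar i" "\<lambda>j. coord (x j) c" m] coord_less by blast
  show ?thesis unfolding result_loop_def
    apply simp
  proof (rule runs_For[where I = "\<lambda>c t. t 0 31 = horner m (\<lambda>c. ?val (n - 1 - c)) c" and B = "\<lambda>_. 7"], goal_cases)
    case (2 c t)
    have "c < n" using 2(1) ready by (simp add: ready_simps)
    have "ready t"
      by (rule ready_cong[of "upd s 0 31 0"], use ready in simp, rule 2(3), auto)
    have "t 0 31 < m ^ c" using 2(2) entry' by (auto intro!: horner_less)
    also have "\<dots> \<le> K" using \<open>c < n\<close> M_le_K power_le_M[of c] by auto
    finally have "t 0 31 < K" .
    moreover have "t 11 (n - Suc c) = s 11 (n - Suc c)" "t 0 24 = off i" using 2(3)[of 11] 2(3)[of 0 24] i by auto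
    ultimately show ?case
      using 2(2) \<open>ready t\<close> \<open>c < n\<close> entry'[of "n - Suc c"] e[of "n - Suc c"]
      by (simp add: ready_simps add.commute)
  qed (use ready in \<open>auto simp: ready_simps apply_op_def code_def\<close>)
qed

lemma apply_op_less: "i < r \<Longrightarrow> apply_op i x < M"
  unfolding apply_op_def
proof (rule code_less)
  fix c assume "i < r"
  then show "w ! (off i + horner m (\<lambda>j. coord (x j) c) (ar i)) < m"
    using entry[of i "horner m (\<lambda>j. coord (x j) c) (ar i)"]
      horner_less[of "ar i" "\<lambda>j. coord (x j) c" m] coord_less by blast
qed

definition eval_time :: "nat \<Rightarrow> nat" where
  "eval_time i = (12 + 10 * n) * (ar i + 1)"

text \<open>
  One evaluation closes the set of found elements under one instance of one operation.
\<close>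

lemma runs_eval_com:
  assumes ready: "ready s" and "queue s" and i: "i < r" "s 0 19 = ar i" "s 0 24 = off i" and z: "s 0 23 < K"
  shows "runs w eval_com s (eval_time i) (\<lambda>t. queue t \<and> extends s t \<and>
    members t = members s \<union>
      (if \<forall>j<ar i. args (s 0 23) j \<in> members s then {apply_op i (args (s 0 23))} else {}))"
proof -
  let ?x = "args (s 0 23)"
  define Q where "Q = (\<lambda>t. queue t \<and> extends s t \<and>
    members t = members s \<union> (if \<forall>j<ar i. ?x j \<in> members s then {apply_op i ?x} else {}))"
  have result: "runs w (result_loop ;; insert_com) u (7 + 8 * n) Q"
    if u: "ready u" "\<And>c. c < n \<Longrightarrow> u 11 c = horner m (\<lambda>l. coord (?x l) c) (ar i)"
      "u 0 24 = off i" "queue u" "extends s u" "members u = members s"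
      "\<forall>l<ar i. ?x l \<in> members s" for u
  proof (rule runs_Seq[OF runs_result_loop[OF u(1) i(1) u(3,2)], where ?T2.0 = 5])
    fix t assume t: "t 0 31 = apply_op i ?x"
      and frame: "\<And>b i. \<not> writes result_loop b i \<Longrightarrow> t b i = u b i"
    have eq: "same_queue u t" "t 0 7 = 1"
      using ready_simps(6)[OF u(1)] by (simp_all add: frame writes_parts same_queue_def)
    have "queue t" "members t = members s" "extends s t"
      using u same_queueD[OF eq(1)] extends_trans by auto
    then show "runs w insert_com t 5 Q"
      using runs_insert_com[of t] t apply_op_less[OF i(1)] eq(2) u(7) extends_trans
      by (auto elim!: runs_frame simp: Q_def)
  qed simp_all
  have "runs w (args_loop ;; Cond 26 (result_loop ;; insert_com) skip) u (10 + 8 * n + ar i * (7 + 7 * n)) Q"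
    if u: "ready u" "\<And>c. c < n \<Longrightarrow> u 11 c = 0" "u 0 26 = 1"
      "\<And>l. u 0 l = s 0 l \<or> l \<in> {25, 26}" "\<And>l. u 8 l = s 8 l" "\<And>l. u 9 l = s 9 l" for u
  proof -
    have eq: "u 0 19 = ar i" "u 0 23 = s 0 23" "u 0 24 = off i" "u 0 32 = s 0 32"
      using u(4)[of 19] u(4)[of 23] u(4)[of 24] u(4)[of 32] i by auto
    note loop = runs_args_loop[OF u(1) i(1) eq(1) _ u(2,3), unfolded eq(2), OF z]
    show ?thesis
    proof (rule runs_Seq[OF loop, where ?T2.0 = "8 + 8 * n"])
      fix t assume t: "(\<forall>c<n. t 11 c = horner m (\<lambda>l. coord (?x l) c) (ar i)) \<and>
          (t 0 26 \<noteq> 0) = (\<forall>l<ar i. ?x l \<in> members u)"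
        and frame: "\<And>b i. \<not> writes args_loop b i \<Longrightarrow> t b i = u b i"
      have "ready t" by (rule ready_cong[OF u(1)], rule frame) (auto simp: writes_parts)
      have eq': "same_queue s t" "t 0 24 = off i" "same_queue s u"
        using u(5,6) eq by (simp_all add: frame writes_parts same_queue_def)
      have mem: "members u = members s" "members t = members s"
        using same_queueD(2)[OF eq'(1)] same_queueD(2)[OF eq'(3)] by auto
      have "queue t" "extends s t"
        using assms(2) same_queueD[OF eq'(1)] by auto
      then show "runs w (Cond 26 (result_loop ;; insert_com) skip) t (8 + 8 * n) Q"
        using t mem result[of t] \<open>ready t\<close> eq'(2) by (auto elim!: runs_mono simp: Q_def)
    qed auto
  qed
  note rest = this
  have init: "runs w (For 25 3 (Put 11 25 8)) s (1 + 2 * n) (\<lambda>t. \<forall>c<n. t 11 c = 0)"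
    by (rule runs_For[where I = "\<lambda>c t. \<forall>d<c. t 11 d = 0" and B = "\<lambda>_. 1"])
      (use ready in \<open>auto simp: ready_simps less_Suc_eq\<close>)
  show ?thesis unfolding eval_com_def Q_def[symmetric]
  proof (rule runs_Seq[OF init, where ?T2.0 = "11 + 8 * n + ar i * (7 + 7 * n)"])
    fix t assume t: "\<forall>c<n. t 11 c = 0"
      and frame: "\<And>b i. \<not> writes (For 25 3 (Put 11 25 8)) b i \<Longrightarrow> t b i = s b i"
    have "ready t" by (rule ready_cong[OF ready], rule frame) auto
    have "runs w (args_loop ;; Cond 26 (result_loop ;; insert_com) skip) (upd t 0 26 1)
        (10 + 8 * n + ar i * (7 + 7 * n)) Q"
      by (rule rest) (use t \<open>ready t\<close> in \<open>auto simp: frame\<close>)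
    then show "runs w (Lit 26 1 ;; args_loop ;; Cond 26 (result_loop ;; insert_com) skip) t
        (11 + 8 * n + ar i * (7 + 7 * n)) Q"
      by (simp add: add.assoc)
  qed (simp add: eval_time_def algebra_simps)
qed

definition generator :: "nat \<Rightarrow> nat \<Rightarrow> nat" where
  "generator a i = code (\<lambda>c. coord a (\<sigma> c i))"

lemma generator_less: "generator a i < M"
  unfolding generator_def by (intro code_less coord_less)

lemma runs_coords_loop:
  assumes ready: "ready s" and a: "s 0 33 < M"
  shows "runs w coords_loop s (2 + 4 * n) (\<lambda>t. \<forall>c<n. t 10 c = coord (s 0 33) c)"
  unfolding coords_loop_def
  apply simp
proof (rule runs_For[where I = "\<lambda>c t. t 0 28 = s 0 33 div m ^ c \<and> (\<forall>d<c. t 10 d = coord (s 0 33) d)"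
      and B = "\<lambda>_. 3"], goal_cases)
  case (2 c t)
  have "ready t" by (rule ready_cong[of "upd s 0 28 (s 0 33)"], use ready in simp, rule 2(3), auto)
  moreover have "s 0 33 div m ^ c < K" using a M_le_K by (intro div_less_K) auto
  ultimately show ?case
    using 2(2) by (auto simp: ready_simps coord_def div_mult2_eq[symmetric] mult.commute less_Suc_eq)
qed (use ready in \<open>auto simp: ready_simps\<close>)

lemma runs_generator_loop:
  assumes ready: "ready s" and i: "i < n" "s 0 34 = i * n"
    and v: "\<And>c. c < n \<Longrightarrow> s 10 c = coord a c"
  shows "runs w generator_loop s (2 + 6 * n) (\<lambda>t. t 0 31 = generator a i \<and> t 0 34 = Suc i * n)"
  unfolding generator_loop_def
  apply simp
proof (rule runs_For[where I = "\<lambda>c t. t 0 34 = i * n + c \<and>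
      t 0 31 = horner m (\<lambda>c. coord a (\<sigma> (n - 1 - c) i)) c" and B = "\<lambda>_. 5"], goal_cases)
  case (2 c t)
  have "ready t" by (rule ready_cong[of "upd s 0 31 0"], use ready in simp, rule 2(3), auto)
  have c: "c < n" using 2(1) ready by (simp add: ready_simps)
  have "t 0 31 < m ^ c" using 2(2) coord_less by (auto intro!: horner_less)
  also have "\<dots> \<le> K" using c M_le_K power_le_M[of c] by auto
  finally have "t 0 31 < K" .
  moreover have "\<sigma> (n - 1 - c) i < n" using i c by (intro \<sigma>) auto
  moreover have "t 10 x = s 10 x" for x using 2(3)[of 10] by simp
  moreover have "t 12 (c + i * n) = \<sigma> (n - Suc c) i"
    using \<open>ready t\<close> i c unfolding ready_def by (simp add: add.commute[of c])
  ultimately show ?case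
    using 2(2) \<open>ready t\<close> i c v by (simp add: ready_simps add.commute)
qed (use ready i in \<open>auto simp: ready_simps generator_def code_def\<close>)

definition gens_time :: nat where "gens_time = 4 + 4 * n + n * (8 + 6 * n)"

lemma runs_gens_com:
  assumes ready: "ready s" and a: "s 0 33 < M" and "queue s"
  shows "runs w gens_com s gens_time
    (\<lambda>t. queue t \<and> members t = members s \<union> generator (s 0 33) ` {..<n})"
  unfolding gens_com_def
proof (rule runs_Seq[OF runs_coords_loop[OF ready a], where ?T2.0 = "2 + n * (8 + 6 * n)"])
  let ?a = "s 0 33"
  fix s' assume v: "\<forall>c<n. s' 10 c = coord ?a c"
    and frame: "\<And>b i. \<not> writes coords_loop b i \<Longrightarrow> s' b i = s b i"
  have ready': "ready s'" by (rule ready_cong[OF ready], rule frame) (auto simp: writes_parts)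
  have "same_queue s s'" by (simp add: frame writes_parts same_queue_def)
  then have q': "queue s'" "members s' = members s"
    using assms(3) same_queueD by auto
  have "runs w (For 27 3 (generator_loop ;; insert_com)) (upd s' 0 34 0) (1 + n * (8 + 6 * n))
    (\<lambda>t. queue t \<and> members t = members s \<union> generator ?a ` {..<n})"
  proof (rule runs_For[where I = "\<lambda>i t. t 0 34 = i * n \<and> queue t \<and>
        members t = members s \<union> generator ?a ` {..<i}" and B = "\<lambda>_. 7 + 6 * n"], goal_cases)
    case (2 i t)
    have i: "i < n" using 2(1) ready' by (simp add: ready_simps)
    have "ready t" by (rule ready_cong[of "upd s' 0 34 0"], use ready' in simp, rule 2(3), auto simp: writes_parts)
    have "t 10 c = coord ?a c" if "c < n" for c
      using 2(3)[of 10] v that by (simp add: writes_parts)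
    then have gen: "runs w generator_loop (upd t 0 27 i) (2 + 6 * n)
        (\<lambda>t. t 0 31 = generator ?a i \<and> t 0 34 = Suc i * n)"
      using \<open>ready t\<close> i 2(2) by (intro runs_generator_loop) auto
    show ?case
    proof (rule runs_Seq[OF gen, where ?T2.0 = 5])
      fix u assume u: "u 0 31 = generator ?a i \<and> u 0 34 = Suc i * n"
        and frame: "\<And>b j. \<not> writes generator_loop b j \<Longrightarrow> u b j = upd t 0 27 i b j"
      have eq: "same_queue t u" "u 0 7 = 1"
        using ready_simps(6)[OF \<open>ready t\<close>] by (simp_all add: frame writes_parts same_queue_def)
      have "queue u" "members u = members t"
        using 2(2) same_queueD[OF eq(1)] by auto
      with runs_insert_com[of u] u eq(2) generator_less 2(2)
      show "runs w insert_com u 5 (\<lambda>t. t 0 34 = Suc i * n \<and> queue t \<and>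
        members t = members s \<union> generator ?a ` {..<Suc i})"
        by (auto elim!: runs_frame simp: writes_parts lessThan_Suc)
    qed simp
  qed (use ready' q' in \<open>auto simp: ready_simps\<close>)
  then show "runs w (Lit 34 0 ;; For 27 3 (generator_loop ;; insert_com)) s' (2 + n * (8 + 6 * n))
    (\<lambda>t. queue t \<and> members t = members s \<union> generator ?a ` {..<n})"
    by simp
qed (simp add: gens_time_def)

lemma apply_op_cong: "(\<And>j. j < ar i \<Longrightarrow> x j = y j) \<Longrightarrow> apply_op i x = apply_op i y"
proof -
  assume "\<And>j. j < ar i \<Longrightarrow> x j = y j"
  then have "horner m (\<lambda>j. coord (x j) c) (ar i) = horner m (\<lambda>j. coord (y j) c) (ar i)" for c
    by (intro horner_cong) auto
  then show ?thesis by (simp add: apply_op_def)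
qed

text \<open>
  Subuniverses of \<open>A ^ n\<close>, in terms of codes.
\<close>

definition closed :: "nat set \<Rightarrow> bool" where
  "closed C \<longleftrightarrow> (\<forall>i<r. \<forall>x. (\<forall>j<ar i. x j \<in> C) \<longrightarrow> apply_op i x \<in> C)"

text \<open>
  The loop invariant of the search: closure under the operations as far as the arguments are among the
  first \<open>q\<close> queue elements. The minimum accounts for a queue that has been exhausted.
\<close>

definition processed :: "nat \<Rightarrow> store \<Rightarrow> bool" where
  "processed q t \<longleftrightarrow> (\<forall>i<r. \<forall>x. (\<forall>j<ar i. x j \<in> t 9 ` {..<min q (t 0 32)}) \<longrightarrow> apply_op i x \<in> members t)"

text \<open>
  After the stage for queue position \<open>q\<close>, operation \<open>i\<close> is done for all arguments among the first \<open>q + 1\<close>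
  elements. For arity at least 2 all tuples of found elements have been visited, so this is clear; for arity
  1 the earlier elements were handled by earlier stages. The set \<open>C\<close> records that nothing outside the generated
  subalgebra is ever added.
\<close>

lemma runs_tuples_loop:
  assumes ready: "ready s" and q: "queue s" and i: "i < r" "s 0 19 = ar i" "s 0 24 = off i" "s 0 37 = iterations i"
    and stage: "s 0 35 = q" "q < s 0 32" and C: "closed C" "members s \<subseteq> C" and d: "processed q s"
  shows "runs w tuples_loop s (1 + iterations i * (5 + eval_time i))
    (\<lambda>t. queue t \<and> extends s t \<and> members s \<subseteq> members t \<and> members t \<subseteq> C \<and>
      (\<forall>x. (\<forall>j<ar i. x j \<in> s 9 ` {..<Suc q}) \<longrightarrow> apply_op i x \<in> members t))"
proof -
  define tuple where "tuple z = (if ar i = 1 then s 9 q else z)" for z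
  have mem: "s 9 l \<in> members s" if "l < s 0 32" for l
    using q that by (auto simp: queue_def)
  have sub: "s 9 ` {..<Suc q} \<subseteq> members s" using mem stage by auto
  have cover: "apply_op i x \<in> members t"
    if x: "\<forall>j<ar i. x j \<in> s 9 ` {..<Suc q}" and t: "members s \<subseteq> members t"
      "\<forall>z<iterations i. (\<forall>j<ar i. args (tuple z) j \<in> members s) \<longrightarrow> apply_op i (args (tuple z)) \<in> members t"
    for x t
  proof -
    have reached: "\<exists>z<iterations i. \<forall>j<ar i. args (tuple z) j = x j" if "\<not> (ar i = 1 \<and> x 0 \<in> s 9 ` {..<q})"
    proof (cases "ar i = 1")
      case True
      then have "x 0 = s 9 q" using x that by (auto simp: lessThan_Suc)
      moreover have "s 9 q < M" using mem stage by (auto simp: members_def)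
      ultimately show ?thesis using True by (auto simp: iterations_def tuple_def args_def)
    next
      case False
      have "x j < M" if "j < ar i" for j
        using x sub that by (force simp: members_def)
      then have less: "x (ar i - 1 - j) < M" if "j < ar i" for j
        using that by simp
      define z where "z = horner M (\<lambda>j. x (ar i - 1 - j)) (ar i)"
      have "z < M ^ ar i" unfolding z_def using less by (rule horner_less)
      moreover have "args z j = x j" if "j < ar i" for j
        unfolding z_def args_def using less that by (subst horner_digit) auto
      ultimately show ?thesis using False by (auto simp: iterations_def tuple_def)
    qed
    show ?thesis
    proof (cases "ar i = 1 \<and> x 0 \<in> s 9 ` {..<q}")
      case True
      then have "apply_op i x \<in> members s"
        using d i(1) stage by (auto simp: processed_def min_def)
      with t(1) show ?thesis by blast
    next
      case False
      then obtain z where z: "z < iterations i" "\<And>j. j < ar i \<Longrightarrow> args (tuple z) j = x j"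
        using reached by blast
      then have "\<forall>j<ar i. args (tuple z) j \<in> members s" using x sub by auto
      then have "apply_op i (args (tuple z)) \<in> members t" using t(2) z(1) by blast
      with apply_op_cong[OF z(2)] show ?thesis by simp
    qed
  qed
  show ?thesis unfolding tuples_loop_def
  proof (rule runs_For[where I = "\<lambda>h t. queue t \<and> extends s t \<and> members s \<subseteq> members t \<and> members t \<subseteq> C \<and>
      (\<forall>z<h. (\<forall>j<ar i. args (tuple z) j \<in> members s) \<longrightarrow> apply_op i (args (tuple z)) \<in> members t)"
      and B = "\<lambda>_. 4 + eval_time i"], goal_cases)
    case (2 z t)
    have z: "z < iterations i" using 2(1) i by simp
    have "ready t" by (rule ready_cong[OF ready], rule 2(3)) (auto simp: writes_parts)
    have t: "t 0 19 = ar i" "t 0 24 = off i" "t 0 35 = q" "t 9 q = s 9 q"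
      using 2(2) stage i by (auto simp: 2(3) writes_parts extends_def)
    have tuple_less: "tuple z < K"
    proof (cases "ar i = 1")
      case True
      then show ?thesis using mem[OF stage(2)] M_le_K by (simp add: tuple_def members_def)
    next
      case False
      have "M ^ ar i \<le> K"
        unfolding K_def using arity[OF i(1)] M_pos by (simp add: power_increasing)
      with False z show ?thesis by (simp add: tuple_def iterations_def)
    qed
    define Q where "Q = (\<lambda>t'. queue t' \<and> extends s t' \<and> members s \<subseteq> members t' \<and> members t' \<subseteq> C \<and>
      (\<forall>h<Suc z. (\<forall>j<ar i. args (tuple h) j \<in> members s) \<longrightarrow> apply_op i (args (tuple h)) \<in> members t'))"
    have ev: "runs w eval_com u (eval_time i) Q"
      if u: "ready u" "u 0 19 = ar i" "u 0 24 = off i" "u 0 23 = tuple z" "same_queue t u" for u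
    proof (rule runs_frame[OF runs_eval_com[OF u(1) _ i(1) u(2,3)]], goal_cases)
      case (3 t')
      have ext: "extends s u" "extends u t'"
        using 3 2(2) same_queueD(3)[OF u(5)] extends_trans by auto
      have mu: "members u = members t" using same_queueD[OF u(5)] by simp
      have mt: "members t' = members t \<union>
         (if \<forall>j<ar i. args (tuple z) j \<in> members t then {apply_op i (args (tuple z))} else {})"
        using 3(1) unfolding mu u(4) by blast
      have "apply_op i x \<in> C" if "\<forall>j<ar i. x j \<in> members t" for x
        using that 2(2) C(1) i(1) unfolding closed_def by blast
      then have "members t' \<subseteq> C" unfolding mt using 2(2) by auto
      moreover have "apply_op i (args (tuple h)) \<in> members t'"
        if "h < Suc z" "\<forall>j<ar i. args (tuple h) j \<in> members s" for h
        using that 2(2) unfolding mt by (cases "h = z") (auto simp: less_Suc_eq)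
      moreover have "members s \<subseteq> members t'" unfolding mt using 2(2) by auto
      ultimately show ?case
        using 3(1) extends_trans[OF ext] unfolding Q_def by blast
    qed (use u tuple_less 2(2) same_queueD[OF u(5)] in auto)
    have *: "same_queue t (upd u 0 23 v)" "same_queue t (upd u 0 20 v)" "same_queue t (upd u 0 38 v)"
      if "same_queue t u" for u v using that by (auto simp: same_queue_def)
    have "same_queue t t" by (simp add: same_queue_def)
    show ?case
      unfolding Q_def[symmetric]
      using \<open>ready t\<close> t arity[OF i(1)] \<open>same_queue t t\<close>
      by (auto intro!: runs_mono[OF ev] * simp: ready_simps tuple_def)
  next
    case (3 t)
    then show ?case using cover[of _ t] i by (auto simp: members_def[symmetric])
  qed (use q i C in \<open>auto simp: extends_refl\<close>)
qed

definition stage_time :: nat where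
  "stage_time = 3 + (\<Sum>i<r. 7 + iterations i * (5 + eval_time i))"

text \<open>
  If the queue is already exhausted at position \<open>q\<close>, the stage does nothing, and the invariant for \<open>q + 1\<close>
  is the one for \<open>q\<close>.
\<close>

lemma runs_stage_com:
  assumes ready: "ready s" and q: "queue s" and stage: "s 0 35 = q"
    and C: "closed C" "members s \<subseteq> C" and d: "processed q s"
  shows "runs w stage_com s stage_time
    (\<lambda>t. queue t \<and> members s \<subseteq> members t \<and> members t \<subseteq> C \<and> processed (Suc q) t)"
proof (cases "q < s 0 32")
  case False
  then have "min (Suc q) (s 0 32) = min q (s 0 32)" by simp
  with False assms show ?thesis
    by (auto simp: stage_com_def stage_time_def processed_def)
next
  case True
  let ?I = "\<lambda>i t. queue t \<and> extends s t \<and> members s \<subseteq> members t \<and> members t \<subseteq> C \<and>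
      (\<forall>h<i. \<forall>x. (\<forall>j<ar h. x j \<in> s 9 ` {..<Suc q}) \<longrightarrow> apply_op h x \<in> members t)"
  have "runs w (For 36 2 (Lit 20 2 ;; Plus 20 20 36 ;; Inp 19 20 ;; Get 24 6 36 ;; Get 37 7 36 ;; tuples_loop))
     (upd s 0 20 (s 0 32 - q)) (1 + (\<Sum>i<r. 7 + iterations i * (5 + eval_time i)))
    (\<lambda>t. queue t \<and> members s \<subseteq> members t \<and> members t \<subseteq> C \<and> processed (Suc q) t)"
  proof (rule runs_For[where I = ?I and B = "\<lambda>i. 6 + iterations i * (5 + eval_time i)"], goal_cases)
    case (2 i t)
    have i: "i < r" using 2(1) ready by (simp add: ready_simps)
    have "ready t"
      by (rule ready_cong[of "upd s 0 20 (s 0 32 - q)"], use ready in simp, rule 2(3), auto simp: writes_parts)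
    have t35: "t 0 35 = q" using stage by (simp add: 2(3) writes_parts)
    have img: "t 9 ` {..<min q (t 0 32)} = s 9 ` {..<min q (s 0 32)}"
      "t 9 ` {..<Suc q} = s 9 ` {..<Suc q}" "q < t 0 32"
      using 2(2) True by (auto simp: extends_def intro!: image_cong)
    have processed_t: "processed q t"
      unfolding processed_def img(1)
    proof (intro allI impI)
      fix i x assume "i < r" "\<forall>j<ar i. x j \<in> s 9 ` {..<min q (s 0 32)}"
      then have "apply_op i x \<in> members s" using d unfolding processed_def by blast
      then show "apply_op i x \<in> members t" using 2(2) by blast
    qed
    have loop: "runs w tuples_loop u (1 + iterations i * (5 + eval_time i)) (?I (Suc i))"
      if u: "ready u" "u 0 19 = ar i" "u 0 24 = off i" "u 0 37 = iterations i" "u 0 35 = q" "same_queue t u" for u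
    proof (rule runs_frame[OF runs_tuples_loop[OF u(1) _ i u(2,3,4,5) _ C(1)]], goal_cases)
      case (5 t')
      have img': "u 9 ` {..<Suc q} = s 9 ` {..<Suc q}"
        using img u(6) by (simp add: same_queue_def image_def)
      have new: "\<forall>x. (\<forall>j<ar i. x j \<in> s 9 ` {..<Suc q}) \<longrightarrow> apply_op i x \<in> members t'"
        using 5(1) unfolding img' by blast
      have mono: "members t \<subseteq> members t'" using 5(1) same_queueD(2)[OF u(6)] by simp
      have "\<forall>h<Suc i. \<forall>x. (\<forall>j<ar h. x j \<in> s 9 ` {..<Suc q}) \<longrightarrow> apply_op h x \<in> members t'"
        unfolding All_less_Suc using new 2(2) mono by (meson subsetD)
      moreover have "extends s t'"
        using 5(1) 2(2) same_queueD(3)[OF u(6)] extends_trans by meson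
      moreover have "members s \<subseteq> members t'" using 2(2) mono by (meson subset_trans)
      ultimately show ?case using 5(1) by (intro conjI) simp_all
    next
      case 4
      have "u 9 = t 9" using u(6) by (auto simp: same_queue_def)
      then show ?case using processed_t u(6) same_queueD[OF u(6)] by (simp add: processed_def same_queue_def)
    qed (use u 2(2) same_queueD[OF u(6)] img in \<open>auto simp: same_queue_def\<close>)
    have "runs w tuples_loop (upd (upd (upd (upd (upd t 0 36 i) 0 20 (2 + i)) 0 19 (ar i)) 0 24 (off i)) 0 37 (iterations i))
      (1 + iterations i * (5 + eval_time i)) (?I (Suc i))"
      by (rule loop) (use \<open>ready t\<close> t35 in \<open>auto simp: same_queue_def\<close>)
    then show ?case
      using \<open>ready t\<close> arity[OF i] i by (simp add: ready_simps)
  next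
    case (3 t)
    have "s 0 2 = r" using ready by (simp add: ready_simps)
    have "t 9 ` {..<min (Suc q) (t 0 32)} = s 9 ` {..<Suc q}"
      using 3(1) True by (auto simp: extends_def intro!: image_cong)
    with 3(1) \<open>s 0 2 = r\<close> show ?case
      by (simp add: processed_def)
  qed (use ready q C in \<open>auto simp: extends_refl ready_simps\<close>)
  then show ?thesis using True stage
    by (auto simp: stage_com_def stage_time_def)
qed

inductive_set closure :: "nat set \<Rightarrow> nat set" for G where
  base: "x \<in> G \<Longrightarrow> x \<in> closure G"
| step: "i < r \<Longrightarrow> (\<And>j. j < ar i \<Longrightarrow> x j \<in> closure G) \<Longrightarrow> apply_op i x \<in> closure G"

lemma closed_closure: "closed (closure G)"
  by (auto simp: closed_def intro: closure.step)

lemma closure_least: "closed C \<Longrightarrow> G \<subseteq> C \<Longrightarrow> closure G \<subseteq> C"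
proof
  fix x assume "closed C" "G \<subseteq> C" "x \<in> closure G"
  from this(3,1,2) show "x \<in> C" by induction (auto simp: closed_def)
qed

definition const_code :: "nat \<Rightarrow> nat" where "const_code d = code (\<lambda>_. d)"

definition meets_constant :: "nat \<Rightarrow> bool" where
  "meets_constant a \<longleftrightarrow> (\<exists>d<m. const_code d \<in> closure (generator a ` {..<n}))"

lemma runs_check_com:
  assumes ready: "ready s"
  shows "runs w check_com s (4 + m * (7 + 3 * n))
    (\<lambda>t. t 0 0 = (if \<exists>d<m. const_code d \<in> members s then s 0 0 else 0))"
proof -
  define Q where "Q = (\<lambda>t :: store. t 0 0 = (if \<exists>d<m. const_code d \<in> members s then s 0 0 else 0))"
  let ?body = "Lit 31 0 ;; For 25 3 (Get 31 1 31 ;; Plus 31 31 38) ;; Get 20 8 31 ;; Cond 20 (Lit 39 1) skip"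
  have horner_loop: "runs w (For 25 3 (Get 31 1 31 ;; Plus 31 31 38)) u (1 + 3 * n)
    (\<lambda>t. t 0 31 = const_code d)" if u: "ready u" "u 0 31 = 0" "u 0 38 = d" "d < m" for u d
  proof (rule runs_For[where I = "\<lambda>c t. t 0 31 = horner m (\<lambda>_. d) c" and B = "\<lambda>_. 2"], goal_cases)
    case (2 c t)
    have c: "c < n" using 2(1) u by (simp add: ready_simps)
    have "ready t" by (rule ready_cong[OF u(1)], rule 2(3)) auto
    have "t 0 31 < m ^ c" using 2(2) u(4) by (auto intro!: horner_less)
    also have "\<dots> \<le> K" using c M_le_K power_le_M[of c] by auto
    finally have "t 0 31 < K" .
    moreover have "t 0 38 = d" using u by (simp add: 2(3))
    ultimately show ?case using \<open>ready t\<close> 2(2) by (simp add: ready_simps)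
  qed (use u in \<open>auto simp: ready_simps const_code_def code_def\<close>)
  have loop: "runs w (For 38 1 ?body) (upd s 0 39 0) (1 + m * (7 + 3 * n))
    (\<lambda>t. t 0 39 \<noteq> 0 \<longleftrightarrow> (\<exists>d<m. const_code d \<in> members s))"
  proof (rule runs_For[where I = "\<lambda>d t. t 0 39 \<noteq> 0 \<longleftrightarrow> (\<exists>h<d. const_code h \<in> members s)" and B = "\<lambda>_. 6 + 3 * n"], goal_cases)
    case (2 d t)
    have d: "d < m" using 2(1) ready by (simp add: ready_simps)
    have "ready t" by (rule ready_cong[of "upd s 0 39 0"], use ready in simp, rule 2(3), auto)
    have "runs w (For 25 3 (Get 31 1 31 ;; Plus 31 31 38) ;; Get 20 8 31 ;; Cond 20 (Lit 39 1) skip)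
      (upd (upd t 0 38 d) 0 31 0) (5 + 3 * n) (\<lambda>t. t 0 39 \<noteq> 0 \<longleftrightarrow> (\<exists>h<Suc d. const_code h \<in> members s))"
    proof (rule runs_Seq[OF horner_loop[of _ d], where ?T2.0 = 4], goal_cases)
      case (5 u)
      have "u 8 x = s 8 x" for x by (simp add: 5(2) 2(3))
      then have "u 8 (const_code d) \<noteq> 0 \<longleftrightarrow> const_code d \<in> members s"
        using d by (auto simp: members_def const_code_def intro!: code_less)
      moreover have "u 0 39 = t 0 39" by (simp add: 5(2))
      ultimately show ?case using 5(1) 2(2) by (auto simp: less_Suc_eq)
    qed (use \<open>ready t\<close> d in auto)
    then show ?case by simp
  qed (use ready in \<open>auto simp: ready_simps\<close>)
  have "runs w (For 38 1 ?body ;; Cond 39 skip (Lit 0 0)) (upd s 0 39 0) (3 + m * (7 + 3 * n)) Q"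
  proof (rule runs_Seq[OF loop, where ?T2.0 = 2], goal_cases)
    case (1 t)
    have "t 0 0 = s 0 0" by (simp add: 1(2))
    with 1(1) show ?case by (auto simp: Q_def)
  qed auto
  then show ?thesis unfolding Q_def[symmetric] by (simp add: check_com_def)
qed

lemma runs_clear_loop:
  assumes ready: "ready s"
  shows "runs w clear_loop s (2 + 2 * M) (\<lambda>t. queue t \<and> members t = {} \<and> t 0 32 = 0)"
proof -
  have "runs w (For 25 4 (Put 8 25 8)) s (1 + 2 * M) (\<lambda>t. \<forall>x<M. t 8 x = 0)"
    by (rule runs_For[where I = "\<lambda>i t. \<forall>x<i. t 8 x = 0" and B = "\<lambda>_. 1"])
      (use ready in \<open>auto simp: ready_simps less_Suc_eq\<close>)
  then show ?thesis unfolding clear_loop_def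
    by (rule runs_Seq[where ?T2.0 = 1]) (auto simp: members_def queue_def)
qed

definition round_time :: nat where
  "round_time = (2 + 2 * M) + (gens_time + ((1 + M * (1 + stage_time)) + (4 + m * (7 + 3 * n))))"

text \<open>
  After \<open>M\<close> stages the whole queue is processed, since it has at most \<open>M\<close> distinct elements. So the set of
  found elements is closed, and hence equal to the generated subalgebra.
\<close>

lemma runs_round:
  assumes ready: "ready s" and a: "s 0 33 = a" "a < M"
  shows "runs w (clear_loop ;; gens_com ;; For 35 4 stage_com ;; check_com) s round_time
    (\<lambda>t. t 0 0 = (if meets_constant a then s 0 0 else 0))"
  unfolding round_time_def
proof (rule runs_Seq[OF runs_clear_loop[OF ready] _ order_refl], goal_cases)
  case (1 s1)
  have ready1: "ready s1" by (rule ready_cong[OF ready], rule 1(2)) (auto simp: writes_parts)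
  have s1: "s1 0 33 = a" "s1 0 0 = s 0 0" using a by (simp_all add: 1(2) writes_parts)
  show ?case
  proof (rule runs_Seq[OF runs_gens_com[OF ready1, unfolded s1] _ order_refl], goal_cases)
    case (3 s2)
    let ?G = "generator a ` {..<n}"
    have ready2: "ready s2" by (rule ready_cong[OF ready1], rule 3(2)) (auto simp: writes_parts)
    have s2: "queue s2" "members s2 = ?G" "s2 0 0 = s 0 0" using 3 1 s1 by (simp_all add: writes_parts)
    have stages: "runs w (For 35 4 stage_com) s2 (1 + M * (1 + stage_time)) (\<lambda>t. members t = closure ?G)"
    proof (rule runs_For[where I = "\<lambda>q t. queue t \<and> ?G \<subseteq> members t \<and> members t \<subseteq> closure ?G \<and> processed q t"
          and B = "\<lambda>_. stage_time"], goal_cases)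
      case 1
      have "\<exists>j. j < ar i" if "i < r" for i using arity[OF that] by (auto intro: exI[of _ 0])
      then have "processed 0 s2" unfolding processed_def by fastforce
      then show ?case using s2 by (auto intro: closure.base)
    next
      case (2 q t)
      have "ready t" by (rule ready_cong[OF ready2], rule 2(3)) (auto simp: writes_parts)
      have "processed q (upd t 0 35 q)" using 2(2) by (simp add: processed_def)
      then show ?case
        using runs_stage_com[of "upd t 0 35 q" q "closure ?G"] closed_closure[of ?G] \<open>ready t\<close> 2(2)
        by (auto elim!: runs_frame)
    next
      case (3 t)
      have M: "s2 0 4 = M" using ready2 by (simp add: ready_simps)
      have "t 9 ` {..<min M (t 0 32)} = members t"
        using 3(1) queue_length_le[of t] by (simp add: queue_def min_absorb2)
      then have "closed (members t)" using 3(1) M by (simp add: processed_def closed_def)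
      then show ?case using 3(1) closure_least[of "members t" ?G] by auto
    qed (use ready2 in \<open>auto simp: ready_simps\<close>)
    show ?case
    proof (rule runs_Seq[OF stages _ order_refl], goal_cases)
      case (1 s3)
      have ready3: "ready s3" by (rule ready_cong[OF ready2], rule 1(2)) (auto simp: writes_parts)
      have "s3 0 0 = s 0 0" using s2 by (simp add: 1(2) writes_parts)
      then show ?case using runs_check_com[OF ready3] 1(1)
        by (simp add: meets_constant_def split del: if_split cong: if_cong)
    qed
  qed (use a 1 in auto)
qed

lemma runs_search_com:
  assumes ready: "ready s"
  shows "runs w search_com s (1 + M * (1 + round_time)) (\<lambda>t. t 0 0 = (if \<forall>a<M. meets_constant a then s 0 0 else 0))"
  unfolding search_com_def
proof (rule runs_For[where I = "\<lambda>i t. t 0 0 = (if \<forall>a<i. meets_constant a then s 0 0 else 0)" and B = "\<lambda>_. round_time"], goal_cases)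
  case (2 a t)
  have "ready t" by (rule ready_cong[OF ready], rule 2(3)) (auto simp: writes_parts)
  moreover have "a < M" using 2(1) ready by (simp add: ready_simps)
  ultimately have "runs w (clear_loop ;; gens_com ;; For 35 4 stage_com ;; check_com) (upd t 0 33 a)
      round_time (\<lambda>t'. t' 0 0 = (if meets_constant a then t 0 0 else 0))"
    using runs_round[of "upd t 0 33 a" a] by (simp split del: if_split cong: if_cong)
  then show ?case
    by (rule runs_frame) (use 2(2) in \<open>auto simp: All_less_Suc\<close>)
qed (use ready in \<open>auto simp: ready_simps\<close>)

end

section \<open>One complete test and its time bound\<close>

lemma writes_load_com: "writes (load_com xs j) b i \<Longrightarrow> b = 0 \<and> i \<in> {20, 31} \<or> b = 12"
  by (induction xs arbitrary: j) auto

lemma runs_load_com: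
  "runs w (load_com xs j) s (1 + 3 * length xs)
    (\<lambda>t. (\<forall>i<length xs. t 12 (j + i) = xs ! i) \<and> (\<forall>i<j. t 12 i = s 12 i))"
proof (induction xs arbitrary: j s)
  case (Cons x xs)
  let ?s = "upd (upd (upd s 0 20 j) 0 31 x) 12 j x"
  have "runs w (load_com xs (Suc j)) ?s (1 + 3 * length xs)
    (\<lambda>t. (\<forall>i<length (x # xs). t 12 (j + i) = (x # xs) ! i) \<and> (\<forall>i<j. t 12 i = s 12 i))"
  proof (rule runs_frame[OF Cons.IH], goal_cases)
    case (1 t)
    then have "t 12 j = x" by (metis (no_types, lifting) lessI upd_apply)
    moreover have "t 12 i = s 12 i" if "i < j" for i
      using 1(1) that by auto
    ultimately show ?case
      using 1(1) by (auto simp: nth_Cons split: nat.splits)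
  qed simp
  then show ?case by simp
qed simp

text \<open>
  The order in which \<open>generator_loop\<close> reads the permutations: for each generator \<open>i\<close> the coordinates \<open>c\<close> from the
  last to the first.
\<close>

definition permutation_table :: "nat \<Rightarrow> (nat \<Rightarrow> nat \<Rightarrow> nat) \<Rightarrow> nat list" where
  "permutation_table n \<sigma> = map (\<lambda>k. \<sigma> (n - 1 - k mod n) (k div n)) [0..<n * n]"

lemma length_permutation_table [simp]: "length (permutation_table n \<sigma>) = n * n"
  by (simp add: permutation_table_def)

lemma nth_permutation_table:
  assumes "i < n" "c < n"
  shows "permutation_table n \<sigma> ! (i * n + c) = \<sigma> (n - 1 - c) i" "i * n + c < n * n"
proof -
  have "i * n + c < Suc i * n" using assms by simp
  also have "\<dots> \<le> n * n" using assms by (intro mult_right_mono) auto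
  finally show "i * n + c < n * n" .
  then show "permutation_table n \<sigma> ! (i * n + c) = \<sigma> (n - 1 - c) i"
    using assms by (simp add: permutation_table_def)
qed

definition test_com :: "nat \<Rightarrow> (nat \<Rightarrow> nat \<Rightarrow> nat) \<Rightarrow> com" where
  "test_com n \<sigma> = Lit 3 n ;; load_com (permutation_table n \<sigma>) 0 ;; power_com 1 3 ;; Mov 4 9 ;;
     power_com 4 6 ;; Mov 5 9 ;; table_com ;; prepare_ops_com ;; search_com"

lemma writes_table_com: "writes table_com b i \<longleftrightarrow> b = 0 \<and> i \<in> {11, 13, 14, 15, 16, 17, 20} \<or> b \<in> {1, 2, 3, 4, 5}"
  by (auto simp: table_com_def tick_def)

lemma writes_prepare_ops_com:
  "writes prepare_ops_com b i \<longleftrightarrow> b = 0 \<and> i \<in> {9, 10, 11, 12, 18, 19, 20, 22} \<or> b \<in> {6, 7}"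
  by (auto simp: prepare_ops_com_def writes_power_com)

lemma writes_search_com:
  "writes search_com b i \<Longrightarrow> b = 0 \<and> i \<notin> {1, 2, 3, 4, 5, 6, 7, 8} \<or> b \<in> {8, 9, 10, 11}"
  by (auto simp: search_com_def writes_parts)

lemma writes_test_com: "writes (test_com n \<sigma>) 0 i \<Longrightarrow> i \<notin> {1, 2, 6, 7, 8}"
  by (auto simp: test_com_def writes_power_com writes_table_com writes_prepare_ops_com
      dest!: writes_search_com writes_load_com)

lemma sum_power_le: "finite S \<Longrightarrow> 1 \<le> n \<Longrightarrow> (\<Sum>i\<in>S. f i ^ n) \<le> (\<Sum>i\<in>S. f i :: nat) ^ n"
proof (induction S rule: finite_induct)
  case (insert x S)
  have "a ^ n + b ^ n \<le> (a + b) ^ n" for a b :: nat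
    using insert.prems
  proof (induction n rule: nat_induct_at_least)
    case (Suc k)
    have "a ^ Suc k + b ^ Suc k \<le> (a + b) * (a ^ k + b ^ k)" by (simp add: algebra_simps)
    also have "\<dots> \<le> (a + b) ^ Suc k" using Suc by simp
    finally show ?case .
  qed simp
  with insert show ?case by (simp) (meson add_left_mono order_trans)
qed simp

context operation_tables begin

definition cells :: nat where "cells = (\<Sum>i<r. m ^ ar i)"

lemma r_le_cells: "r \<le> cells"
proof -
  have "(\<Sum>i<r. 1) \<le> cells" unfolding cells_def using m by (intro sum_mono) simp
  then show ?thesis by simp
qed

lemma power_le_cells: "i < r \<Longrightarrow> m ^ ar i \<le> cells"
  unfolding cells_def by (intro member_le_sum) auto

lemma m_le_cells: "m \<le> cells"
proof -
  have "m \<le> m ^ ar 0" using m arity[of 0] r by (intro self_le_power) auto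
  with power_le_cells[of 0] r show ?thesis by simp
qed

lemma M_le: "M \<le> cells ^ n"
  unfolding M_def using m_le_cells by (rule power_mono) simp

lemma K_le: "K \<le> cells ^ n"
proof -
  obtain i where "i < r" "ar i = kmax" using kmax_attained by auto
  then have "m ^ kmax \<le> cells" using power_le_cells by auto
  then have "(m ^ kmax) ^ n \<le> cells ^ n" by (rule power_mono) simp
  then show ?thesis by (simp add: K_def M_def power_mult[symmetric] mult.commute)
qed

text \<open>
  Bounds the number of tuples visited in the whole test. Unary operations are the critical case: visiting
  each of the \<open>M\<close> elements in every stage would exceed the bound by a factor up to \<open>M\<close>. For arity at least 2
  there is room, because already \<open>M ^ 2\<close> is at most \<open>(m ^ kmax) ^ n\<close>.
\<close>

lemma key_bound: "M * M * (\<Sum>i<r. iterations i) \<le> cells ^ n * cells ^ n"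
proof (cases "kmax = 1")
  case True
  then have 1: "ar i = 1" if "i < r" for i using arity[OF that] by simp
  then have "cells = r * m" "(\<Sum>i<r. iterations i) = r" by (auto simp: cells_def iterations_def)
  moreover have "M * M * r \<le> M * M * (r ^ n * r ^ n)"
  proof -
    have "r \<le> r ^ n" using r n by (intro self_le_power) auto
    also have "\<dots> \<le> r ^ n * r ^ n" using r by simp
    finally show ?thesis by simp
  qed
  ultimately show ?thesis by (simp add: M_def power_mult_distrib algebra_simps)
next
  case False
  then have "M ^ 2 \<le> K"
    unfolding K_def using kmax_pos M_pos by (intro power_increasing) auto
  then have "M * M \<le> cells ^ n" using K_le by (simp add: power2_eq_square)
  moreover have "(\<Sum>i<r. iterations i) \<le> cells ^ n"
  proof -
    have "iterations i \<le> (m ^ ar i) ^ n" for i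
      using M_pos m by (auto simp: iterations_def M_def power_mult[symmetric] mult.commute)
    then have "(\<Sum>i<r. iterations i) \<le> (\<Sum>i<r. (m ^ ar i) ^ n)" by (intro sum_mono)
    also have "\<dots> \<le> cells ^ n" unfolding cells_def using n by (intro sum_power_le) auto
    finally show ?thesis .
  qed
  ultimately show ?thesis by (intro mult_mono) auto
qed

definition test_time :: nat where
  "test_time = 1 + ((1 + 3 * (n * n)) + ((2 + n * (4 + 2 * m)) + (1 + ((2 + kmax * (4 + 2 * M)) + (1 + ((6 + K * 17) +
     ((3 + (\<Sum>i<r. 15 + ar i * (8 + 2 * m + 2 * M))) + (1 + M * (1 + round_time)))))))))"

text \<open>
  Every summand of the running time is compared with \<open>X = kmax * P * P\<close>, where \<open>P\<close> is the size of the input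
  to the power \<open>n\<close>. The visited tuples contribute the dominant term through \<open>key_bound\<close>; one visit costs at most
  \<open>(36 + 20 * n) * kmax\<close>. The coefficient collects the constants of all program parts.
\<close>

lemma test_time_le: "test_time \<le> (130 + 41 * n + 9 * (n * n)) * (kmax * cells ^ (2 * n))"
proof -
  define P where "P = cells ^ n"
  define X where "X = kmax * (P * P)"
  have X: "cells ^ (2 * n) = P * P" by (simp add: P_def mult_2 power_add)
  have MP: "M \<le> P" "K \<le> P" using M_le K_le by (auto simp: P_def)
  then have P: "1 \<le> P" using M_pos by simp
  have P2: "P \<le> P * P" using P by simp
  then have PX: "P * P \<le> X" "P \<le> X" using kmax_pos P unfolding X_def by (auto intro: order_trans)
  have "m \<le> M" unfolding M_def using m n by (intro self_le_power) auto
  have "cells \<le> P" unfolding P_def using n r_le_cells r by (intro self_le_power) auto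
  then have rP: "r \<le> P" using r_le_cells by simp
  have 1: "1 \<le> X" using P PX by simp
  have kX: "kmax \<le> X" using P unfolding X_def by simp
  have kM: "kmax * M \<le> X" unfolding X_def using MP(1) P2 by (intro mult_mono order_trans[OF MP(1) P2]) auto
  have "r * M \<le> P * P" using rP MP by (intro mult_mono) auto
  then have rkM: "kmax * (r * M) \<le> X" unfolding X_def by simp
  have MM: "M * M \<le> X" using MP PX mult_mono[of M P M P] by simp
  have Mm: "M * m \<le> X" by (rule order_trans[OF mult_le_mono2[OF \<open>m \<le> M\<close>] MM])
  have "(\<Sum>i<r. 15 + ar i * (8 + 2 * m + 2 * M)) \<le> (\<Sum>i<r. kmax * (27 * M))"
  proof (intro sum_mono)
    fix i assume "i \<in> {..<r}"
    then have ar: "1 \<le> ar i" "ar i \<le> kmax" using arity by auto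
    have "15 \<le> ar i * (15 * M)" using ar M_pos by (simp add: Suc_le_eq)
    then have "15 + ar i * (8 + 2 * m + 2 * M) \<le> ar i * (15 * M) + ar i * (12 * M)"
      using \<open>m \<le> M\<close> M_pos by (intro add_mono mult_left_mono) auto
    also have "\<dots> = ar i * (27 * M)" by (simp add: algebra_simps)
    also have "\<dots> \<le> kmax * (27 * M)" using ar by simp
    finally show "15 + ar i * (8 + 2 * m + 2 * M) \<le> kmax * (27 * M)" .
  qed
  also have "\<dots> = 27 * (kmax * (r * M))" by simp
  finally have ops: "(\<Sum>i<r. 15 + ar i * (8 + 2 * m + 2 * M)) \<le> 27 * X" using rkM by simp
  have "(\<Sum>i<r. 7 + iterations i * (5 + eval_time i)) \<le> (\<Sum>i<r. iterations i * (kmax * (36 + 20 * n)))"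
  proof (intro sum_mono)
    fix i assume "i \<in> {..<r}"
    then have ar: "1 \<le> ar i" "ar i \<le> kmax" using arity by auto
    have it: "1 \<le> iterations i" using M_pos by (simp add: iterations_def)
    have "eval_time i \<le> (12 + 10 * n) * (2 * kmax)"
      unfolding eval_time_def using ar by (intro mult_left_mono) auto
    then have e: "12 + eval_time i \<le> kmax * (36 + 20 * n)"
      using kmax_pos by (simp add: algebra_simps)
    have "7 + iterations i * (5 + eval_time i) \<le> iterations i * 7 + iterations i * (5 + eval_time i)"
      using it by simp
    also have "\<dots> = iterations i * (12 + eval_time i)" by (simp add: algebra_simps)
    also have "\<dots> \<le> iterations i * (kmax * (36 + 20 * n))" using e by simp
    finally show "7 + iterations i * (5 + eval_time i) \<le> iterations i * (kmax * (36 + 20 * n))" .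
  qed
  then have "stage_time \<le> 3 + (\<Sum>i<r. iterations i) * (kmax * (36 + 20 * n))"
    by (simp add: stage_time_def sum_distrib_right)
  then have "M * M * stage_time \<le> M * M * (3 + (\<Sum>i<r. iterations i) * (kmax * (36 + 20 * n)))" by simp
  also have "\<dots> = 3 * (M * M) + (M * M * (\<Sum>i<r. iterations i)) * (kmax * (36 + 20 * n))"
    by (simp add: algebra_simps)
  also have "\<dots> \<le> 3 * X + (P * P) * (kmax * (36 + 20 * n))"
    using MM key_bound by (intro add_mono mult_right_mono) (auto simp: P_def)
  also have "\<dots> = 3 * X + (36 + 20 * n) * X" by (simp add: X_def algebra_simps)
  finally have stage: "M * M * stage_time \<le> (39 + 20 * n) * X" by (simp add: algebra_simps)
  have "M * (1 + round_time) = M * (8 + gens_time) + 3 * (M * M) + M * M * stage_time + (M * m) * (7 + 3 * n)"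
    by (simp add: round_time_def algebra_simps)
  also have "\<dots> \<le> X * (8 + gens_time) + 3 * X + (39 + 20 * n) * X + X * (7 + 3 * n)"
    using MM Mm stage MP(1) PX(2) by (intro add_mono mult_left_mono mult_right_mono) auto
  finally have rounds: "M * (1 + round_time) \<le> (61 + 35 * n + 6 * (n * n)) * X"
    by (simp add: gens_time_def algebra_simps)
  have "n * (4 + 2 * m) \<le> n * (6 * X)"
    using 1 \<open>m \<le> M\<close> MP PX by (intro mult_left_mono) auto
  then have nm: "n * (4 + 2 * m) \<le> 6 * (n * X)" by simp
  have nn: "3 * (n * n) \<le> 3 * (n * n) * X" using 1 by simp
  have "kmax * (4 + 2 * M) \<le> 6 * X" using kX kM by (simp add: algebra_simps)
  then have "test_time \<le> 19 * X + 3 * (n * n) * X + 6 * (n * X) + 6 * X + 17 * X + 27 * X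
      + (61 + 35 * n + 6 * (n * n)) * X"
    using 1 nn nm MP PX ops rounds unfolding test_time_def by linarith
  also have "\<dots> = (130 + 41 * n + 9 * (n * n)) * X" by (simp add: algebra_simps)
  finally show ?thesis unfolding X X_def .
qed

text \<open>
  What is in place after loading the permutations, and is preserved while the tables are built.
\<close>

definition loaded :: "nat \<Rightarrow> store \<Rightarrow> bool" where
  "loaded v t \<longleftrightarrow> t 0 0 = v \<and> t 0 1 = m \<and> t 0 2 = r \<and> t 0 3 = n \<and> t 0 6 = kmax \<and> t 0 7 = 1 \<and> t 0 8 = 0 \<and>
    (\<forall>i<n. \<forall>c<n. t 12 (i * n + c) = \<sigma> (n - 1 - c) i)"

lemma loaded_frame:
  assumes "loaded v s" "\<And>b i. b = 0 \<and> i \<in> {0, 1, 2, 3, 6, 7, 8} \<or> b = 12 \<Longrightarrow> t b i = s b i"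
  shows "loaded v t"
  using assms(1) assms(2)[of 0] assms(2)[of 12] unfolding loaded_def by simp

lemma loaded_simps:
  assumes "loaded v t"
  shows "t 0 0 = v" "t 0 1 = m" "t 0 (Suc 0) = m" "t 0 2 = r" "t 0 3 = n" "t 0 6 = kmax" "t 0 7 = 1" "t 0 8 = 0"
  using assms by (simp_all add: loaded_def)

lemma runs_test_com:
  assumes s: "s 0 1 = m" "s 0 2 = r" "s 0 6 = kmax" "s 0 7 = 1" "s 0 8 = 0"
  shows "runs w (test_com n \<sigma>) s test_time (\<lambda>t. t 0 0 = (if \<forall>a<M. meets_constant a then s 0 0 else 0))"
proof -
  define v where "v = s 0 0"
  define Q where "Q = (\<lambda>t :: store. t 0 0 = (if \<forall>a<M. meets_constant a then v else 0))"
  define tables where "tables t \<longleftrightarrow> (\<forall>x<K. t 1 x = x * m \<and> t 2 x = x div m \<and> t 3 x = x mod m \<and>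
      t 4 x = x div M \<and> t 5 x = x mod M)" for t :: store
  have search: "runs w search_com t (1 + M * (1 + round_time)) Q" if "ready t" "t 0 0 = v" for t
    using runs_search_com[OF that(1)] that(2) unfolding Q_def by (simp split del: if_split cong: if_cong)
  have prepare: "runs w (prepare_ops_com ;; search_com) t ((3 + (\<Sum>i<r. 15 + ar i * (8 + 2 * m + 2 * M)))
      + (1 + M * (1 + round_time))) Q" if t: "loaded v t" "t 0 4 = M" "tables t" for t
  proof (rule runs_Seq[OF runs_prepare_ops_com[of t m M r] _ order_refl], goal_cases)
    case (6 u)
    have "loaded v u" by (rule loaded_frame[OF t(1)], rule 6(2)) (auto simp: writes_prepare_ops_com)
    moreover have "u 0 4 = M" "tables u"
      using t(2,3) by (simp_all add: tables_def 6(2) writes_prepare_ops_com)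
    ultimately have "ready u"
      using 6(1) off unfolding ready_def loaded_def tables_def iterations_def by simp
    with \<open>loaded v u\<close> show ?case using search by (simp add: loaded_simps)
  qed (use t arity in \<open>auto simp: loaded_simps\<close>)
  have table: "runs w (table_com ;; prepare_ops_com ;; search_com) t ((6 + K * 17) +
      ((3 + (\<Sum>i<r. 15 + ar i * (8 + 2 * m + 2 * M))) + (1 + M * (1 + round_time)))) Q"
    if t: "loaded v t" "t 0 4 = M" "t 0 5 = K" for t
  proof (rule runs_Seq[OF runs_table_com[of t m M, unfolded t(3)] _ order_refl], goal_cases)
    case (6 u)
    have "loaded v u" by (rule loaded_frame[OF t(1)], rule 6(2)) (auto simp: writes_table_com)
    moreover have "u 0 4 = M" using t(2) by (simp add: 6(2) writes_table_com)
    ultimately show ?case using 6(1) by (intro prepare) (auto simp: tables_def)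
  qed (use t m M_pos in \<open>auto simp: loaded_simps\<close>)
  let ?T = "(6 + K * 17) + ((3 + (\<Sum>i<r. 15 + ar i * (8 + 2 * m + 2 * M))) + (1 + M * (1 + round_time)))"
  have copy_K: "runs w (Mov 5 9 ;; table_com ;; prepare_ops_com ;; search_com) t (1 + ?T) Q"
    if t: "loaded v t" "t 0 4 = M" "t 0 9 = K" for t
  proof (rule runs_Seq[where R = "\<lambda>u. u 0 5 = K", OF _ _ order_refl], goal_cases)
    case (2 u)
    have "loaded v u" by (rule loaded_frame[OF t(1)], rule 2(2)) auto
    with 2(1) t show ?case by (intro table) (auto simp: 2(2))
  qed (use t in simp)
  have power_K: "runs w (power_com 4 6 ;; Mov 5 9 ;; table_com ;; prepare_ops_com ;; search_com) t
      ((2 + kmax * (4 + 2 * M)) + (1 + ?T)) Q"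
    if t: "loaded v t" "t 0 4 = M" for t
  proof (rule runs_Seq[OF runs_power_com[of 4 6 w t, unfolded t(2) loaded_simps(6)[OF t(1)]] _ order_refl], goal_cases)
    case (3 u)
    have "loaded v u" by (rule loaded_frame[OF t(1)], rule 3(2)) (auto simp: writes_power_com)
    with 3(1) t show ?case by (intro copy_K) (auto simp: 3(2) writes_power_com K_def)
  qed simp_all
  have copy_M: "runs w (Mov 4 9 ;; power_com 4 6 ;; Mov 5 9 ;; table_com ;; prepare_ops_com ;; search_com) t
      (1 + ((2 + kmax * (4 + 2 * M)) + (1 + ?T))) Q"
    if t: "loaded v t" "t 0 9 = M" for t
  proof (rule runs_Seq[where R = "\<lambda>u. u 0 4 = M", OF _ _ order_refl], goal_cases)
    case (2 u)
    have "loaded v u" by (rule loaded_frame[OF t(1)], rule 2(2)) auto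
    with 2(1) show ?case by (intro power_K)
  qed (use t in simp)
  have power_M: "runs w (power_com 1 3 ;; Mov 4 9 ;; power_com 4 6 ;; Mov 5 9 ;; table_com ;; prepare_ops_com ;; search_com) t
      ((2 + n * (4 + 2 * m)) + (1 + ((2 + kmax * (4 + 2 * M)) + (1 + ?T)))) Q"
    if t: "loaded v t" for t
  proof (rule runs_Seq[OF runs_power_com[of 1 3 w t, unfolded loaded_simps(2,5)[OF t]] _ order_refl], goal_cases)
    case (3 u)
    have "loaded v u" by (rule loaded_frame[OF t], rule 3(2)) (auto simp: writes_power_com)
    with 3(1) show ?case by (intro copy_M) (simp_all add: M_def)
  qed simp_all
  have "runs w (test_com n \<sigma>) s test_time Q"
    unfolding test_com_def test_time_def
  proof (rule runs_Seq[where R = "\<lambda>t. t 0 3 = n", OF _ _ order_refl], goal_cases)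
    case (2 t)
    show ?case
    proof (rule runs_Seq[OF runs_load_com[of w "permutation_table n \<sigma>" 0 t, unfolded length_permutation_table] _ order_refl], goal_cases)
      case (1 u)
      have u: "u 0 i = t 0 i" if "i \<notin> {20, 31}" for i
        by (rule 1(2)) (use that in \<open>auto dest: writes_load_com\<close>)
      have "u 0 i = s 0 i" if "i \<notin> {3, 20, 31}" for i
        using that by (simp add: u 2(2))
      moreover have "u 0 3 = n" using 2(1) by (simp add: u)
      ultimately have "loaded v u"
        using s 1(1) by (simp add: loaded_def v_def nth_permutation_table)
      then show ?case by (rule power_M)
    qed
  qed simp
  then show ?thesis unfolding Q_def v_def .
qed

end

section \<open>Algebras given by their operation tables\<close>

lemma horner_Suc_shift: "horner m f (Suc n) = f 0 * m ^ n + horner m (\<lambda>j. f (Suc j)) n"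
  by (induction n) (auto simp: algebra_simps)

lemma nth_concat_blocks:
  assumes "\<forall>xs \<in> set xss. length xs = L" "i < length xss" "j < L"
  shows "concat xss ! (i * L + j) = xss ! i ! j"
  using assms
proof (induction xss arbitrary: i)
  case (Cons xs xss)
  then show ?case by (cases i) (auto simp: nth_append)
qed simp

lemma nth_concat_sum:
  assumes "i < length xss" "j < length (xss ! i)"
  shows "(\<Sum>l<i. length (xss ! l)) + j < length (concat xss) \<and>
    concat xss ! ((\<Sum>l<i. length (xss ! l)) + j) = xss ! i ! j"
  using assms
proof (induction xss arbitrary: i)
  case (Cons xs xss)
  show ?case
  proof (cases i)
    case (Suc i')
    have "(\<Sum>l<i. length ((xs # xss) ! l)) = length xs + (\<Sum>l<i'. length (xss ! l))"
      by (simp add: Suc sum.lessThan_Suc_shift del: sum.lessThan_Suc)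
    with Cons.IH[of i'] Cons.prems Suc show ?thesis by (simp add: nth_append)
  qed (use Cons.prems in \<open>auto simp: nth_append\<close>)
qed simp

lemma length_product_lists_replicate: "length (product_lists (replicate k [0..<m])) = m ^ k"
  by (induction k) (simp_all add: length_concat comp_def sum_list_triv)

lemma in_product_lists_replicate:
  "as \<in> set (product_lists (replicate k [0..<m])) \<Longrightarrow> length as = k \<and> set as \<subseteq> {..<m}"
  by (induction k arbitrary: as) fastforce+

lemma nth_product_lists_replicate:
  "length as = k \<Longrightarrow> set as \<subseteq> {..<m} \<Longrightarrow> product_lists (replicate k [0..<m]) ! horner m ((!) as) k = as"
proof (induction k arbitrary: as)
  case (Suc k)
  then obtain b bs where as: "as = b # bs" by (cases as) auto
  have b: "b < m" "length bs = k" "set bs \<subseteq> {..<m}" using Suc.prems as by auto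
  let ?L = "product_lists (replicate k [0..<m])"
  have less: "horner m ((!) bs) k < m ^ k"
    using b by (intro horner_less) (metis lessThan_iff nth_mem subsetD)
  have "product_lists (replicate (Suc k) [0..<m]) ! horner m ((!) as) (Suc k) =
      concat (map (\<lambda>x. map (Cons x) ?L) [0..<m]) ! (b * m ^ k + horner m ((!) bs) k)"
    by (simp add: as horner_Suc_shift del: horner.simps)
  also have "\<dots> = map (\<lambda>x. map (Cons x) ?L) [0..<m] ! b ! horner m ((!) bs) k"
    using b less by (intro nth_concat_blocks) (auto simp: length_product_lists_replicate)
  also have "\<dots> = as"
    using b less Suc.IH[of bs] by (simp add: as length_product_lists_replicate)
  finally show ?case .
qed simp

lemma length_op_table: "length (op_table m kf) = m ^ fst kf"
  by (simp add: op_table_def length_product_lists_replicate)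

lemma nth_op_table:
  assumes "length as = fst kf" "set as \<subseteq> {..<m}"
  shows "op_table m kf ! horner m ((!) as) (fst kf) = snd kf as"
proof -
  have "horner m ((!) as) (fst kf) < m ^ fst kf"
    using assms by (intro horner_less) (metis lessThan_iff nth_mem subsetD)
  then show ?thesis
    using nth_product_lists_replicate[OF assms] by (simp add: op_table_def length_product_lists_replicate)
qed

abbreviation op_arity :: "'a op_algebra \<Rightarrow> nat \<Rightarrow> nat" where
  "op_arity A i \<equiv> fst (basic_ops A ! i)"

text \<open>
  The input starts with the size of the universe, the number of operations, and the list of arities.
\<close>

definition op_offset :: "nat op_algebra \<Rightarrow> nat \<Rightarrow> nat" where
  "op_offset A i = 2 + length (basic_ops A) + (\<Sum>l<i. card (univ A) ^ op_arity A l)"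

lemma encode_algebra_simps:
  assumes "w = encode_algebra A"
  shows "2 \<le> length w" "w ! 0 = card (univ A)" "w ! 1 = length (basic_ops A)"
    "i < length (basic_ops A) \<Longrightarrow> 2 + i < length w \<and> w ! (2 + i) = op_arity A i"
  unfolding assms by (auto simp: encode_algebra_def nth_append)

lemma encode_algebra_entry:
  assumes "i < length (basic_ops A)" "j < card (univ A) ^ op_arity A i"
  shows "op_offset A i + j < length (encode_algebra A) \<and>
    encode_algebra A ! (op_offset A i + j) = op_table (card (univ A)) (basic_ops A ! i) ! j"
proof -
  let ?m = "card (univ A)"
  let ?T = "map (op_table ?m) (basic_ops A)"
  have "(\<Sum>l<i. length (?T ! l)) = (\<Sum>l<i. ?m ^ op_arity A l)"
    using assms(1) by (intro sum.cong) (auto simp: length_op_table)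
  then have "(\<Sum>l<i. ?m ^ op_arity A l) + j < length (concat ?T) \<and>
      concat ?T ! ((\<Sum>l<i. ?m ^ op_arity A l) + j) = ?T ! i ! j"
    using nth_concat_sum[of i ?T j] assms by (simp add: length_op_table)
  with assms(1) show ?thesis
    by (simp add: encode_algebra_def op_offset_def nth_append)
qed

lemma encode_algebra_apply:
  assumes "i < length (basic_ops A)" "length as = op_arity A i" "set as \<subseteq> {..<card (univ A)}"
  shows "encode_algebra A ! (op_offset A i + horner (card (univ A)) ((!) as) (op_arity A i)) =
    snd (basic_ops A ! i) as"
proof -
  have "horner (card (univ A)) ((!) as) (op_arity A i) < card (univ A) ^ op_arity A i"
    using assms by (intro horner_less) (metis lessThan_iff nth_mem subsetD)
  then show ?thesis using encode_algebra_entry[OF assms(1)] nth_op_table[OF assms(2,3)] by simp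
qed

lemma finite_algebra_apply:
  assumes "finite_algebra A" "i < length (basic_ops A)" "length as = op_arity A i" "set as \<subseteq> univ A"
  shows "snd (basic_ops A ! i) as \<in> univ A"
proof -
  obtain k f where kf: "basic_ops A ! i = (k, f)" by (rule prod.exhaust)
  then have "(k, f) \<in> set (basic_ops A)" using nth_mem[OF assms(2)] by simp
  with assms(1) have "\<forall>as. length as = k \<and> set as \<subseteq> univ A \<longrightarrow> f as \<in> univ A"
    unfolding finite_algebra_def by blast
  with assms(3,4) kf show ?thesis by simp
qed

locale encoded_algebra =
  fixes A :: "nat op_algebra" and n :: nat and \<sigma> :: "nat \<Rightarrow> nat \<Rightarrow> nat" and kmax :: nat
  assumes inst: "instance_algebra A"
    and n_pos: "1 \<le> n" and ops: "basic_ops A \<noteq> []"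
    and positive_arity: "\<And>i. i < length (basic_ops A) \<Longrightarrow> 1 \<le> op_arity A i \<and> op_arity A i \<le> kmax"
    and attained: "\<exists>i<length (basic_ops A). op_arity A i = kmax"
    and \<sigma>_less: "\<And>c i. c < n \<Longrightarrow> i < n \<Longrightarrow> \<sigma> c i < n"
begin

lemma fin_alg: "finite_algebra A" and univ_eq: "univ A = {..<card (univ A)}"
  using inst by (simp_all add: instance_algebra_def)

sublocale operation_tables "encode_algebra A" n "card (univ A)" "length (basic_ops A)" "op_arity A" "op_offset A" \<sigma> kmax
proof
  show "1 \<le> card (univ A)"
    using fin_alg by (auto simp: finite_algebra_def Suc_le_eq card_gt_0_iff)
  show "1 \<le> length (basic_ops A)" using ops by (simp add: Suc_le_eq)
  fix i assume i: "i < length (basic_ops A)"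
  show "2 + i < length (encode_algebra A) \<and> encode_algebra A ! (2 + i) = op_arity A i \<and>
      1 \<le> op_arity A i \<and> op_arity A i \<le> kmax"
    using encode_algebra_simps(4)[OF refl i] positive_arity[OF i] by blast
  fix j assume j: "j < card (univ A) ^ op_arity A i"
  let ?as = "product_lists (replicate (op_arity A i) [0..<card (univ A)]) ! j"
  have "?as \<in> set (product_lists (replicate (op_arity A i) [0..<card (univ A)]))"
    using j by (intro nth_mem) (simp add: length_product_lists_replicate)
  then have "length ?as = op_arity A i" "set ?as \<subseteq> {..<card (univ A)}"
    using in_product_lists_replicate by blast+
  then have "snd (basic_ops A ! i) ?as \<in> {..<card (univ A)}"
    using finite_algebra_apply[OF fin_alg i] univ_eq by simp
  then show "op_offset A i + j < length (encode_algebra A) \<and>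
      encode_algebra A ! (op_offset A i + j) < card (univ A)"
    using encode_algebra_entry[OF i j] j by (simp add: op_table_def length_product_lists_replicate)
qed (use n_pos attained \<sigma>_less in \<open>auto simp: op_offset_def\<close>)

text \<open>
  The value of a term in \<open>A ^ n\<close> at the generators of the subalgebra belonging to the tuple \<open>a\<close>: coordinate \<open>c\<close> is
  the value of the term at the \<open>c\<close>-th rearrangement of \<open>a\<close>.
\<close>

definition value_code :: "nat \<Rightarrow> ((nat \<Rightarrow> nat) \<Rightarrow> nat) \<Rightarrow> nat" where
  "value_code a t = code (\<lambda>c. t (\<lambda>i \<in> {..<n}. coord a (\<sigma> c i)))"

lemma coord_args_in: "(\<lambda>i \<in> {..<n}. coord a (\<sigma> c i)) \<in> {..<n} \<rightarrow>\<^sub>E univ A"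
  using coord_less univ_eq by auto

lemma coord_value_code:
  assumes "t \<in> term_ops A {..<n}" "c < n"
  shows "coord (value_code a t) c = t (\<lambda>i \<in> {..<n}. coord a (\<sigma> c i))"
proof -
  have "t (\<lambda>i \<in> {..<n}. coord a (\<sigma> c i)) < card (univ A)" for c
    using term_ops_closed[OF fin_alg assms(1) coord_args_in] univ_eq by auto
  then show ?thesis unfolding value_code_def using assms(2) by (intro coord_code)
qed

lemma value_code_comp:
  assumes i: "i < length (basic_ops A)" and ts: "length ts = op_arity A i" "\<forall>t \<in> set ts. t \<in> term_ops A {..<n}"
    and x: "\<And>j. j < op_arity A i \<Longrightarrow> x j = value_code a (ts ! j)"
  shows "apply_op i x = value_code a (\<lambda>y \<in> {..<n} \<rightarrow>\<^sub>E univ A. snd (basic_ops A ! i) (map (\<lambda>t. t y) ts))"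
  unfolding apply_op_def value_code_def
proof (rule code_cong)
  fix c assume c: "c < n"
  let ?y = "\<lambda>i \<in> {..<n}. coord a (\<sigma> c i)"
  let ?as = "map (\<lambda>t. t ?y) ts"
  have "horner (card (univ A)) (\<lambda>j. coord (x j) c) (op_arity A i) = horner (card (univ A)) ((!) ?as) (op_arity A i)"
  proof (rule horner_cong)
    fix j assume "j < op_arity A i"
    then show "coord (x j) c = ?as ! j" using x ts c coord_value_code by (simp add: ts(2))
  qed
  moreover have "set ?as \<subseteq> {..<card (univ A)}"
    using term_ops_closed[OF fin_alg _ coord_args_in] ts(2) univ_eq by auto
  ultimately show "encode_algebra A ! (op_offset A i + horner (card (univ A)) (\<lambda>j. coord (x j) c) (op_arity A i)) =
      (\<lambda>y \<in> {..<n} \<rightarrow>\<^sub>E univ A. snd (basic_ops A ! i) (map (\<lambda>t. t y) ts)) ?y"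
    using encode_algebra_apply[OF i, of ?as] ts(1) coord_args_in by simp
qed

text \<open>
  The generated subalgebra consists of the values of term operations: projections give the generators,
  and composition with a basic operation is application of this operation in \<open>A ^ n\<close>.
\<close>

lemma closure_eq_value_codes:
  "closure (generator a ` {..<n}) = value_code a ` term_ops A {..<n}"
proof
  show "closure (generator a ` {..<n}) \<subseteq> value_code a ` term_ops A {..<n}"
  proof
    fix x assume "x \<in> closure (generator a ` {..<n})"
    then show "x \<in> value_code a ` term_ops A {..<n}"
    proof induction
      case (base x)
      then obtain i where i: "i < n" "x = generator a i" by auto
      have "generator a i = value_code a (\<lambda>y \<in> {..<n} \<rightarrow>\<^sub>E univ A. y i)"
        unfolding generator_def value_code_def using i(1) coord_args_in by (intro code_cong) simp
      moreover have "(\<lambda>y \<in> {..<n} \<rightarrow>\<^sub>E univ A. y i) \<in> term_ops A {..<n}"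
        using i(1) by (intro term_ops.proj) simp
      ultimately show ?case using i(2) by blast
    next
      case (step i x)
      then have "\<forall>j. \<exists>t. j < op_arity A i \<longrightarrow> t \<in> term_ops A {..<n} \<and> x j = value_code a t" by blast
      then obtain t where t: "\<And>j. j < op_arity A i \<Longrightarrow> t j \<in> term_ops A {..<n} \<and> x j = value_code a (t j)"
        by metis
      let ?ts = "map t [0..<op_arity A i]"
      have "apply_op i x = value_code a (\<lambda>y \<in> {..<n} \<rightarrow>\<^sub>E univ A. snd (basic_ops A ! i) (map (\<lambda>t. t y) ?ts))"
        using step.hyps(1) t by (intro value_code_comp) auto
      moreover have "(\<lambda>y \<in> {..<n} \<rightarrow>\<^sub>E univ A. snd (basic_ops A ! i) (map (\<lambda>t. t y) ?ts)) \<in> term_ops A {..<n}"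
        using step.hyps(1) t by (intro term_ops.comp[of "op_arity A i"]) auto
      ultimately show ?case by blast
    qed
  qed
  show "value_code a ` term_ops A {..<n} \<subseteq> closure (generator a ` {..<n})"
  proof (rule image_subsetI)
    fix t assume "t \<in> term_ops A {..<n}"
    then show "value_code a t \<in> closure (generator a ` {..<n})"
    proof induction
      case (proj i)
      then have eq: "value_code a (\<lambda>y \<in> {..<n} \<rightarrow>\<^sub>E univ A. y i) = generator a i"
        unfolding generator_def value_code_def using coord_args_in by (intro code_cong) simp
      show ?case unfolding eq using proj by (intro closure.base) auto
    next
      case (comp k f ts)
      then obtain i where i: "i < length (basic_ops A)" "basic_ops A ! i = (k, f)"
        by (auto simp: in_set_conv_nth)
      have "apply_op i (\<lambda>j. value_code a (ts ! j)) \<in> closure (generator a ` {..<n})"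
        using comp i by (intro closure.step) auto
      moreover have "apply_op i (\<lambda>j. value_code a (ts ! j)) =
          value_code a (\<lambda>y \<in> {..<n} \<rightarrow>\<^sub>E univ A. snd (basic_ops A ! i) (map (\<lambda>t. t y) ts))"
        using comp i by (intro value_code_comp) auto
      ultimately have "value_code a (\<lambda>y \<in> {..<n} \<rightarrow>\<^sub>E univ A. snd (basic_ops A ! i) (map (\<lambda>t. t y) ts))
          \<in> closure (generator a ` {..<n})" by (simp only:)
      then show ?case unfolding i(2) snd_conv .
    qed
  qed
qed

lemma meets_constant_iff: "meets_constant a \<longleftrightarrow> (\<exists>t \<in> term_ops A {..<n}. \<exists>d. \<forall>c<n. t (\<lambda>i \<in> {..<n}. coord a (\<sigma> c i)) = d)"
proof
  assume "meets_constant a"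
  then obtain d t where d: "d < card (univ A)" "t \<in> term_ops A {..<n}" "const_code d = value_code a t"
    unfolding meets_constant_def closure_eq_value_codes by blast
  have "t (\<lambda>i \<in> {..<n}. coord a (\<sigma> c i)) = d" if "c < n" for c
    using coord_value_code[OF d(2) that, of a] coord_code[of "\<lambda>_. d" c] d(1,3) that
    by (simp add: const_code_def)
  with d(2) show "\<exists>t \<in> term_ops A {..<n}. \<exists>d. \<forall>c<n. t (\<lambda>i \<in> {..<n}. coord a (\<sigma> c i)) = d" by blast
next
  assume "\<exists>t \<in> term_ops A {..<n}. \<exists>d. \<forall>c<n. t (\<lambda>i \<in> {..<n}. coord a (\<sigma> c i)) = d"
  then obtain t d where t: "t \<in> term_ops A {..<n}" "\<And>c. c < n \<Longrightarrow> t (\<lambda>i \<in> {..<n}. coord a (\<sigma> c i)) = d"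
    by blast
  have "d < card (univ A)"
    using t(2)[of 0] term_ops_closed[OF fin_alg t(1) coord_args_in] univ_eq n_pos by fastforce
  moreover have "value_code a t = const_code d"
    unfolding value_code_def const_code_def using t(2) by (intro code_cong)
  ultimately show "meets_constant a" unfolding meets_constant_def closure_eq_value_codes using t(1) by force
qed

lemma all_meet_iff_local_sym: "(\<forall>a<M. meets_constant a) \<longleftrightarrow> local_sym n \<sigma> A"
proof
  assume all: "\<forall>a<M. meets_constant a"
  show "local_sym n \<sigma> A"
    unfolding local_sym_def
  proof
    fix x assume x: "x \<in> {..<n} \<rightarrow>\<^sub>E univ A"
    then have less: "x i < card (univ A)" if "i < n" for i using that univ_eq by auto
    have eq: "(\<lambda>i \<in> {..<n}. coord (code x) (\<sigma> c i)) = (\<lambda>i \<in> {..<n}. x (\<sigma> c i))" if "c < n" for c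
      using coord_code[of x] less \<sigma>_less[OF that] by (intro restrict_ext) simp
    have "code x < M" by (rule code_less) (rule less)
    then have "meets_constant (code x)" using all by blast
    then obtain t d where t: "t \<in> term_ops A {..<n}"
      "\<And>c. c < n \<Longrightarrow> t (\<lambda>i \<in> {..<n}. coord (code x) (\<sigma> c i)) = d"
      unfolding meets_constant_iff by blast
    have "t (\<lambda>i \<in> {..<n}. x (\<sigma> c i)) = d" if "c < n" for c
      using t(2)[OF that] unfolding eq[OF that] .
    with t(1) show "\<exists>t \<in> term_ops A {..<n}. \<exists>d. \<forall>c<n. t (\<lambda>i \<in> {..<n}. x (\<sigma> c i)) = d"
      by blast
  qed
next
  assume loc: "local_sym n \<sigma> A"
  show "\<forall>a<M. meets_constant a"
  proof (intro allI impI)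
    fix a
    let ?x = "\<lambda>i \<in> {..<n}. coord a i"
    have "?x \<in> {..<n} \<rightarrow>\<^sub>E univ A" using coord_less univ_eq by auto
    then obtain t d where t: "t \<in> term_ops A {..<n}" "\<And>c. c < n \<Longrightarrow> t (\<lambda>i \<in> {..<n}. ?x (\<sigma> c i)) = d"
      using loc unfolding local_sym_def by blast
    have eq: "(\<lambda>i \<in> {..<n}. ?x (\<sigma> c i)) = (\<lambda>i \<in> {..<n}. coord a (\<sigma> c i))" if "c < n" for c
      using \<sigma>_less[OF that] by (intro restrict_ext) simp
    have "t (\<lambda>i \<in> {..<n}. coord a (\<sigma> c i)) = d" if "c < n" for c
      using t(2)[OF that] unfolding eq[OF that] .
    with t(1) show "meets_constant a" unfolding meets_constant_iff by blast
  qed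
qed

end

section \<open>The decision procedure\<close>

text \<open>
  A halted machine does not move, so a bound on the running time can be raised to exactly the required
  number of steps.
\<close>

lemma decidable_in_timeI:
  assumes "wf_com c"
    and "\<And>A. instance_algebra A \<Longrightarrow> runs (encode_algebra A) c (\<lambda>_ _. 0) (C * max 1 (g A))
      (\<lambda>t. t 0 0 = (if Q A then 1 else 0))"
  shows "decidable_in_time Q g"
  unfolding decidable_in_time_def
proof (intro exI allI impI)
  fix A assume A: "instance_algebra A"
  let ?P = "compile c 0" and ?w = "encode_algebra A" and ?s = "(\<lambda>_ _. 0) :: store"
  let ?T = "10 * C * max 1 (g A)"
  have "code_at ?P 0 ?P" by (simp add: code_at_def)
  moreover have "represents (\<lambda>_. 0) ?s" by (simp add: represents_def)
  ultimately obtain R where R: "reaches ?P ?w (10 * cost ?w c ?s) (0, \<lambda>_. 0) (length ?P, R)"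
    "represents R (sem ?w c ?s)"
    using compile_correct[OF assms(1)] by fastforce
  then obtain T where T: "T \<le> 10 * cost ?w c ?s" "(ram_step ?P ?w ^^ T) (0, \<lambda>_. 0) = (length ?P, R)"
    by (auto simp: reaches_def)
  have run: "cost ?w c ?s \<le> C * max 1 (g A)" "sem ?w c ?s 0 0 = (if Q A then 1 else 0)"
    using assms(2)[OF A] by (auto simp: runs_def)
  have "10 * cost ?w c ?s \<le> ?T" using run(1) by simp
  then obtain k where k: "?T = k + T" using T(1) by (metis le_add_diff_inverse2 le_trans)
  have halted: "(ram_step ?P ?w ^^ k) (length ?P, R) = (length ?P, R)" for k
    by (induction k) (simp_all add: ram_step_def)
  have "(ram_step ?P ?w ^^ ?T) (0, \<lambda>_. 0) = (length ?P, R)"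
    unfolding k funpow_add comp_apply T(2) by (rule halted)
  moreover have "R 0 = (if Q A then 1 else 0)"
    using represents_scalar[OF R(2), of 0] run(2) by simp
  ultimately show "ram_halts_with ?P ?w ?T (if Q A then 1 else 0)"
    by (simp add: ram_halts_with_def)
qed

text \<open>
  Computes the maximal arity, and in register 40 whether some operation is nullary.
\<close>

definition scan_com :: com where
  "scan_com = Lit 6 0 ;; Lit 40 0 ;; For 22 2 (Lit 20 2 ;; Plus 20 20 22 ;; Inp 19 20 ;;
     Cond 19 (Minus 20 19 6 ;; Cond 20 (Mov 6 19) skip) (Lit 40 1))"

lemma runs_scan_com:
  assumes "s 0 2 = r" and w: "\<And>i. i < r \<Longrightarrow> 2 + i < length w \<and> w ! (2 + i) = ar i"
  shows "runs w scan_com s (3 + 8 * r) (\<lambda>t. (\<forall>i<r. ar i \<le> t 0 6) \<and> (t 0 6 = 0 \<or> (\<exists>i<r. ar i = t 0 6)) \<and>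
    (t 0 40 \<noteq> 0 \<longleftrightarrow> (\<exists>i<r. ar i = 0)))"
  unfolding scan_com_def
  apply simp
proof (rule runs_For[where I = "\<lambda>i t. (\<forall>h<i. ar h \<le> t 0 6) \<and> (t 0 6 = 0 \<or> (\<exists>h<i. ar h = t 0 6)) \<and>
    (t 0 40 \<noteq> 0 \<longleftrightarrow> (\<exists>h<i. ar h = 0))" and B = "\<lambda>_. 7"], goal_cases)
  case (2 i t)
  then have i: "2 + i < length w" "w ! (2 + i) = ar i" using w[of i] assms(1) by simp_all
  have I: "\<forall>h<i. ar h \<le> t 0 6" "t 0 6 = 0 \<or> (\<exists>h<i. ar h = t 0 6)" "t 0 40 \<noteq> 0 \<longleftrightarrow> (\<exists>h<i. ar h = 0)"
    using 2(2) by blast+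
  consider "ar i = 0" | "0 < ar i" "ar i \<le> t 0 6" | "t 0 6 < ar i" by linarith
  then show ?case
  proof cases
    case 3
    with I(1) have "\<forall>h<i. ar h \<le> ar i" by fastforce
    with 3 i I(3) show ?thesis by (simp add: All_less_Suc Ex_less_Suc)
  qed (use i I in \<open>simp_all add: All_less_Suc Ex_less_Suc disj_commute\<close>)
qed (use assms in auto)

primrec tests_com :: "(nat \<times> (nat \<Rightarrow> nat \<Rightarrow> nat)) list \<Rightarrow> com" where
  "tests_com [] = skip"
| "tests_com (x # xs) = test_com (fst x) (snd x) ;; tests_com xs"

text \<open>
  The arity list is scanned only after the first arity has been found to be positive, as otherwise the
  time bound may be constant.
\<close>

definition main_com :: "(nat \<times> (nat \<Rightarrow> nat \<Rightarrow> nat)) list \<Rightarrow> com" where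
  "main_com xs = Lit 7 1 ;; Lit 8 0 ;; Inp 1 8 ;; Inp 2 7 ;; Lit 0 1 ;;
     Cond 2 (Lit 20 2 ;; Inp 19 20 ;; Cond 19 (scan_com ;; Cond 40 skip (tests_com xs)) skip)
       (Minus 20 1 7 ;; Cond 20 (Lit 0 0) skip)"

lemma wf_load_com: "wf_com (load_com xs j)"
  by (induction xs arbitrary: j) auto

lemma wf_test_com: "wf_com (test_com n \<sigma>)"
  by (simp add: test_com_def wf_load_com power_com_def table_com_def tick_def prepare_ops_com_def
      search_com_def clear_loop_def gens_com_def coords_loop_def generator_loop_def insert_com_def
      stage_com_def tuples_loop_def eval_com_def args_loop_def digits_loop_def result_loop_def check_com_def)

lemma wf_main_com: "wf_com (main_com xs)"
proof -
  have "wf_com (tests_com xs)" by (induction xs) (auto simp: wf_test_com)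
  then show ?thesis by (simp add: main_com_def scan_com_def)
qed

lemma alg_size_eq: "alg_size A = (\<Sum>i<length (basic_ops A). card (univ A) ^ op_arity A i)"
  by (simp add: alg_size_def sum_list_sum_nth atLeast0LessThan case_prod_beta)

lemma max_arity_eqI:
  assumes "\<And>i. i < length (basic_ops A) \<Longrightarrow> op_arity A i \<le> k" "\<exists>i<length (basic_ops A). op_arity A i = k"
  shows "max_arity A = k"
  unfolding max_arity_def
proof (rule Max_eqI)
  show "y \<le> k" if "y \<in> insert 0 (fst ` set (basic_ops A))" for y
    using that assms(1) by (auto simp: in_set_conv_nth) (metis fst_conv)
  show "k \<in> insert 0 (fst ` set (basic_ops A))"
    using assms(2) by (metis imageI insertCI nth_mem)
qed simp

definition time_const :: "nat \<Rightarrow> nat" where "time_const n = 130 + 41 * n + 9 * (n * n)"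

lemma runs_tests_com:
  assumes A: "instance_algebra A" "basic_ops A \<noteq> []"
    and ar: "\<And>i. i < length (basic_ops A) \<Longrightarrow> 1 \<le> op_arity A i \<and> op_arity A i \<le> kmax"
      "\<exists>i<length (basic_ops A). op_arity A i = kmax"
    and xs: "\<forall>(n, \<sigma>) \<in> set xs. 1 \<le> n \<and> n \<le> N \<and> (\<forall>c<n. \<forall>i<n. \<sigma> c i < n)"
    and s: "s 0 1 = card (univ A)" "s 0 2 = length (basic_ops A)" "s 0 6 = kmax" "s 0 7 = 1" "s 0 8 = 0"
  shows "runs (encode_algebra A) (tests_com xs) s
    (1 + length xs * time_const N * (kmax * alg_size A ^ (2 * N)))
    (\<lambda>t. t 0 0 = (if \<forall>(n, \<sigma>) \<in> set xs. local_sym n \<sigma> A then s 0 0 else 0))"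
  using xs s
proof (induction xs arbitrary: s)
  case (Cons x xs)
  obtain n \<sigma> where x: "x = (n, \<sigma>)" by (rule prod.exhaust)
  interpret encoded_algebra A n \<sigma> kmax
    using Cons.prems(1) A ar by unfold_locales (auto simp: x)
  let ?X = "kmax * alg_size A ^ (2 * N)"
  have "1 \<le> n" "n \<le> N" using Cons.prems(1) by (auto simp: x)
  have cells: "cells = alg_size A" by (simp add: cells_def alg_size_eq)
  then have "1 \<le> alg_size A" using r_le_cells r by simp
  then have pow: "alg_size A ^ (2 * n) \<le> alg_size A ^ (2 * N)"
    using \<open>n \<le> N\<close> by (intro power_increasing) auto
  have "time_const n \<le> time_const N"
    unfolding time_const_def using \<open>n \<le> N\<close> by (intro add_mono mult_mono) auto
  then have T: "test_time \<le> time_const N * ?X"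
    using test_time_le pow unfolding cells time_const_def[symmetric]
    by (meson le_trans mult_le_mono order_refl)
  note test = runs_test_com[of s, OF Cons.prems(2-6), unfolded all_meet_iff_local_sym]
  show ?case
    unfolding tests_com.simps x fst_conv snd_conv
  proof (rule runs_Seq[OF runs_mono[OF test T], where ?T2.0 = "1 + length xs * time_const N * ?X"], goal_cases)
    case (1 t)
    have "t 0 i = s 0 i" if "i \<in> {1, 2, 6, 7, 8}" for i
      by (rule 1(2)) (use that writes_test_com in blast)
    then have t: "t 0 1 = card (univ A)" "t 0 2 = length (basic_ops A)" "t 0 6 = kmax" "t 0 7 = 1" "t 0 8 = 0"
      using Cons.prems by simp_all
    show ?case
      by (rule runs_frame[OF Cons.IH[of t, OF _ t]]) (use Cons.prems(1) 1(1) in auto)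
  qed (simp add: algebra_simps)
qed simp

text \<open>
  The decision procedure for any conjunction of local conditions. The hypotheses on algebras without
  operations and with a nullary operation describe the instances that are answered without running a test.
\<close>

lemma decidable_by_local_tests:
  fixes xs :: "(nat \<times> (nat \<Rightarrow> nat \<Rightarrow> nat)) list"
  assumes N: "1 \<le> N" and xs: "\<forall>(n, \<sigma>) \<in> set xs. 1 \<le> n \<and> n \<le> N \<and> (\<forall>c<n. \<forall>i<n. \<sigma> c i < n)"
    and tests: "\<And>A. instance_algebra A \<Longrightarrow> Q A \<longleftrightarrow> (\<forall>(n, \<sigma>) \<in> set xs. local_sym n \<sigma> A)"
    and no_ops: "\<And>A. instance_algebra A \<Longrightarrow> basic_ops A = [] \<Longrightarrow> Q A \<longleftrightarrow> card (univ A) = 1"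
    and nullary: "\<And>A f. instance_algebra A \<Longrightarrow> (0, f) \<in> set (basic_ops A) \<Longrightarrow> Q A"
  shows "decidable_in_time Q (\<lambda>A. max_arity A * alg_size A ^ (2 * N))"
proof (rule decidable_in_timeI[OF wf_main_com])
  fix A assume A: "instance_algebra A"
  let ?w = "encode_algebra A" and ?m = "card (univ A)" and ?r = "length (basic_ops A)"
  let ?g = "max_arity A * alg_size A ^ (2 * N)"
  let ?C = "30 + length xs * time_const N"
  define answer where "answer = (\<lambda>t :: store. t 0 0 = (if Q A then 1 else 0))"
  have m: "1 \<le> ?m"
    using A by (auto simp: instance_algebra_def finite_algebra_def Suc_le_eq card_gt_0_iff)
  note w = encode_algebra_simps[of "encode_algebra A" A, OF refl]
  define s where "s = upd (upd (upd (upd (upd (\<lambda>_ _. 0) 0 7 1) 0 8 0) 0 1 ?m) 0 2 ?r) 0 0 1"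
  have nullaryI: "Q A" if "i < ?r" "op_arity A i = 0" for i
    using nullary[OF A, of "snd (basic_ops A ! i)"] that nth_mem[of i "basic_ops A"]
    by (metis prod.collapse)
  define T where "T = ?C * max 1 ?g"
  have T: "30 \<le> T" unfolding T_def by (rule order_trans[of _ "?C * 1"]) (simp, intro mult_left_mono, auto)
  have scan: "runs ?w (scan_com ;; Cond 40 skip (tests_com xs)) u (T - 10) answer"
    if ops: "basic_ops A \<noteq> []" "op_arity A 0 \<noteq> 0" and u: "\<And>i. i \<notin> {19, 20} \<Longrightarrow> u 0 i = s 0 i" for u
  proof -
    have ne: "0 < ?r" using ops by simp
    have "op_arity A 0 \<le> max_arity A"
      unfolding max_arity_def using nth_mem[OF ne] by (intro Max_ge) auto
    then have "1 \<le> max_arity A" using ops(2) by simp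
    moreover have "(\<Sum>i<?r. 1) \<le> alg_size A" unfolding alg_size_eq using m by (intro sum_mono) simp
    then have r: "?r \<le> alg_size A" by simp
    then have "1 \<le> alg_size A" using ne by linarith
    then have "alg_size A \<le> alg_size A ^ (2 * N)" using N by (intro self_le_power) auto
    with r have "?r \<le> alg_size A ^ (2 * N)" by linarith
    \<comment> \<open>the budget suffices for reading all arities, since each operation has a nonempty table\<close>
    ultimately have g: "?r \<le> ?g" by (metis mult_le_mono nat_mult_1)
    then have g1: "max 1 ?g = ?g" using ne by (intro max_absorb2) linarith
    have time: "(3 + 8 * ?r) + (2 + (1 + length xs * time_const N * ?g)) \<le> T - 10"
      using g ne unfolding T_def g1 add_mult_distrib by linarith
    have "?w ! (2 + i) = op_arity A i" "2 + i < length ?w" if "i < ?r" for i using w(4)[OF that] by auto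
    then have sc: "runs ?w scan_com u (3 + 8 * ?r) (\<lambda>t. (\<forall>i<?r. op_arity A i \<le> t 0 6) \<and>
        (t 0 6 = 0 \<or> (\<exists>i<?r. op_arity A i = t 0 6)) \<and> (t 0 40 \<noteq> 0 \<longleftrightarrow> (\<exists>i<?r. op_arity A i = 0)))"
      using u[of 2] by (intro runs_scan_com) (auto simp: s_def)
    show ?thesis
    proof (rule runs_Seq[OF sc _ time], goal_cases)
      case (1 t)
      have t: "t 0 i = s 0 i" if "i \<in> {0, 1, 2, 7, 8}" for i
      proof -
        have "t 0 i = u 0 i" by (rule 1(2)) (use that in \<open>auto simp: scan_com_def\<close>)
        also have "\<dots> = s 0 i" by (rule u) (use that in auto)
        finally show ?thesis .
      qed
      have regs: "t 0 0 = 1" "t 0 1 = ?m" "t 0 2 = ?r" "t 0 7 = 1" "t 0 8 = 0"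
        using t[of 0] t[of 1] t[of 2] t[of 7] t[of 8] by (simp_all add: s_def)
      show ?case
      proof (cases "\<exists>i<?r. op_arity A i = 0")
        case True
        then have "Q A" using nullaryI by blast
        with True 1(1) regs show ?thesis by (simp add: answer_def)
      next
        case False
        then have ar: "1 \<le> op_arity A i \<and> op_arity A i \<le> t 0 6" if "i < ?r" for i
          using that 1(1) by (simp add: Suc_le_eq)
        then have att: "\<exists>i<?r. op_arity A i = t 0 6" using 1(1) ne by fastforce
        have k: "max_arity A = t 0 6" using ar att by (intro max_arity_eqI) auto
        have "runs ?w (tests_com xs) t (1 + length xs * time_const N * ?g) answer"
          using runs_tests_com[of A "t 0 6" xs N t, OF A ops(1) ar att xs regs(2,3) refl regs(4,5)] tests[OF A] regs(1)
          unfolding k answer_def by (simp split del: if_split cong: if_cong)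
        then show ?thesis using 1(1) False by (simp add: runs_mono)
      qed
    qed
  qed
  show "runs ?w (main_com xs) (\<lambda>_ _. 0) (?C * max 1 ?g) (\<lambda>t. t 0 0 = (if Q A then 1 else 0))"
    unfolding T_def[symmetric] answer_def[symmetric]
  proof (cases "basic_ops A = []")
    case True
    then show "runs ?w (main_com xs) (\<lambda>_ _. 0) T answer"
      using T w m no_ops[OF A True] by (auto simp: main_com_def answer_def)
  next
    case False
    then have ne: "0 < ?r" by simp
    have w2: "2 < length ?w" "?w ! 2 = op_arity A 0" using w(4)[OF ne] by auto
    let ?u = "upd (upd s 0 20 2) 0 19 (op_arity A 0)"
    have rest: "runs ?w (Cond 19 (scan_com ;; Cond 40 skip (tests_com xs)) skip) ?u (T - 8) answer"
    proof (cases "op_arity A 0 = 0")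
      case True
      then have "Q A" using nullaryI ne by blast
      moreover have "1 \<le> T - 8" "1 \<le> T - 8 - 1" using T by linarith+
      ultimately show ?thesis using True by (simp add: answer_def s_def)
    next
      case nz: False
      have "runs ?w (scan_com ;; Cond 40 skip (tests_com xs)) ?u (T - 10) answer"
        by (rule scan[OF False nz]) auto
      then show ?thesis using nz T by (auto elim: runs_mono)
    qed
    define U where "U = T - 8"
    have U: "T = 8 + U" using T by (simp add: U_def)
    have branch: "runs ?w (Cond 2 (Lit 20 2 ;; Inp 19 20 ;; Cond 19 (scan_com ;; Cond 40 skip (tests_com xs)) skip)
       (Minus 20 1 7 ;; Cond 20 (Lit 0 0) skip)) s (3 + U) answer"
      by (subst runs_simps(8))
        (use rest w2 ne in \<open>simp add: U s_def del: runs_simps(8)\<close>)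
    have "0 < length ?w" "1 < length ?w" using w(1) by linarith+
    then show "runs ?w (main_com xs) (\<lambda>_ _. 0) T answer"
      using branch w(2,3) by (simp add: main_com_def U s_def del: runs_simps(8))
  qed
qed

lemma decidable_trivially:
  assumes "\<And>A. instance_algebra A \<Longrightarrow> Q A"
  shows "decidable_in_time Q g"
  by (rule decidable_in_timeI[of "Lit 0 1" 1]) (use assms in auto)

text \<open>
  The only terms are projections, and one that is invariant under a group element moving its variable
  forces the universe to be a singleton.
\<close>

lemma satisfies_sym_no_ops:
  assumes A: "finite_algebra A" "basic_ops A = []" and X: "finite X" "X \<noteq> {}"
    and H: "\<And>\<pi> i. \<pi> \<in> H \<Longrightarrow> i \<in> X \<Longrightarrow> \<pi> i \<in> X" and moves: "\<And>i. i \<in> X \<Longrightarrow> \<exists>\<pi> \<in> H. \<pi> i \<noteq> i"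
  shows "satisfies_sym X H A \<longleftrightarrow> card (univ A) = 1"
proof
  assume "satisfies_sym X H A"
  then obtain t where t: "t \<in> term_ops A X"
    "\<And>\<pi> x. \<pi> \<in> H \<Longrightarrow> x \<in> X \<rightarrow>\<^sub>E univ A \<Longrightarrow> t x = t (\<lambda>i \<in> X. x (\<pi> i))"
    by (auto simp: satisfies_sym_def permute_args_def)
  from t(1) A(2) obtain i where i: "i \<in> X" "t = (\<lambda>x \<in> X \<rightarrow>\<^sub>E univ A. x i)"
    by cases auto
  obtain \<pi> where \<pi>: "\<pi> \<in> H" "\<pi> i \<noteq> i" using moves[OF i(1)] by blast
  have "a = b" if ab: "a \<in> univ A" "b \<in> univ A" for a b
  proof -
    define x where "x = (\<lambda>j \<in> X. if j = i then a else b)"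
    have x: "x \<in> X \<rightarrow>\<^sub>E univ A" using ab by (auto simp: x_def)
    have "(\<lambda>i \<in> X. x (\<pi> i)) \<in> X \<rightarrow>\<^sub>E univ A" using x H[OF \<pi>(1)] by auto
    then have "x i = x (\<pi> i)" using t(2)[OF \<pi>(1) x] x i by simp
    then show ?thesis using \<pi> i(1) H[OF \<pi>(1) i(1)] by (simp add: x_def)
  qed
  moreover obtain a where "a \<in> univ A" using A(1) by (auto simp: finite_algebra_def)
  ultimately have "univ A = {a}" by blast
  then show "card (univ A) = 1" by simp
next
  assume "card (univ A) = 1"
  then obtain a where a: "univ A = {a}" by (auto simp: card_1_singleton_iff)
  obtain i where i: "i \<in> X" using X by blast
  let ?t = "\<lambda>x \<in> X \<rightarrow>\<^sub>E univ A. x i"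
  have t: "?t \<in> term_ops A X" using i by (rule term_ops.proj)
  have "?t x = permute_args A X \<pi> ?t x" if "\<pi> \<in> H" "x \<in> X \<rightarrow>\<^sub>E univ A" for \<pi> x
  proof -
    have "(\<lambda>i \<in> X. x (\<pi> i)) \<in> X \<rightarrow>\<^sub>E univ A" using that H[OF that(1)] by auto
    then have val: "?t x \<in> univ A" "?t (\<lambda>i \<in> X. x (\<pi> i)) \<in> univ A"
      using term_ops_closed[OF A(1) t] that(2) by blast+
    have eq: "y = a" if "y \<in> univ A" for y using that a by simp
    have "permute_args A X \<pi> ?t x = ?t (\<lambda>i \<in> X. x (\<pi> i))"
      by (simp only: permute_args_def restrict_apply'[OF that(2)])
    also have "\<dots> = ?t x" by (rule trans[OF eq[OF val(2)] eq[OF val(1), symmetric]])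
    finally show ?thesis by (rule sym)
  qed
  with t show "satisfies_sym X H A" unfolding satisfies_sym_def by blast
qed

lemma satisfies_sym_nullary:
  assumes "(0, f) \<in> set (basic_ops A)" and H: "\<And>\<pi> i. \<pi> \<in> H \<Longrightarrow> i \<in> X \<Longrightarrow> \<pi> i \<in> X"
  shows "satisfies_sym X H A"
proof -
  let ?t = "\<lambda>x \<in> X \<rightarrow>\<^sub>E univ A. f (map (\<lambda>t. t x) [])"
  have "?t \<in> term_ops A X" using assms(1) by (rule term_ops.comp) auto
  moreover have "?t x = permute_args A X \<pi> ?t x" if "\<pi> \<in> H" "x \<in> X \<rightarrow>\<^sub>E univ A" for \<pi> x
  proof -
    have "(\<lambda>i \<in> X. x (\<pi> i)) \<in> X \<rightarrow>\<^sub>E univ A" using that H[OF that(1)] by auto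
    then show ?thesis using that(2) by (simp add: permute_args_def)
  qed
  ultimately show ?thesis unfolding satisfies_sym_def by blast
qed

text \<open>
  For the trivial group there is nothing to compute. Otherwise left translation by an element other than
  the unit moves every point.
\<close>

theorem decidable_regular:
  fixes G :: "('g, 'm) monoid_scheme"
  assumes "group G" "finite (carrier G)"
  shows "decidable_in_time (satisfies_sym (carrier G) (left_translations G))
    (\<lambda>A. max_arity A * alg_size A ^ (2 * card (carrier G)))"
proof -
  interpret G: group G by fact
  interpret regular_perms "carrier G" "left_translations G" "\<lambda>g. \<lambda>x \<in> carrier G. g \<otimes>\<^bsub>G\<^esub> x"
    by (rule regular_perms_left_translations[OF assms])
  let ?n = "card (carrier G)"
  have n: "1 \<le> ?n" using assms(2) G.one_closed by (auto simp: Suc_le_eq card_gt_0_iff)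
  obtain \<sigma> where \<sigma>: "\<forall>c<?n. \<forall>i<?n. \<sigma> c i < ?n"
    "\<And>A :: nat op_algebra. finite_algebra A \<Longrightarrow>
      satisfies_sym (carrier G) (left_translations G) A = local_sym ?n \<sigma> A"
    using satisfies_iff_local_sym[where 'a = nat] by blast
  show ?thesis
  proof (cases "?n = 1")
    case True
    then have X: "carrier G = {\<one>\<^bsub>G\<^esub>}"
      using G.one_closed by (metis card_1_singletonE singletonD)
    show ?thesis
    proof (rule decidable_trivially)
      fix A :: "nat op_algebra" assume "instance_algebra A"
      let ?t = "\<lambda>x \<in> carrier G \<rightarrow>\<^sub>E univ A. x \<one>\<^bsub>G\<^esub>"
      have t: "?t \<in> term_ops A (carrier G)" by (intro term_ops.proj) simp
      have "locally A"
        unfolding locally_def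
      proof
        fix x assume x: "x \<in> carrier G \<rightarrow>\<^sub>E univ A"
        have "?t (\<lambda>i \<in> carrier G. x (\<pi> i)) = x \<one>\<^bsub>G\<^esub>" if "\<pi> \<in> left_translations G" for \<pi>
        proof -
          have "\<pi> \<one>\<^bsub>G\<^esub> = \<one>\<^bsub>G\<^esub>" using perm[OF that G.one_closed] X by auto
          then show ?thesis
            unfolding restrict_apply'[OF permuted[OF that x]] restrict_apply'[OF G.one_closed] by simp
        qed
        with t show "\<exists>t \<in> term_ops A (carrier G). \<exists>d. \<forall>\<pi> \<in> left_translations G.
            t (\<lambda>i \<in> carrier G. x (\<pi> i)) = d" by blast
      qed
      then show "satisfies_sym (carrier G) (left_translations G) A"
        using satisfies_iff_locally \<open>instance_algebra A\<close> unfolding instance_algebra_def by blast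
    qed
  next
    case False
    have moves: "\<exists>\<pi> \<in> left_translations G. \<pi> i \<noteq> i" if i: "i \<in> carrier G" for i
    proof -
      have "carrier G \<noteq> {\<one>\<^bsub>G\<^esub>}" using False by auto
      then obtain g where g: "g \<in> carrier G" "g \<noteq> \<one>\<^bsub>G\<^esub>" using G.one_closed by blast
      then have "g \<otimes>\<^bsub>G\<^esub> i \<noteq> i" using i by (simp add: G.r_cancel_one)
      then show ?thesis using g(1) i by (auto simp: left_translations_def)
    qed
    show ?thesis
    proof (rule decidable_by_local_tests[of ?n "[(?n, \<sigma>)]"])
      fix A :: "nat op_algebra" assume "instance_algebra A"
      then have A: "finite_algebra A" by (simp add: instance_algebra_def)
      show "satisfies_sym (carrier G) (left_translations G) A \<longleftrightarrow> (\<forall>(n, \<sigma>) \<in> set [(?n, \<sigma>)]. local_sym n \<sigma> A)"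
        using \<sigma>(2)[OF A] by simp
      show "satisfies_sym (carrier G) (left_translations G) A \<longleftrightarrow> card (univ A) = 1" if "basic_ops A = []"
        using A that finite_X X_nonempty perm moves by (rule satisfies_sym_no_ops)
      show "satisfies_sym (carrier G) (left_translations G) A" if "(0, f) \<in> set (basic_ops A)" for f
        using that perm by (rule satisfies_sym_nullary)
    qed (use n \<sigma>(1) in auto)
  qed
qed

text \<open>
  One local test for each prime divisor of \<open>n\<close>; all of them fit into the time for the largest one.
\<close>

theorem decidable_cyclic:
  assumes "2 \<le> n"
  shows "decidable_in_time (satisfies_sym {1..n} (cyclic_perms n))
    (\<lambda>A. max_arity A * alg_size A ^ (2 * largest_prime_divisor n))"
proof -
  let ?P = "{p. prime p \<and> p dvd n}"
  have fin: "finite ?P" by (rule finite_subset[of _ "{..n}"]) (use assms in \<open>auto dest: dvd_imp_le\<close>)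
  have le: "p \<le> largest_prime_divisor n" if "p \<in> ?P" for p
    unfolding largest_prime_divisor_def using fin that by (rule Max_ge)
  have "\<exists>\<sigma>. (\<forall>c<p. \<forall>i<p. \<sigma> c i < p) \<and> (\<forall>A :: nat op_algebra. finite_algebra A \<longrightarrow>
      satisfies_sym {1..p} (cyclic_perms p) A = local_sym p \<sigma> A)" if "1 \<le> p" for p
    using regular_perms.satisfies_iff_local_sym[OF regular_perms_cyclic[OF that], where 'a = nat] by simp
  then obtain \<sigma> where \<sigma>: "\<And>p. 1 \<le> p \<Longrightarrow> \<forall>c<p. \<forall>i<p. \<sigma> p c i < p"
    "\<And>p A. 1 \<le> p \<Longrightarrow> finite_algebra (A :: nat op_algebra) \<Longrightarrow>
      satisfies_sym {1..p} (cyclic_perms p) A = local_sym p (\<sigma> p) A"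
    by metis
  let ?xs = "map (\<lambda>p. (p, \<sigma> p)) (sorted_list_of_set ?P)"
  interpret regular_perms "{1..n}" "cyclic_perms n" "rotation n"
    using assms by (intro regular_perms_cyclic) simp
  obtain q where q: "prime q" "q dvd n" using prime_factor_nat[of n] assms by auto
  show ?thesis
  proof (rule decidable_by_local_tests[of _ ?xs])
    show "1 \<le> largest_prime_divisor n" using le[of q] q prime_ge_1_nat[OF q(1)] by simp
    show "\<forall>(k, \<tau>) \<in> set ?xs. 1 \<le> k \<and> k \<le> largest_prime_divisor n \<and> (\<forall>c<k. \<forall>i<k. \<tau> c i < k)"
      using fin le \<sigma>(1) prime_ge_1_nat by auto
    fix A :: "nat op_algebra" assume "instance_algebra A"
    then have A: "finite_algebra A" by (simp add: instance_algebra_def)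
    have "satisfies_sym {1..n} (cyclic_perms n) A \<longleftrightarrow> (\<forall>p \<in> ?P. \<exists>t. cyclic_term p A t)"
      using satisfies_cyclic_iff[OF A] cyclic_term_iff_primes[OF A] assms by auto
    also have "\<dots> \<longleftrightarrow> (\<forall>p \<in> ?P. local_sym p (\<sigma> p) A)"
      using satisfies_cyclic_iff[OF A] \<sigma>(2)[OF _ A] prime_ge_1_nat by auto
    finally show "satisfies_sym {1..n} (cyclic_perms n) A \<longleftrightarrow> (\<forall>(k, \<tau>) \<in> set ?xs. local_sym k \<tau> A)"
      using fin by simp
    have moves: "\<exists>\<pi> \<in> cyclic_perms n. \<pi> i \<noteq> i" if "i \<in> {1..n}" for i
    proof (rule bexI[of _ "cyclic_shift n"])
      show "cyclic_shift n i \<noteq> i" using that assms by (auto simp: cyclic_shift_def)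
      show "cyclic_shift n \<in> cyclic_perms n" unfolding cyclic_perms_def by (intro generate.incl) simp
    qed
    show "satisfies_sym {1..n} (cyclic_perms n) A \<longleftrightarrow> card (univ A) = 1" if "basic_ops A = []"
      using A that finite_X X_nonempty perm moves by (rule satisfies_sym_no_ops)
    show "satisfies_sym {1..n} (cyclic_perms n) A" if "(0, f) \<in> set (basic_ops A)" for f
      using that perm by (rule satisfies_sym_nullary)
  qed
qed

theorem corollary14:
  shows "(\<forall>G :: ('g, 'm) monoid_scheme. group G \<and> finite (carrier G) \<longrightarrow>
            decidable_in_time (satisfies_sym (carrier G) (left_translations G))
              (\<lambda>A. max_arity A * alg_size A ^ (2 * card (carrier G))))
       \<and> (\<forall>n \<ge> 2.
            decidable_in_time (satisfies_sym {1..n} (cyclic_perms n))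
              (\<lambda>A. max_arity A * alg_size A ^ (2 * largest_prime_divisor n)))"
  using decidable_regular decidable_cyclic by blast

end
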